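(* Let $\Omega\subset\mathbb{C}^n$ be a bounded domain with Bergman kernel $\mathcal{B}$, and let $\Phi:\Omega\to\mathcal{P}(\Omega,dV)$, $\Phi(z)=P(z,\xi)\,dV(\xi)$, $P(z,\xi)=\frac{|\mathcal{B}(z,\xi)|^2}{\mathcal{B}(z,z)}$, be its Bergman statistical model. Then: (1) If $\Omega$ satisfies Condition $C_6$, then $\Phi^*T=0$, where $T$ is the Amari–Chentsov tensor. (2) If $\Omega$ satisfies Condition $C_6$, then $\Phi^*\nabla^{(\alpha)}=\nabla^{LC}$ for all $\alpha\in\mathbb{R}$, where $\nabla^{(\alpha)}$ is the $\alpha$-connection and $\nabla^{LC}$ is the Levi-Civita connection of the Bergman metric. (3) If $\mathcal{B}(\cdot,z)\log\frac{\mathcal{B}(\cdot,z)}{\mathcal{B}(\cdot,w)}\in A^2(\Omega)$ for all $z,w\in\Omega$, then $$\Phi^*D^{(1)}(z,w)=\mathcal{D}(z,w)=\Phi^*D^{(-1)}(z,w)\quad\text{for all }z,w\in\Omega,$$ where $D^{(\pm1)}$ are the Kullback–Leibler divergences and $\mathcal{D}$ is the diastasis function. (4) If $\mathcal{B}(\cdot,z)\log\mathcal{B}(\cdot,z)\in A^2(\Omega)$ for all $z\in\Omega$, then the Shannon entropy satisfies $H(\Phi(z))=-\log\mathcal{B}(z,z)$ for all $z\in\Omega$.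
   Context: $A^2(\Omega)$ is the space of $L^2$ holomorphic functions on $\Omega$ (Lebesgue measure $dV$), $\mathcal{B}$ its reproducing kernel. The Bergman metric is $g_{\alpha\overline\beta}=\partial_\alpha\partial_{\overline\beta}\log\mathcal{B}(z,z)$. The conditions in (3), (4) include that the logarithms are taken with (holomorphic) single-valued branches. $\mathcal{P}(\Omega,dV)$ is the set of probability measures with a.e. positive density. Let $l=\log P$, derivatives in $z$, and $\mathrm{E}_z[f]=\int_\Omega f(\xi)P(z,\xi)\,dV(\xi)$. With $\partial_i$ coordinate derivatives in the (real, $2n$-dimensional) coordinates of the parameter space (extended complex-linearly): the Fisher information metric pulled back to $\Omega$ is $\mathrm{E}_z[(\partial_il)(\partial_jl)]$; the Amari–Chentsov tensor is $(T_{ijk})_z=\mathrm{E}_z[(\partial_il)(\partial_jl)(\partial_kl)]$; the $\alpha$-connection is defined by $g_F(\nabla^{(\alpha)}_{\partial_i}\partial_j,\partial_k)=\mathrm{E}_z[(\partial_i\partial_jl)(\partial_kl)]+\frac{1-\alpha}{2}\mathrm{E}_z[(\partial_il)(\partial_jl)(\partial_kl)]$. $\Phi^*$ denotes viewing these objects on $\Omega$. Divergences: $D^{(\alpha)}(\mu_1,\mu_2)=\int\chi^{(\alpha)}\big(\frac{d\mu_2}{d\mu_1}\big)d\mu_1$ with $\chi^{(1)}(x)=x\log x$, $\chi^{(-1)}(x)=-\log x$; $\Phi^*D^{(\alpha)}(z,w)=D^{(\alpha)}(\Phi(z),\Phi(w))$. Diastasis: $\mathcal{D}(z,w)=\log\frac{\mathcal{B}(z,z)\mathcal{B}(w,w)}{|\mathcal{B}(z,w)|^2}$.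 Entropy: $H(\Phi(z))=-\int_\Omega P(z,\xi)\log P(z,\xi)\,dV(\xi)$. Condition $C_k$: for all nonzero multi-indices $\Gamma_1,\dots,\Gamma_A,\Lambda_1,\dots,\Lambda_B\in\mathbb{N}_0^n$ with $\sum_i|\Gamma_i|+\sum_j|\Lambda_j|\le k$, the function $\prod_i(\partial^{\Gamma_i}l)\prod_j(\overline\partial^{\Lambda_j}l)$ of $\xi$ lies in $L^1(\Omega,\Phi(z))$ for each $z\in\Omega$, and its $L^1(\Omega,\Phi(z))$-norm is a continuous function of $z\in\Omega$ (here $\partial,\overline\partial$ are derivatives in $z_1,\dots,z_n$ and $\overline z_1,\dots,\overline z_n$). *)

theory Defs
  imports "HOL-Probability.Probability"
begin

definition domain :: "(complex ^ 'n) set \<Rightarrow> bool" where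
  "domain \<Omega> \<longleftrightarrow> open \<Omega> \<and> connected \<Omega> \<and> \<Omega> \<noteq> {}"

text \<open>Holomorphy in several variables: the real Frechet derivative exists and is complex linear.\<close>

definition holomorphic_in :: "(complex ^ 'n \<Rightarrow> complex) \<Rightarrow> (complex ^ 'n) set \<Rightarrow> bool" where
  "holomorphic_in f \<Omega> \<longleftrightarrow>
     (\<forall>z\<in>\<Omega>. \<exists>D. (f has_derivative D) (at z) \<and> (\<forall>c v. D (c *s v) = c * D v))"

definition bergman_space :: "(complex ^ 'n) set \<Rightarrow> (complex ^ 'n \<Rightarrow> complex) set" where
  "bergman_space \<Omega> =
     {f. holomorphic_in f \<Omega> \<and> set_integrable lebesgue \<Omega> (\<lambda>z. (cmod (f z))\<^sup>2)}"

text \<open>The reproducing kernel, holomorphic in the first and antiholomorphic in the second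
  variable. Values outside \<open>\<Omega> \<times> \<Omega>\<close> are unconstrained; everything below only uses values
  inside. The diagonal values \<open>B z z\<close> are real; as complex numbers they enter the formulas
  below through \<open>Re\<close>.\<close>

definition bergman_kernel :: "(complex ^ 'n) set \<Rightarrow> (complex ^ 'n \<Rightarrow> complex ^ 'n \<Rightarrow> complex) \<Rightarrow> bool" where
  "bergman_kernel \<Omega> B \<longleftrightarrow>
     (\<forall>w\<in>\<Omega>. (\<lambda>z. B z w) \<in> bergman_space \<Omega> \<and>
        (\<forall>f\<in>bergman_space \<Omega>. f w = (LINT z:\<Omega>|lebesgue. f z * cnj (B z w))))"


section \<open>Derivatives in the parameter\<close>

text \<open>The \<open>2n\<close> real coordinate vectors of \<open>complex ^ 'n\<close> are the elements of \<open>Basis\<close>, that is,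
  \<open>axis k 1\<close> and \<open>axis k \<i>\<close>.\<close>

definition rpart :: "complex ^ 'n \<Rightarrow> (complex ^ 'n \<Rightarrow> 'b::real_normed_vector) \<Rightarrow> complex ^ 'n \<Rightarrow> 'b" where
  "rpart b f z = vector_derivative (\<lambda>t. f (z + t *\<^sub>R b)) (at 0)"

definition wirt :: "'n \<Rightarrow> (complex ^ 'n \<Rightarrow> complex) \<Rightarrow> complex ^ 'n \<Rightarrow> complex" where
  "wirt k f z = (rpart (axis k 1) f z - \<i> * rpart (axis k \<i>) f z) / 2"

definition wirt_bar :: "'n \<Rightarrow> (complex ^ 'n \<Rightarrow> complex) \<Rightarrow> complex ^ 'n \<Rightarrow> complex" where
  "wirt_bar k f z = (rpart (axis k 1) f z + \<i> * rpart (axis k \<i>) f z) / 2"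

text \<open>Multi-indices are functions \<open>'n \<Rightarrow> nat\<close>. The finite index type carries no order, so the
  coordinates are processed in some fixed order; it does not matter where the function is
  smooth.\<close>

definition multi_deriv ::
  "('n \<Rightarrow> (complex ^ 'n \<Rightarrow> complex) \<Rightarrow> complex ^ 'n \<Rightarrow> complex) \<Rightarrow> ('n \<Rightarrow> nat)
     \<Rightarrow> (complex ^ 'n \<Rightarrow> complex) \<Rightarrow> complex ^ 'n \<Rightarrow> complex" where
  "multi_deriv d \<Gamma> = foldr (\<lambda>k. d k ^^ \<Gamma> k) (SOME ks. distinct ks \<and> set ks = UNIV)"

definition multi_order :: "('n::finite \<Rightarrow> nat) \<Rightarrow> nat" where
  "multi_order \<Gamma> = (\<Sum>k\<in>UNIV. \<Gamma> k)"


section \<open>The Bergman statistical model\<close>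

definition bergman_P :: "(complex ^ 'n \<Rightarrow> complex ^ 'n \<Rightarrow> complex) \<Rightarrow> complex ^ 'n \<Rightarrow> complex ^ 'n \<Rightarrow> real" where
  "bergman_P B z \<xi> = (cmod (B z \<xi>))\<^sup>2 / Re (B z z)"

definition bergman_model ::
  "(complex ^ 'n) set \<Rightarrow> (complex ^ 'n \<Rightarrow> complex ^ 'n \<Rightarrow> complex) \<Rightarrow> complex ^ 'n \<Rightarrow> (complex ^ 'n) measure" where
  "bergman_model \<Omega> B z = density (lebesgue_on \<Omega>) (\<lambda>\<xi>. ennreal (bergman_P B z \<xi>))"

text \<open>For fixed \<open>z\<close> the zeros of \<open>B z\<close> form a null set, so the value of \<open>ln 0\<close>, and of
  derivatives there, is immaterial.\<close>

definition loglik :: "(complex ^ 'n \<Rightarrow> complex ^ 'n \<Rightarrow> complex) \<Rightarrow> complex ^ 'n \<Rightarrow> complex ^ 'n \<Rightarrow> real" where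
  "loglik B \<xi> z = ln (bergman_P B z \<xi>)"

definition expect ::
  "(complex ^ 'n) set \<Rightarrow> (complex ^ 'n \<Rightarrow> complex ^ 'n \<Rightarrow> complex) \<Rightarrow> complex ^ 'n \<Rightarrow> (complex ^ 'n \<Rightarrow> real) \<Rightarrow> real" where
  "expect \<Omega> B z f = (LINT \<xi>:\<Omega>|lebesgue. f \<xi> * bergman_P B z \<xi>)"

definition condition_C_integrand ::
  "(complex ^ 'n \<Rightarrow> complex ^ 'n \<Rightarrow> complex) \<Rightarrow> ('n \<Rightarrow> nat) list \<Rightarrow> ('n \<Rightarrow> nat) list
     \<Rightarrow> complex ^ 'n \<Rightarrow> complex ^ 'n \<Rightarrow> complex" where
  "condition_C_integrand B \<Gamma>s \<Lambda>s z \<xi> =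
     (\<Prod>\<Gamma>\<leftarrow>\<Gamma>s. multi_deriv wirt \<Gamma> (\<lambda>z. of_real (loglik B \<xi> z)) z) *
     (\<Prod>\<Lambda>\<leftarrow>\<Lambda>s. multi_deriv wirt_bar \<Lambda> (\<lambda>z. of_real (loglik B \<xi> z)) z)"

definition condition_C ::
  "nat \<Rightarrow> (complex ^ 'n) set \<Rightarrow> (complex ^ 'n \<Rightarrow> complex ^ 'n \<Rightarrow> complex) \<Rightarrow> bool" where
  "condition_C k \<Omega> B \<longleftrightarrow>
     (\<forall>\<Gamma>s \<Lambda>s. (\<forall>\<Gamma> \<in> set \<Gamma>s \<union> set \<Lambda>s. \<Gamma> \<noteq> (\<lambda>_. 0)) \<and>
        (\<Sum>\<Gamma>\<leftarrow>\<Gamma>s. multi_order \<Gamma>) + (\<Sum>\<Lambda>\<leftarrow>\<Lambda>s. multi_order \<Lambda>) \<le> k \<longrightarrow>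
        (\<forall>z\<in>\<Omega>. integrable (bergman_model \<Omega> B z) (condition_C_integrand B \<Gamma>s \<Lambda>s z)) \<and>
        continuous_on \<Omega>
          (\<lambda>z. LINT \<xi>|bergman_model \<Omega> B z. cmod (condition_C_integrand B \<Gamma>s \<Lambda>s z \<xi>)))"


section \<open>Fisher metric, Amari--Chentsov tensor and connections\<close>

text \<open>Components are taken with respect to coordinate vectors \<open>i, j, k \<in> Basis\<close>.\<close>

definition amari_chentsov ::
  "(complex ^ 'n) set \<Rightarrow> (complex ^ 'n \<Rightarrow> complex ^ 'n \<Rightarrow> complex)
     \<Rightarrow> complex ^ 'n \<Rightarrow> complex ^ 'n \<Rightarrow> complex ^ 'n \<Rightarrow> complex ^ 'n \<Rightarrow> real" where
  "amari_chentsov \<Omega> B z i j k =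
     expect \<Omega> B z (\<lambda>\<xi>. rpart i (loglik B \<xi>) z * rpart j (loglik B \<xi>) z * rpart k (loglik B \<xi>) z)"

definition fisher_metric ::
  "(complex ^ 'n) set \<Rightarrow> (complex ^ 'n \<Rightarrow> complex ^ 'n \<Rightarrow> complex)
     \<Rightarrow> complex ^ 'n \<Rightarrow> complex ^ 'n \<Rightarrow> complex ^ 'n \<Rightarrow> real" where
  "fisher_metric \<Omega> B z u v =
     (\<Sum>i\<in>Basis. \<Sum>j\<in>Basis. (u \<bullet> i) * (v \<bullet> j) *
        expect \<Omega> B z (\<lambda>\<xi>. rpart i (loglik B \<xi>) z * rpart j (loglik B \<xi>) z))"

text \<open>A connection on \<open>\<Omega>\<close> is given in the global real coordinates by the vectors
  \<open>C z i j\<close> = \<open>\<nabla>\<close> of the coordinate field \<open>j\<close> in direction \<open>i\<close> at \<open>z\<close>.\<close>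

definition is_alpha_connection ::
  "real \<Rightarrow> (complex ^ 'n) set \<Rightarrow> (complex ^ 'n \<Rightarrow> complex ^ 'n \<Rightarrow> complex)
     \<Rightarrow> (complex ^ 'n \<Rightarrow> complex ^ 'n \<Rightarrow> complex ^ 'n \<Rightarrow> complex ^ 'n) \<Rightarrow> bool" where
  "is_alpha_connection \<alpha> \<Omega> B C \<longleftrightarrow>
     (\<forall>z\<in>\<Omega>. \<forall>i\<in>Basis. \<forall>j\<in>Basis. \<forall>k\<in>Basis.
        fisher_metric \<Omega> B z (C z i j) k =
          expect \<Omega> B z (\<lambda>\<xi>. rpart i (rpart j (loglik B \<xi>)) z * rpart k (loglik B \<xi>) z) +
          (1 - \<alpha>) / 2 *
          expect \<Omega> B z (\<lambda>\<xi>. rpart i (loglik B \<xi>) z * rpart j (loglik B \<xi>) z * rpart k (loglik B \<xi>) z))"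

definition bergman_coeff ::
  "(complex ^ 'n \<Rightarrow> complex ^ 'n \<Rightarrow> complex) \<Rightarrow> complex ^ 'n \<Rightarrow> 'n \<Rightarrow> 'n \<Rightarrow> complex" where
  "bergman_coeff B z a b = wirt a (wirt_bar b (\<lambda>z. of_real (ln (Re (B z z))))) z"

text \<open>The Riemannian metric on real tangent vectors: the complex bilinear extension takes the
  coefficient \<open>bergman_coeff B z a b\<close> on the pair of the \<open>a\<close>-th holomorphic and the \<open>b\<close>-th
  antiholomorphic coordinate vector (in either order), and vanishes on pairs of equal type; a real
  vector \<open>u\<close> has components \<open>u $ a\<close> and \<open>cnj (u $ a)\<close>.\<close>

definition bergman_metric ::
  "(complex ^ 'n \<Rightarrow> complex ^ 'n \<Rightarrow> complex) \<Rightarrow> complex ^ 'n \<Rightarrow> complex ^ 'n \<Rightarrow> complex ^ 'n \<Rightarrow> real" where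
  "bergman_metric B z u v =
     2 * Re (\<Sum>a\<in>UNIV. \<Sum>b\<in>UNIV. bergman_coeff B z a b * u $ a * cnj (v $ b))"

text \<open>Torsion freeness and compatibility with the metric \<open>g\<close>; coordinate fields commute.\<close>

definition is_levi_civita ::
  "(complex ^ 'n) set \<Rightarrow> (complex ^ 'n \<Rightarrow> complex ^ 'n \<Rightarrow> complex ^ 'n \<Rightarrow> real)
     \<Rightarrow> (complex ^ 'n \<Rightarrow> complex ^ 'n \<Rightarrow> complex ^ 'n \<Rightarrow> complex ^ 'n) \<Rightarrow> bool" where
  "is_levi_civita \<Omega> g C \<longleftrightarrow>
     (\<forall>z\<in>\<Omega>. \<forall>i\<in>Basis. \<forall>j\<in>Basis. C z i j = C z j i) \<and>
     (\<forall>z\<in>\<Omega>. \<forall>i\<in>Basis. \<forall>j\<in>Basis. \<forall>k\<in>Basis.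
        rpart k (\<lambda>z. g z i j) z = g z (C z k i) j + g z i (C z k j))"


section \<open>Divergences, diastasis, entropy\<close>

definition chi_plus :: "real \<Rightarrow> real" where
  "chi_plus x = x * ln x"

definition chi_minus :: "real \<Rightarrow> real" where
  "chi_minus x = - ln x"

definition chi_divergence :: "(real \<Rightarrow> real) \<Rightarrow> 'a measure \<Rightarrow> 'a measure \<Rightarrow> real" where
  "chi_divergence h M N = (LINT x|M. h (enn2real (RN_deriv M N x)))"

definition chi_divergence_finite :: "(real \<Rightarrow> real) \<Rightarrow> 'a measure \<Rightarrow> 'a measure \<Rightarrow> bool" where
  "chi_divergence_finite h M N \<longleftrightarrow> integrable M (\<lambda>x. h (enn2real (RN_deriv M N x)))"

definition diastasis ::
  "(complex ^ 'n \<Rightarrow> complex ^ 'n \<Rightarrow> complex) \<Rightarrow> complex ^ 'n \<Rightarrow> complex ^ 'n \<Rightarrow> real" where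
  "diastasis B z w = ln (Re (B z z) * Re (B w w) / (cmod (B z w))\<^sup>2)"

definition bergman_entropy ::
  "(complex ^ 'n) set \<Rightarrow> (complex ^ 'n \<Rightarrow> complex ^ 'n \<Rightarrow> complex) \<Rightarrow> complex ^ 'n \<Rightarrow> real" where
  "bergman_entropy \<Omega> B z = - (LINT \<xi>:\<Omega>|lebesgue. bergman_P B z \<xi> * ln (bergman_P B z \<xi>))"

text \<open>A single-valued holomorphic branch of the logarithm of \<open>f\<close>; in particular \<open>f\<close> has no
  zeros. Applied to a quotient \<open>f = p / q\<close>, the convention \<open>x / 0 = 0\<close> thus makes both \<open>p\<close> and
  \<open>q\<close> zero-free.\<close>

definition log_branch :: "(complex ^ 'n) set \<Rightarrow> (complex ^ 'n \<Rightarrow> complex) \<Rightarrow> (complex ^ 'n \<Rightarrow> complex) \<Rightarrow> bool" where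
  "log_branch \<Omega> f L \<longleftrightarrow> holomorphic_in L \<Omega> \<and> (\<forall>\<xi>\<in>\<Omega>. exp (L \<xi>) = f \<xi>)"

end

theory Submission
  imports Defs "HOL-Complex_Analysis.Complex_Analysis"
begin

unbundle no fps_syntax

text \<open>The functions \<open>B(\<cdot>,z) \<partial>\<^sub>i l \<partial>\<^sub>j l \<dots>\<close> are, up to conjugation, meromorphic in \<open>\<xi>\<close> with poles on the zero
  set of \<open>B(\<cdot>,z)\<close>. Condition \<open>C\<^sub>6\<close> makes those of total order at most three square integrable, and
  square integrable singularities along an analytic hypersurface are removable, so they lie in the
  Bergman space. The reproducing property and its derivative therefore evaluate, for such a
  meromorphic \<open>m\<close>, the means \<open>E[m] = m z\<close> and \<open>E[m \<partial>\<^sub>k l] = \<partial>\<^sub>k m z\<close>. Since \<open>\<partial>\<^sub>i l\<close> vanishes at \<open>\<xi> = z\<close>,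
  all third moments vanish, and the remaining moments are derivatives of \<open>log B\<close>, which identifies
  the Christoffel symbols. The divergences and the entropy are means of holomorphic logarithms
  and follow from the reproducing property alone.\<close>
section \<open>Holomorphic functions of several variables\<close>

text \<open>The kernel is given as holomorphic in its first slot only, while the moments involve
  third derivatives of log B in both slots. Hermitian symmetry supplies the second slot, and a local
  bound on the diagonal together with Cauchy estimates supplies joint regularity. The polarised
  kernel \<open>G\<close> then carries all derivatives; for the moments only its logarithmic
  derivatives occur, which are single-valued off the zeros. Every derivative is written as a circle
  mean of values, so that regularity, removability and the differentiated reproducing formula all
  become questions about exchanging integrals.

  The second parameter derivatives of the log-likelihood contain a term from log B(z,z) that is
  constant in \<open>\<xi>\<close>. Integrability is known only for the function including this
  term, so the shift is carried along as a constant; it drops out because the score has mean zero.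
  Boundedness of \<open>\<Omega>\<close> puts 1 and the coordinates into the Bergman space, which
  gives a positive diagonal and a definite metric, and definiteness makes the connections exist
  uniquely.\<close>

lemma norm_scalar_mult: "norm (c *s v) = cmod c * norm v" for v :: "complex ^ 'm"
  by (simp add: norm_vec_def norm_mult L2_set_right_distrib)

lemma scaleR_eq_scalar_mult: "t *\<^sub>R v = complex_of_real t *s v" for v :: "complex ^ 'm"
  by (simp add: vec_eq_iff scaleR_conv_of_real[of _ "_::complex"])

lemma bounded_linear_scalar_mult_left: "bounded_linear (\<lambda>c. c *s v)"
  for v :: "complex ^ 'm"
  by (rule bounded_linear_intro[where K="norm v"])
     (auto simp: vec_eq_iff algebra_simps norm_scalar_mult scaleR_conv_of_real[of _ "_::complex"])

lemma bounded_linear_scalar_mult_right: "bounded_linear (\<lambda>v. c *s v)"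
  for c :: complex and v :: "complex ^ 'm"
  by (rule bounded_linear_intro[where K="cmod c"])
     (auto simp: vec_eq_iff algebra_simps norm_scalar_mult scaleR_conv_of_real[of _ "_::complex"])

lemmas continuous_on_scalar_mult_left [continuous_intros] =
  bounded_linear.continuous_on[OF bounded_linear_scalar_mult_left]

lemma has_derivative_imp_has_vector_derivative_line:
  assumes "(f has_derivative D) (at z)"
  shows "((\<lambda>t. f (z + t *\<^sub>R v)) has_vector_derivative D v) (at 0)"
proof -
  have *: "((\<lambda>t. z + t *\<^sub>R v) has_derivative (\<lambda>t. t *\<^sub>R v)) (at 0)"
    by (auto intro!: derivative_eq_intros)
  have "((\<lambda>t. f (z + t *\<^sub>R v)) has_derivative (\<lambda>t. D (t *\<^sub>R v))) (at 0)"
    using has_derivative_compose[OF *, of f D] assms by simp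
  then show ?thesis
    using has_derivative_bounded_linear[OF assms]
    by (simp add: has_vector_derivative_def linear_simps)
qed

lemma rpart_eqI:
  assumes "(f has_derivative D) (at z)"
  shows "rpart v f z = D v"
  unfolding rpart_def
  by (rule vector_derivative_at[OF has_derivative_imp_has_vector_derivative_line[OF assms]])

lemma rpart_cong:
  assumes "open S" "z \<in> S" "\<And>x. x \<in> S \<Longrightarrow> f x = g x"
  shows "rpart v f z = rpart v g z"
  unfolding rpart_def
proof (rule vector_derivative_cong_eq)
  have "open ((\<lambda>t. z + t *\<^sub>R v) -` S)"
    by (intro open_vimage continuous_intros assms)
  then have "\<forall>\<^sub>F t in nhds 0. z + t *\<^sub>R v \<in> S"
    unfolding eventually_nhds using assms(2) by (intro exI[of _ "(\<lambda>t. z + t *\<^sub>R v) -` S"]) auto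
  then show "\<forall>\<^sub>F t in nhds 0. t \<in> UNIV \<longrightarrow> f (z + t *\<^sub>R v) = g (z + t *\<^sub>R v)"
    by eventually_elim (use assms in auto)
qed (use assms in auto)

lemma holomorphic_inI:
  assumes "\<And>z. z \<in> S \<Longrightarrow> (f has_derivative D z) (at z)"
    and "\<And>z c v. z \<in> S \<Longrightarrow> D z (c *s v) = c * D z v"
  shows "holomorphic_in f S"
  using assms unfolding holomorphic_in_def by blast

text \<open>Naming the derivative \<open>rpart v f z\<close> instead of quantifying over it makes
  each directional derivative a function of the point that can be differentiated again.\<close>

lemma holomorphic_in_has_derivative:
  assumes "holomorphic_in f S" "z \<in> S"
  shows "(f has_derivative (\<lambda>v. rpart v f z)) (at z)"
proof -
  obtain D where D: "(f has_derivative D) (at z)"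
    using assms by (auto simp: holomorphic_in_def)
  moreover have "D = (\<lambda>v. rpart v f z)"
    using rpart_eqI[OF D] by auto
  ultimately show ?thesis by simp
qed

lemma rpart_scalar_mult:
  assumes "holomorphic_in f S" "z \<in> S"
  shows "rpart (c *s v) f z = c * rpart v f z"
proof -
  obtain D where D: "(f has_derivative D) (at z)" "\<And>c v. D (c *s v) = c * D v"
    using assms unfolding holomorphic_in_def by blast
  then show ?thesis using rpart_eqI[OF D(1)] by auto
qed

lemma rpart_add_direction:
  assumes "(f has_derivative D) (at z)"
  shows "rpart (u + v) f z = rpart u f z + rpart v f z"
  using rpart_eqI[OF assms] has_derivative_bounded_linear[OF assms] by (simp add: linear_simps)

lemma holomorphic_in_subset: "holomorphic_in f S \<Longrightarrow> T \<subseteq> S \<Longrightarrow> holomorphic_in f T"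
  unfolding holomorphic_in_def by blast

lemma holomorphic_in_cong:
  assumes "open S" "\<And>x. x \<in> S \<Longrightarrow> f x = g x" "holomorphic_in f S"
  shows "holomorphic_in g S"
proof (rule holomorphic_inI)
  fix z assume z: "z \<in> S"
  show "(g has_derivative (\<lambda>v. rpart v f z)) (at z)"
    by (rule has_derivative_transform_within_open[OF holomorphic_in_has_derivative[OF assms(3) z] assms(1) z])
      (use assms in auto)
qed (use rpart_scalar_mult[OF assms(3)] in auto)

lemma holomorphic_in_const: "holomorphic_in (\<lambda>_. c) S"
  by (rule holomorphic_inI[where D="\<lambda>_ _. 0"]) auto

lemma holomorphic_in_diff:
  assumes "holomorphic_in f S" "holomorphic_in g S"
  shows "holomorphic_in (\<lambda>z. f z - g z) S"
  by (rule holomorphic_inI[where D="\<lambda>z v. rpart v f z - rpart v g z"])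
    (use assms in \<open>auto intro!: has_derivative_diff holomorphic_in_has_derivative
      simp: rpart_scalar_mult algebra_simps\<close>)

lemma holomorphic_in_mult:
  assumes "holomorphic_in f S" "holomorphic_in g S"
  shows "holomorphic_in (\<lambda>z. f z * g z) S"
proof (rule holomorphic_inI)
  fix z assume "z \<in> S"
  then show "((\<lambda>z. f z * g z) has_derivative (\<lambda>v. f z * rpart v g z + rpart v f z * g z)) (at z)"
    by (intro has_derivative_mult holomorphic_in_has_derivative[where S=S] assms)
qed (simp add: rpart_scalar_mult[OF assms(1)] rpart_scalar_mult[OF assms(2)] algebra_simps)

lemma holomorphic_in_power: "holomorphic_in f S \<Longrightarrow> holomorphic_in (\<lambda>z. f z ^ k) S"
  by (induction k) (auto intro: holomorphic_in_const holomorphic_in_mult)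

lemma holomorphic_in_divide:
  assumes "holomorphic_in f S" "holomorphic_in g S" "\<And>z. z \<in> S \<Longrightarrow> g z \<noteq> 0"
  shows "holomorphic_in (\<lambda>z. f z / g z) S"
proof (rule holomorphic_inI)
  fix z assume "z \<in> S"
  then show "((\<lambda>z. f z / g z) has_derivative
    (\<lambda>v. (rpart v f z * g z - f z * rpart v g z) / (g z * g z))) (at z)"
    by (intro has_derivative_divide' holomorphic_in_has_derivative[where S=S] assms)
qed (simp add: rpart_scalar_mult[OF assms(1)] rpart_scalar_mult[OF assms(2)] algebra_simps diff_divide_distrib)

lemma holomorphic_in_component: "holomorphic_in (\<lambda>z. z $ k) S"
  by (rule holomorphic_inI[where D="\<lambda>_ v. v $ k"])
    (simp_all add: bounded_linear_imp_has_derivative bounded_linear_vec_nth)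

lemma holomorphic_in_compose_linear:
  fixes L :: "complex ^ 'k \<Rightarrow> complex ^ 'm"
  assumes "holomorphic_in f S" "bounded_linear L" "\<And>c v. L (c *s v) = c *s L v"
    and "\<And>z. z \<in> T \<Longrightarrow> a + L z \<in> S"
  shows "holomorphic_in (\<lambda>z. f (a + L z)) T"
proof (rule holomorphic_inI[where D="\<lambda>z v. rpart (L v) f (a + L z)"])
  fix z assume z: "z \<in> T"
  have 1: "((\<lambda>z. a + L z) has_derivative L) (at z)"
    using has_derivative_add[OF has_derivative_const[of a] bounded_linear_imp_has_derivative[OF assms(2)]] by simp
  show "((\<lambda>z. f (a + L z)) has_derivative (\<lambda>v. rpart (L v) f (a + L z))) (at z)"
    using has_derivative_compose[OF 1 holomorphic_in_has_derivative[OF assms(1) assms(4)[OF z]]] by simp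
qed (simp add: assms(3) rpart_scalar_mult[OF assms(1) assms(4)])

text \<open>Two antilinear operations, \<open>L\<close> inside and conjugation outside, compose to a
  complex linear one. This handles the second slot of the kernel.\<close>

lemma holomorphic_in_cnj_compose:
  assumes "holomorphic_in f S" "bounded_linear L" "\<And>c v. L (c *s v) = cnj c *s L v"
    and "\<And>z. z \<in> T \<Longrightarrow> a + L z \<in> S"
  shows "holomorphic_in (\<lambda>z. cnj (f (a + L z))) T"
proof (rule holomorphic_inI[where D="\<lambda>z v. cnj (rpart (L v) f (a + L z))"])
  fix z assume z: "z \<in> T"
  have 1: "((\<lambda>z. a + L z) has_derivative L) (at z)"
    using has_derivative_add[OF has_derivative_const[of a] bounded_linear_imp_has_derivative[OF assms(2)]] by simp
  show "((\<lambda>z. cnj (f (a + L z))) has_derivative (\<lambda>v. cnj (rpart (L v) f (a + L z)))) (at z)"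
    using has_derivative_compose[OF 1 holomorphic_in_has_derivative[OF assms(1) assms(4)[OF z]]]
    by (auto intro!: has_derivative_cnj)
qed (simp add: assms(3) rpart_scalar_mult[OF assms(1) assms(4)])

lemma holomorphic_in_continuous_on:
  assumes "holomorphic_in f S"
  shows "continuous_on S f"
  using has_derivative_continuous[OF holomorphic_in_has_derivative[OF assms]]
  by (auto intro!: continuous_at_imp_continuous_on)

lemma rpart_divide:
  assumes "holomorphic_in f S" "holomorphic_in g S" "z \<in> S" "g z \<noteq> 0"
  shows "rpart v (\<lambda>z. f z / g z) z = (rpart v f z * g z - f z * rpart v g z) / (g z * g z)"
  by (rule rpart_eqI) (use assms in \<open>auto intro!: has_derivative_divide' holomorphic_in_has_derivative\<close>)

lemma rpart_const: "rpart v (\<lambda>_. c) z = 0"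
  by (simp add: rpart_def)

section \<open>Cauchy formulas as means over circles\<close>

definition unit_circle :: "real \<Rightarrow> complex" where
  "unit_circle x = exp (2 * of_real pi * \<i> * of_real x)"

lemma norm_unit_circle [simp]: "cmod (unit_circle x) = 1"
  by (simp add: unit_circle_def)

lemma unit_circle_nonzero [simp]: "unit_circle x \<noteq> 0"
  by (simp add: unit_circle_def)

lemma continuous_on_unit_circle [continuous_intros]: "continuous_on S unit_circle"
  unfolding unit_circle_def by (intro continuous_intros)

text \<open>Complex linearity of the derivative says exactly that the restriction to the complex
  line through \<open>z\<close> in direction \<open>v\<close> is complex differentiable, so
  one-variable theory applies. The direction is not normalised and may be zero.\<close>

lemma holomorphic_on_slice:
  assumes "holomorphic_in f S" "\<And>t. t \<in> T \<Longrightarrow> z + t *s v \<in> S"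
  shows "(\<lambda>t. f (z + t *s v)) holomorphic_on T"
    and "t \<in> T \<Longrightarrow> deriv (\<lambda>t. f (z + t *s v)) t = rpart v f (z + t *s v)"
proof -
  have D: "((\<lambda>t. f (z + t *s v)) has_field_derivative rpart v f (z + t *s v)) (at t)"
    if t: "t \<in> T" for t
  proof -
    have 1: "((\<lambda>t. z + t *s v) has_derivative (\<lambda>t. t *s v)) (at t)"
      using has_derivative_add[OF has_derivative_const[of z]
        bounded_linear_imp_has_derivative[OF bounded_linear_scalar_mult_left[of v]]] by simp
    have "(\<lambda>s. rpart (s *s v) f (z + t *s v)) = (*) (rpart v f (z + t *s v))"
      using rpart_scalar_mult[OF assms(1) assms(2)[OF t]] by (simp add: fun_eq_iff)
    then show ?thesis
      using has_derivative_compose[OF 1 holomorphic_in_has_derivative[OF assms(1) assms(2)[OF t]]]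
      unfolding has_field_derivative_def by simp
  qed
  show "(\<lambda>t. f (z + t *s v)) holomorphic_on T"
    using D by (auto simp: holomorphic_on_def field_differentiable_def intro: has_field_derivative_at_within)
  show "t \<in> T \<Longrightarrow> deriv (\<lambda>t. f (z + t *s v)) t = rpart v f (z + t *s v)"
    using D by (auto intro: DERIV_imp_deriv)
qed

text \<open>With the circle parametrised over \<open>{0..1}\<close>, the form du / (2 pi i u) pulls
  back to dx, so the Cauchy formulas for the value and for the first derivative become plain
  averages.\<close>

lemma Cauchy_mean_unit_circle:
  assumes c: "continuous_on (cball 0 r) f" "f holomorphic_on ball 0 r" and "r > 0"
  shows "((\<lambda>x. f (of_real r * unit_circle x)) has_integral f 0) {0..1}"
    and "((\<lambda>x. f (of_real r * unit_circle x) / (of_real r * unit_circle x)) has_integral deriv f 0) {0..1}"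
proof -
  have cp: "circlepath 0 r x = of_real r * unit_circle x" for x
    by (simp add: circlepath unit_circle_def)
  have *: "((\<lambda>x. g (of_real r * unit_circle x) * (of_real r * unit_circle x)) has_integral y) {0..1}"
    if "(g has_contour_integral (2 * of_real pi * \<i> * y)) (circlepath 0 r)" for g y
  proof -
    have "((\<lambda>x. g (of_real r * unit_circle x) * (2 * of_real pi * \<i> * of_real r * unit_circle x)) has_integral (2 * of_real pi * \<i> * y)) {0..1}"
      using that unfolding has_contour_integral_def
      by (rule has_integral_eq[rotated]) (auto simp: cp vector_derivative_circlepath01 unit_circle_def)
    from has_integral_mult_right[OF this, of "1 / (2 * of_real pi * \<i>)"] show ?thesis
      by (simp add: field_simps)
  qed
  have "((\<lambda>u. f u / u) has_contour_integral (2 * of_real pi * \<i> * f 0)) (circlepath 0 r)"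
    using Cauchy_integral_circlepath[OF c, of 0] assms by simp
  from *[OF this] show "((\<lambda>x. f (of_real r * unit_circle x)) has_integral f 0) {0..1}"
    using assms by simp
  have "((\<lambda>u. f u / u ^ 2) has_contour_integral (2 * of_real pi * \<i> * deriv f 0)) (circlepath 0 r)"
    using Cauchy_has_contour_integral_higher_derivative_circlepath[OF c, of 0 1] assms
    by (simp add: power2_eq_square)
  from *[OF this] show "((\<lambda>x. f (of_real r * unit_circle x) / (of_real r * unit_circle x)) has_integral deriv f 0) {0..1}"
    using assms by (simp add: power2_eq_square)
qed

text \<open>The second formula expresses a directional derivative through values of \<open>f\<close>
  alone, integrated against a bounded weight. This is what later lets derivatives pass through
  parameters and through Fubini.\<close>

lemma circle_mean:
  assumes "holomorphic_in f S" "r > 0" "\<And>t. cmod t \<le> r \<Longrightarrow> z + t *s v \<in> S"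
  shows "((\<lambda>x. f (z + (of_real r * unit_circle x) *s v)) has_integral f z) {0..1}"
    and "((\<lambda>x. f (z + (of_real r * unit_circle x) *s v) / (of_real r * unit_circle x))
           has_integral rpart v f z) {0..1}"
  using Cauchy_mean_unit_circle[OF
      holomorphic_on_imp_continuous_on[OF holomorphic_on_slice(1)[OF assms(1), of "cball 0 r" z v]]
      holomorphic_on_slice(1)[OF assms(1), of "ball 0 r" z v] assms(2)]
    holomorphic_on_slice(2)[OF assms(1), of "cball 0 r" z v 0] assms(2,3)
  by (auto simp: dist_norm)

text \<open>One radius serves all centres near \<open>z\<close>: the circle stays fixed while its
  centre varies, as needed for differentiating circle means in the centre.\<close>

lemma circle_radius:
  fixes z v :: "complex ^ 'm"
  assumes "open S" "z \<in> S"
  obtains r e where "r > 0" "e > 0" "\<And>w t. w \<in> ball z e \<Longrightarrow> cmod t \<le> r \<Longrightarrow> w + t *s v \<in> S"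
proof -
  obtain d where d: "d > 0" "ball z d \<subseteq> S" using assms openE by blast
  \<comment> \<open>The summand 1 in \<open>norm v + 1\<close> admits \<open>v = 0\<close>.\<close>
  have "w + t *s v \<in> S" if "w \<in> ball z (d/2)" "cmod t \<le> d / (2 * (norm v + 1))" for w t
  proof -
    have "norm (t *s v) \<le> d / (2 * (norm v + 1)) * norm v"
      using mult_right_mono[OF that(2), of "norm v"] by (simp only: norm_scalar_mult norm_ge_zero)
    also have "\<dots> \<le> d / 2 * 1"
      using d by (simp add: field_simps add_pos_nonneg)
    finally have "dist z (w + t *s v) < d"
      using that(1) norm_triangle_ineq[of "w - z" "t *s v"] by (simp add: dist_norm norm_minus_commute algebra_simps)
    then show ?thesis using d by auto
  qed
  then show ?thesis using that[of "d / (2 * (norm v + 1))" "d/2"] d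
    by (simp add: add_nonneg_pos)
qed

lemma continuous_on_circle_integrand:
  fixes f :: "'a::real_normed_vector \<Rightarrow> 'b::real_normed_algebra"
  assumes "continuous_on S f" "\<And>z x. z \<in> U \<Longrightarrow> x \<in> {0..1} \<Longrightarrow> z + \<gamma> x \<in> S"
    "continuous_on {0..1} \<gamma>" "continuous_on {0..1} w"
  shows "continuous_on (U \<times> {0..1::real}) (\<lambda>(z, x). w x * f (z + \<gamma> x))"
proof -
  have "continuous_on (U \<times> {0..1::real}) (\<lambda>p. w (snd p) * f (fst p + \<gamma> (snd p)))"
  proof -
    have g: "continuous_on (U \<times> {0..1::real}) (\<lambda>p. \<gamma> (snd p))"
      by (rule continuous_on_compose2[OF assms(3)]) (auto intro!: continuous_intros)
    have w: "continuous_on (U \<times> {0..1::real}) (\<lambda>p. w (snd p))"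
      by (rule continuous_on_compose2[OF assms(4)]) (auto intro!: continuous_intros)
    have "continuous_on (U \<times> {0..1::real}) (\<lambda>p. f (fst p + \<gamma> (snd p)))"
      by (rule continuous_on_compose2[OF assms(1)]) (use assms(2) in \<open>auto intro!: continuous_on_add[OF _ g] continuous_on_fst continuous_on_id\<close>)
    with w show ?thesis by (rule continuous_on_mult)
  qed
  then show ?thesis by (simp add: case_prod_beta)
qed

text \<open>Holomorphy only asks that a derivative exists. Its continuity, which the Leibniz rule
  below requires, comes from the circle mean for the derivative, whose integrand is jointly
  continuous in centre and parameter.\<close>

lemma continuous_on_rpart:
  assumes "holomorphic_in f S" "open S"
  shows "continuous_on S (rpart v f)"
proof -
  have "continuous (at z) (rpart v f)" if z: "z \<in> S" for z
  proof -
    obtain r e where re: "r > 0" "e > 0" "\<And>w t. w \<in> ball z e \<Longrightarrow> cmod t \<le> r \<Longrightarrow> w + t *s v \<in> S"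
      using circle_radius[OF assms(2) z] by metis
    have "continuous_on (ball z e \<times> cbox 0 1) (\<lambda>(w, x). (1 / (of_real r * unit_circle x)) * f (w + (of_real r * unit_circle x) *s v))"
      unfolding cbox_interval
      by (rule continuous_on_circle_integrand[OF holomorphic_in_continuous_on[OF assms(1)]])
        (use re in \<open>auto intro!: continuous_intros simp: norm_mult\<close>)
    then have "continuous_on (ball z e) (\<lambda>w. integral (cbox 0 1) (\<lambda>x. (1 / (of_real r * unit_circle x)) * f (w + (of_real r * unit_circle x) *s v)))"
      by (rule integral_continuous_on_param)
    moreover have "integral (cbox 0 1) (\<lambda>x. (1 / (of_real r * unit_circle x)) * f (w + (of_real r * unit_circle x) *s v)) = rpart v f w"
      if "w \<in> ball z e" for w
      using integral_unique[OF circle_mean(2)[OF assms(1) re(1) re(3)[OF that]]] by simp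
    ultimately have "continuous_on (ball z e) (rpart v f)" by (rule continuous_on_eq)
    then show ?thesis using re(2) by (simp add: continuous_on_eq_continuous_at)
  qed
  then show ?thesis by (simp add: continuous_at_imp_continuous_on)
qed

text \<open>Differentiation under the integral sign, with path \<open>\<gamma>\<close> and weight
  \<open>w\<close> held fixed. Weight 1 gives means of values; the reciprocal of the circle point
  gives derivatives.\<close>

lemma holomorphic_in_circle_integral:
  assumes f: "holomorphic_in f S" "open S" and U: "open U"
    and sub: "\<And>z x. z \<in> U \<Longrightarrow> x \<in> {0..1} \<Longrightarrow> z + \<gamma> x \<in> S"
    and c: "continuous_on {0..1} \<gamma>" "continuous_on {0..1} w"
  defines "F \<equiv> \<lambda>z. integral {0..1::real} (\<lambda>x. w x * f (z + \<gamma> x))"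
  shows "holomorphic_in F U"
    and "z \<in> U \<Longrightarrow> rpart v F z = integral {0..1} (\<lambda>x. w x * rpart v f (z + \<gamma> x))"
proof -
  define D where "D z v = integral {0..1} (\<lambda>x. w x * rpart v f (z + \<gamma> x))" for z v
  have D: "(F has_derivative D z) (at z)" if z: "z \<in> U" for z
  proof -
    obtain e where e: "e > 0" "ball z e \<subseteq> U" using U z openE by blast
    \<comment> \<open>The Leibniz rule wants the derivative as a continuous family of bounded linear
      functions; in finite dimension continuity can be checked direction by direction.\<close>
    define fx where "fx z x = Blinfun (\<lambda>v. w x * rpart v f (z + \<gamma> x))" for z x
    have der: "(f has_derivative (\<lambda>v. rpart v f (y + \<gamma> x))) (at (y + \<gamma> x))"
      if "y \<in> U" "x \<in> {0..1}" for y x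
      by (rule holomorphic_in_has_derivative[OF f(1) sub[OF that]])
    have fx: "blinfun_apply (fx y x) = (\<lambda>v. w x * rpart v f (y + \<gamma> x))" if "y \<in> U" "x \<in> {0..1}" for y x
      unfolding fx_def using has_derivative_bounded_linear[OF der[OF that]]
      by (intro bounded_linear_Blinfun_apply bounded_linear_intros) 
    have cont: "continuous_on (U \<times> {0..1}) (\<lambda>(y, x). w x * rpart v f (y + \<gamma> x))" for v
      by (rule continuous_on_circle_integrand[OF continuous_on_rpart[OF f] sub c])
    have cfx: "continuous_on (U \<times> {0..1}) (\<lambda>(y, x). fx y x)"
    proof (rule continuous_on_blinfun_componentwise)
      fix i show "continuous_on (U \<times> {0..1}) (\<lambda>p. blinfun_apply (case p of (y, x) \<Rightarrow> fx y x) i)"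
        using cont[of i] by (rule continuous_on_eq) (auto simp: fx)
    qed
    have cfx': "continuous_on {0..1} (fx y)" if "y \<in> U" for y
      using continuous_on_compose2[OF cfx, of "{0..1}" "\<lambda>x. (y, x)"] that
        continuous_on_Pair[OF continuous_on_const[of _ y] continuous_on_id, of "{0..1}"] by auto
    have "((\<lambda>y. integral (cbox 0 1) (\<lambda>x. w x * f (y + \<gamma> x))) has_derivative integral (cbox 0 1) (fx z))
      (at z within ball z e)"
    proof (rule leibniz_rule)
      fix y x assume yx: "y \<in> ball z e" "x \<in> cbox 0 (1::real)"
      then have *: "y \<in> U" "x \<in> {0..1}" using e by auto
      have "((\<lambda>y. y + \<gamma> x) has_derivative (\<lambda>v. v)) (at y)" by (auto intro!: derivative_eq_intros)
      from has_derivative_compose[OF this der[OF *]]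
      have "((\<lambda>y. w x * f (y + \<gamma> x)) has_derivative (\<lambda>v. w x * rpart v f (y + \<gamma> x))) (at y)"
        by (auto intro!: derivative_eq_intros)
      then show "((\<lambda>y. w x * f (y + \<gamma> x)) has_derivative blinfun_apply (fx y x)) (at y within ball z e)"
        using fx[OF *] by (auto intro: has_derivative_at_withinI)
    next
      fix y assume "y \<in> ball z e"
      then have *: "y \<in> U" using e by auto
      have "continuous_on (U \<times> {0..1}) (\<lambda>(z, x). w x * f (z + \<gamma> x))"
        by (rule continuous_on_circle_integrand[OF holomorphic_in_continuous_on[OF f(1)] sub c])
      from continuous_on_compose2[OF this, of "{0..1}" "\<lambda>x. (y, x)"] *
      have "continuous_on {0..1} (\<lambda>x. w x * f (y + \<gamma> x))"
        using continuous_on_Pair[OF continuous_on_const[of _ y] continuous_on_id, of "{0..1}"] by auto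
      then show "(\<lambda>x. w x * f (y + \<gamma> x)) integrable_on cbox 0 1"
        by (simp add: integrable_continuous_interval)
    next
      show "continuous_on (ball z e \<times> cbox 0 1) (\<lambda>(y, x). fx y x)"
        by (rule continuous_on_subset[OF cfx]) (use e in auto)
    qed (use e in auto)
    moreover have "blinfun_apply (integral (cbox 0 1) (fx z)) = D z"
    proof
      fix v
      have "blinfun_apply (integral {0..1} (fx z)) v = integral {0..1} (\<lambda>x. blinfun_apply (fx z x) v)"
        by (rule blinfun_apply_integral) (use cfx'[OF z] integrable_continuous_interval in auto)
      also have "\<dots> = D z v" unfolding D_def by (rule integral_cong) (use fx z in auto)
      finally show "blinfun_apply (integral (cbox 0 1) (fx z)) v = D z v" by simp
    qed
    ultimately show ?thesis using e(1) at_within_open[of z "ball z e"]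
      by (simp add: F_def)
  qed
  show "holomorphic_in F U"
  proof (rule holomorphic_inI[OF D])
    fix z c v assume z: "z \<in> U"
    have "D z (c *s v) = integral {0..1} (\<lambda>x. c * (w x * rpart v f (z + \<gamma> x)))"
      unfolding D_def by (rule integral_cong) (simp add: rpart_scalar_mult[OF f(1) sub[OF z]])
    then show "D z (c *s v) = c * D z v" by (simp add: D_def)
  qed
  show "z \<in> U \<Longrightarrow> rpart v F z = integral {0..1} (\<lambda>x. w x * rpart v f (z + \<gamma> x))"
    using rpart_eqI[OF D] by (simp add: D_def)
qed

lemma holomorphic_in_local:
  assumes "\<And>z. z \<in> S \<Longrightarrow> \<exists>V. z \<in> V \<and> holomorphic_in f V"
  shows "holomorphic_in f S"
  using assms unfolding holomorphic_in_def by blast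

text \<open>Near \<open>z\<close> the derivative coincides with a circle mean of \<open>f\<close>,
  so it is holomorphic, and a further derivative moves under the integral onto \<open>f\<close>,
  which gives the symmetry. The symmetry is conditional because holomorphy of
  \<open>rpart u f\<close> on all of \<open>S\<close> is only obtained from the first half, in the
  next lemma.\<close>

lemma rpart_circle_integral:
  assumes f: "holomorphic_in f S" "open S" and z: "z \<in> S"
  obtains e where "e > 0" "ball z e \<subseteq> S" "holomorphic_in (rpart v f) (ball z e)"
    "\<And>u. holomorphic_in (rpart u f) S \<Longrightarrow> rpart u (rpart v f) z = rpart v (rpart u f) z"
proof -
  obtain r e where re: "r > 0" "e > 0" "\<And>w t. w \<in> ball z e \<Longrightarrow> cmod t \<le> r \<Longrightarrow> w + t *s v \<in> S"
    using circle_radius[OF f(2) z] by metis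
  let ?w = "\<lambda>x. 1 / (of_real r * unit_circle x)" and ?\<gamma> = "\<lambda>x. (of_real r * unit_circle x) *s v"
  define F where "F z = integral {0..1} (\<lambda>x. ?w x * f (z + ?\<gamma> x))" for z
  have c: "w + ?\<gamma> x \<in> S" if "w \<in> ball z e" for w x
    using re that by (auto simp: norm_mult)
  have cc: "continuous_on {0..1} ?\<gamma>" "continuous_on {0..1} ?w" 
    using re by (auto intro!: continuous_intros)
  note H = holomorphic_in_circle_integral[OF f open_ball[of z e] c cc, folded F_def]
  have FR: "F w = rpart v f w" if "w \<in> ball z e" for w
    using integral_unique[OF circle_mean(2)[OF f(1) re(1) re(3)[OF that]]] by (simp add: F_def)
  have "holomorphic_in (rpart v f) (ball z e)"
    by (rule holomorphic_in_cong[OF _ FR H(1)]) auto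
  moreover have "rpart u (rpart v f) z = rpart v (rpart u f) z" if g: "holomorphic_in (rpart u f) S" for u
  proof -
    have "rpart u (rpart v f) z = rpart u F z"
      by (rule rpart_cong[of "ball z e"]) (use FR re in auto)
    also have "\<dots> = integral {0..1} (\<lambda>x. ?w x * rpart u f (z + ?\<gamma> x))"
      using H(2) re by simp
    also have "\<dots> = rpart v (rpart u f) z"
      using integral_unique[OF circle_mean(2)[OF g re(1) re(3), of z]] re by simp
    finally show ?thesis .
  qed
  moreover have "ball z e \<subseteq> S" using re(3)[of _ 0] re(1) by auto
  ultimately show ?thesis using re(2) that by blast
qed

lemma holomorphic_in_rpart:
  assumes "holomorphic_in f S" "open S"
  shows "holomorphic_in (rpart v f) S"
proof (rule holomorphic_in_local)
  fix z assume "z \<in> S"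
  from rpart_circle_integral[OF assms this, of v]
  show "\<exists>V. z \<in> V \<and> holomorphic_in (rpart v f) V" by (metis centre_in_ball)
qed

lemma rpart_commute:
  assumes "holomorphic_in f S" "open S" "z \<in> S"
  shows "rpart u (rpart v f) z = rpart v (rpart u f) z"
proof -
  have "\<forall>u. rpart u (rpart v f) z = rpart v (rpart u f) z"
    by (rule rpart_circle_integral[OF assms, of v]) (simp add: holomorphic_in_rpart[OF assms(1,2)])
  then show ?thesis by blast
qed

section \<open>The mean value property on balls\<close>

lemma nn_integral_lborel_translate:
  fixes f :: "'a::euclidean_space \<Rightarrow> ennreal"
  assumes "f \<in> borel_measurable borel"
  shows "(\<integral>\<^sup>+x. f (x + c) \<partial>lborel) = (\<integral>\<^sup>+x. f x \<partial>lborel)"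
proof -
  have "(\<integral>\<^sup>+x. f x \<partial>lborel) = (\<integral>\<^sup>+x. f x \<partial>distr lborel borel ((+) c))"
    by (simp add: lborel_distr_plus)
  also have "\<dots> = (\<integral>\<^sup>+x. f (x + c) \<partial>lborel)"
    using assms by (subst nn_integral_distr) (auto simp: add.commute)
  finally show ?thesis by simp
qed

text \<open>Uniqueness of Haar measure, in the form \<open>M A * N B = M (- B) * N A\<close> for translation
  invariant \<open>M\<close> and \<open>N\<close>, applied to the unit ball \<open>B\<close>.\<close>

lemma lborel_distr_isometry:
  fixes T :: "'a::euclidean_space \<Rightarrow> 'a"
  assumes T: "linear T" "\<And>x. norm (T x) = norm x"
  shows "distr lborel borel T = lborel"
proof (rule measure_eqI)
  have [measurable]: "T \<in> borel_measurable borel"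
    by (intro borel_measurable_continuous_onI linear_continuous_on linear_conv_bounded_linear[THEN iffD1] T)
  have "inj T" 
    using T by (metis linear_injective_0 norm_eq_zero)
  then have "surj T" using T linear_injective_imp_surjective by blast
  then obtain T' where T': "\<And>y. T (T' y) = y" by (metis surj_f_inv_f)
  fix A assume "A \<in> sets (distr lborel borel T)"
  then have [measurable]: "A \<in> sets borel" by simp
  have [measurable]: "ball (0::'a) 1 \<in> sets borel" by simp
  let ?A = "indicator A :: 'a \<Rightarrow> ennreal" and ?B = "indicator (ball 0 1) :: 'a \<Rightarrow> ennreal"
  let ?b = "\<integral>\<^sup>+x. ?B x \<partial>(lborel :: 'a measure)"
  have "(\<integral>\<^sup>+x. ?A (T x) \<partial>lborel) * ?b = (\<integral>\<^sup>+x. ?A (T x) * ?b \<partial>lborel)"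
    by (rule nn_integral_multc[symmetric]) simp
  also have "\<dots> = (\<integral>\<^sup>+x. \<integral>\<^sup>+y. ?A (T x) * ?B y \<partial>lborel \<partial>lborel)"
    by (intro nn_integral_cong nn_integral_cmult[symmetric]) measurable
  also have "\<dots> = (\<integral>\<^sup>+y. \<integral>\<^sup>+x. ?A (T x) * ?B y \<partial>lborel \<partial>lborel)"
    by (rule lborel_pair.Fubini'[symmetric]) simp
  \<comment> \<open>Translating \<open>x\<close> by a preimage of \<open>y\<close> replaces
    \<open>T x\<close> by \<open>T x + y\<close> without changing the inner integral.\<close>
  also have "\<dots> = (\<integral>\<^sup>+y. \<integral>\<^sup>+x. ?A (T x + y) * ?B y \<partial>lborel \<partial>lborel)"
  proof (rule nn_integral_cong)
    fix y
    have "(\<integral>\<^sup>+x. ?A (T (x + T' y)) * ?B y \<partial>lborel) = (\<integral>\<^sup>+x. ?A (T x) * ?B y \<partial>lborel)"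
      by (rule nn_integral_lborel_translate) measurable
    then show "(\<integral>\<^sup>+x. ?A (T x) * ?B y \<partial>lborel) = (\<integral>\<^sup>+x. ?A (T x + y) * ?B y \<partial>lborel)"
      by (simp add: linear_add[OF T(1)] T')
  qed
  also have "\<dots> = (\<integral>\<^sup>+x. \<integral>\<^sup>+y. ?A (T x + y) * ?B y \<partial>lborel \<partial>lborel)"
    by (rule lborel_pair.Fubini') simp
  also have "\<dots> = (\<integral>\<^sup>+x. \<integral>\<^sup>+y. ?A y * ?B (y - T x) \<partial>lborel \<partial>lborel)"
  proof (rule nn_integral_cong)
    fix x
    have "(\<integral>\<^sup>+y. ?A (y + T x) * ?B (y + T x - T x) \<partial>lborel) = (\<integral>\<^sup>+y. ?A y * ?B (y - T x) \<partial>lborel)"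
      by (rule nn_integral_lborel_translate) measurable
    then show "(\<integral>\<^sup>+y. ?A (T x + y) * ?B y \<partial>lborel) = (\<integral>\<^sup>+y. ?A y * ?B (y - T x) \<partial>lborel)"
      by (simp add: add.commute)
  qed
  also have "\<dots> = (\<integral>\<^sup>+y. \<integral>\<^sup>+x. ?A y * ?B (y - T x) \<partial>lborel \<partial>lborel)"
    by (rule lborel_pair.Fubini'[symmetric]) simp
  \<comment> \<open>The isometry enters here: the ball around \<open>y\<close> pulls back under
    \<open>T\<close> to the ball around a preimage of \<open>y\<close>, which has the measure of the
    unit ball.\<close>
  also have "\<dots> = (\<integral>\<^sup>+y. ?A y * ?b \<partial>lborel)"
  proof (rule nn_integral_cong)
    fix y
    have "(\<integral>\<^sup>+x. ?B (x + (- T' y)) \<partial>lborel) = ?b"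
      by (rule nn_integral_lborel_translate) measurable
    moreover have "?B (y - T x) = ?B (x + (- T' y))" for x
    proof -
      have "norm (x - T' y) = norm (y - T x)"
        using T(2)[of "x - T' y"] by (simp add: linear_diff[OF T(1)] T' norm_minus_commute)
      then show ?thesis by (simp add: indicator_def)
    qed
    ultimately show "(\<integral>\<^sup>+x. ?A y * ?B (y - T x) \<partial>lborel) = ?A y * ?b"
      by (simp add: nn_integral_cmult)
  qed
  also have "\<dots> = (\<integral>\<^sup>+y. ?A y \<partial>lborel) * ?b"
    by (rule nn_integral_multc) simp
  finally have *: "(\<integral>\<^sup>+x. ?A (T x) \<partial>lborel) * ?b = (\<integral>\<^sup>+y. ?A y \<partial>lborel) * ?b" .
  have b: "?b = emeasure lborel (ball (0::'a) 1)" by simp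
  have "0 < measure lborel (ball (0::'a) 1)"
    using content_ball_pos[of 1 "0::'a"] by simp
  then have "?b \<noteq> 0" unfolding b by (metis measure_eq_emeasure_eq_ennreal enn2real_0 measure_def order_less_irrefl)
  moreover have "?b \<noteq> \<top>" unfolding b using emeasure_lborel_ball_finite[of "0::'a" 1] by simp
  ultimately have "(\<integral>\<^sup>+x. ?A (T x) \<partial>lborel) = (\<integral>\<^sup>+y. ?A y \<partial>lborel)"
    using * by (metis ennreal_mult_cancel_left mult.commute)
  moreover have "(\<integral>\<^sup>+x. ?A (T x) \<partial>lborel) = (\<integral>\<^sup>+x. ?A x \<partial>distr lborel borel T)"
    by (subst nn_integral_distr) auto
  ultimately show "emeasure (distr lborel borel T) A = emeasure lborel A" by simp
qed simp

lemma lborel_integral_unit_scalar_mult: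
  fixes g :: "complex ^ 'm \<Rightarrow> 'b::{banach, second_countable_topology}"
  assumes "cmod c = 1" "g \<in> borel_measurable borel"
  shows "(LINT v|lborel. g (c *s v)) = (LINT v|lborel. g v)"
proof -
  have lin: "linear (\<lambda>v::complex ^ 'm. c *s v)"
    by (rule bounded_linear.linear[OF bounded_linear_scalar_mult_right])
  have "(LINT v|lborel. g v) = (LINT v|distr lborel borel (\<lambda>v. c *s v). g v)"
    using lborel_distr_isometry[OF lin] assms by (simp add: norm_scalar_mult)
  also have "\<dots> = (LINT v|lborel. g (c *s v))"
    using assms(2) by (subst integral_distr)
      (auto intro!: borel_measurable_continuous_onI linear_continuous_on bounded_linear_scalar_mult_right)
  finally show ?thesis by simp
qed

text \<open>Ball and measure are invariant under multiplication by the unit circle, so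
  \<open>f\<close> may first be averaged over all rotations of \<open>v\<close>; on the complex line
  through \<open>v\<close> that average is the value at the centre.\<close>

lemma ball_mean:
  fixes f :: "complex ^ 'm \<Rightarrow> complex"
  assumes f: "holomorphic_in f S" and r: "r > 0" "cball z r \<subseteq> S"
  shows "(LINT v:cball 0 r|lborel. f (z + v)) = measure lborel (cball (0::complex ^ 'm) r) *\<^sub>R f z"
proof -
  let ?C = "cball (0::complex ^ 'm) r"
  define g where "g v = indicator ?C v *\<^sub>R f (z + v)" for v
  have cf: "continuous_on ?C (\<lambda>v. f (z + v))"
    by (rule continuous_on_compose2[OF holomorphic_in_continuous_on[OF f]])
      (use r in \<open>auto intro!: continuous_intros simp: dist_norm subset_iff\<close>)
  have gm: "g \<in> borel_measurable borel"
    unfolding g_def by (rule borel_measurable_continuous_on_indicator[OF _ cf]) simp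
  have ind: "indicator ?C (unit_circle x *s v) = (indicator ?C v :: real)" for x v
    by (simp add: indicator_def norm_scalar_mult)
  \<comment> \<open>The indicator restricts to a compact set, where continuity supplies the
    integrability that Fubini asks for.\<close>
  define h where "h x v = indicator ({0..1::real} \<times> ?C) (x, v) *\<^sub>R f (z + unit_circle x *s v)" for x v
  have "continuous_on ({0..1::real} \<times> ?C) (\<lambda>p. f (z + unit_circle (fst p) *s snd p))"
  proof (rule continuous_on_compose2[OF holomorphic_in_continuous_on[OF f]])
    show "continuous_on ({0..1::real} \<times> ?C) (\<lambda>p. z + unit_circle (fst p) *s snd p)"
      unfolding vector_scalar_mult_def
      by (intro continuous_intros continuous_on_compose2[OF continuous_on_unit_circle]) auto
    show "(\<lambda>p. z + unit_circle (fst p) *s snd p) ` ({0..1} \<times> ?C) \<subseteq> S"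
      using r by (auto simp: dist_norm subset_iff norm_scalar_mult)
  qed
  then have "integrable lborel (\<lambda>p. indicator ({0..1::real} \<times> ?C) p *\<^sub>R f (z + unit_circle (fst p) *s snd p))"
    by (intro borel_integrable_compact compact_Times) auto
  then have int: "integrable (lborel \<Otimes>\<^sub>M lborel) (case_prod h)"
    unfolding lborel_prod h_def by (simp add: case_prod_unfold)
  have "(LINT v|lborel. g v) = (LINT x|lborel. LINT v|lborel. h x v)"
  proof -
    have "(LINT v|lborel. h x v) = indicator {0..1} x *\<^sub>R (LINT v|lborel. g v)" for x
    proof -
      have "(LINT v|lborel. h x v) = (LINT v|lborel. indicator {0..1} x *\<^sub>R g (unit_circle x *s v))"
        by (rule Bochner_Integration.integral_cong) (auto simp: h_def g_def ind indicator_times)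
      then show ?thesis using lborel_integral_unit_scalar_mult[OF norm_unit_circle gm] by simp
    qed
    then show ?thesis by simp
  qed
  also have "\<dots> = (LINT v|lborel. LINT x|lborel. h x v)"
    using lborel_pair.Fubini_integral[OF int] by simp
  also have "\<dots> = (LINT v|lborel. indicator ?C v *\<^sub>R f z)"
  proof (rule Bochner_Integration.integral_cong[OF refl])
    fix v
    show "(LINT x|lborel. h x v) = indicator ?C v *\<^sub>R f z"
    proof (cases "v \<in> ?C")
      case True
      have sub: "z + t *s v \<in> S" if "cmod t \<le> 1" for t
      proof -
        have "norm (t *s v) \<le> 1 * r"
          unfolding norm_scalar_mult using that True by (intro mult_mono) auto
        then show ?thesis using r by (auto simp: dist_norm subset_iff)
      qed
      have "set_integrable lborel {0..1::real} (\<lambda>x. f (z + unit_circle x *s v))"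
        unfolding set_integrable_def
        by (intro borel_integrable_compact continuous_on_compose2[OF holomorphic_in_continuous_on[OF f]]
            continuous_intros) (use sub in auto)
      then have "(LINT x:{0..1}|lborel. f (z + unit_circle x *s v)) = integral {0..1} (\<lambda>x. f (z + unit_circle x *s v))"
        by (rule set_borel_integral_eq_integral)
      also have "\<dots> = f z"
        using integral_unique[OF circle_mean(1)[OF f, of 1 z v]] sub by simp
      finally show ?thesis using True by (simp add: set_lebesgue_integral_def h_def indicator_times)
    qed (simp add: h_def)
  qed
  also have "\<dots> = measure lborel ?C *\<^sub>R f z"
    by (subst integral_scaleR_left) (auto intro!: integrable_real_indicator emeasure_lborel_cball_finite)
  finally show ?thesis by (simp add: set_lebesgue_integral_def g_def)
qed

text \<open>The mean value property is applied to the holomorphic square \<open>f z * f z\<close>,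
  whose modulus is the integrand of the norm; the bound is then the triangle inequality for
  integrals.\<close>

lemma bergman_space_point_bound:
  fixes f :: "complex ^ 'm \<Rightarrow> complex"
  assumes f: "f \<in> bergman_space S" and S: "open S" and r: "r > 0" "cball z r \<subseteq> S"
  shows "(cmod (f z))\<^sup>2 * measure lborel (cball (0::complex ^ 'm) r) \<le> (LINT x:S|lebesgue. (cmod (f x))\<^sup>2)"
proof -
  let ?C = "cball (0::complex ^ 'm) r"
  have hol: "holomorphic_in f S" and int: "set_integrable lebesgue S (\<lambda>z. (cmod (f z))\<^sup>2)"
    using f by (auto simp: bergman_space_def)
  have m: "(\<lambda>x. indicator S x *\<^sub>R (cmod (f x))\<^sup>2) \<in> borel_measurable borel"
    using S by (intro borel_measurable_continuous_on_indicator continuous_intros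
      holomorphic_in_continuous_on[OF hol]) auto
  have intb: "integrable lborel (\<lambda>x. indicator S x *\<^sub>R (cmod (f x))\<^sup>2)"
    using int m unfolding set_integrable_def by (simp add: integrable_completion)
  have "(cmod (f z))\<^sup>2 * measure lborel ?C = cmod (measure lborel ?C *\<^sub>R (f z * f z))"
    by (simp add: norm_mult power2_eq_square)
  also have "\<dots> = cmod (LINT v:?C|lborel. f (z + v) * f (z + v))"
    using ball_mean[OF holomorphic_in_mult[OF hol hol] r] by simp
  also have "\<dots> \<le> (LINT v|lborel. cmod (indicator ?C v *\<^sub>R (f (z + v) * f (z + v))))"
    unfolding set_lebesgue_integral_def by (rule integral_norm_bound)
  also have "\<dots> \<le> (LINT v|lborel. indicator S (z + v) *\<^sub>R (cmod (f (z + v)))\<^sup>2)"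
  proof (rule integral_mono')
    show "integrable lborel (\<lambda>v. indicator S (z + v) *\<^sub>R (cmod (f (z + v)))\<^sup>2)"
      using lborel_integrable_real_affine_iff intb 
      by (subst (asm) lborel_distr_plus[symmetric, of z], subst (asm) integrable_distr_eq) (use m in auto)
  qed (use r in \<open>auto simp: indicator_def norm_mult power2_eq_square dist_norm subset_iff\<close>)
  also have "\<dots> = (LINT x|lborel. indicator S x *\<^sub>R (cmod (f x))\<^sup>2)"
    by (subst (2) lborel_distr_plus[symmetric, of z], subst integral_distr) (use m in auto)
  also have "\<dots> = (LINT x:S|lebesgue. (cmod (f x))\<^sup>2)"
    using m unfolding set_lebesgue_integral_def by (simp add: integral_completion)
  finally show ?thesis .
qed

section \<open>Zero sets and removable singularities\<close>

text \<open>Scale invariance: under doubling, the area factor 4 cancels the factor from the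
  integrand, so the discs of radius \<open>r\<close> and \<open>r / 2\<close> have equal integrals.
  If these were finite, the annulus between them would contribute zero, although the integrand is
  positive there.\<close>

lemma nn_integral_inverse_square_disc:
  assumes "r > 0"
  shows "(\<integral>\<^sup>+z. indicator (ball 0 r) z * ennreal (1 / (cmod z)\<^sup>2) \<partial>lborel) = \<infinity>"
proof (rule ccontr)
  let ?f = "\<lambda>r z. indicator (ball (0::complex) r) z * ennreal (1 / (cmod z)\<^sup>2)"
  let ?A = "ball (0::complex) r - ball 0 (r/2)"
  let ?g = "\<lambda>z. indicator ?A z * ennreal (1 / (cmod z)\<^sup>2)"
  have [measurable]: "ball (0::complex) s \<in> sets borel" for s by simp
  have [measurable]: "?f s \<in> borel_measurable borel" for s by measurable
  assume fin: "(\<integral>\<^sup>+z. ?f r z \<partial>lborel) \<noteq> \<infinity>"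
  have "(\<integral>\<^sup>+z. ?f r z \<partial>lborel) =
      (\<integral>\<^sup>+z. ?f r z \<partial>density (distr lborel borel (\<lambda>x. 0 + 2 *\<^sub>R x)) (\<lambda>_. \<bar>2\<bar>^DIM(complex)))"
    using arg_cong[OF lborel_affine[of 2 "0::complex"], of "\<lambda>M. nn_integral M (?f r)"] by simp
  also have "\<dots> = (\<integral>\<^sup>+x. ennreal 4 * ?f r (2 *\<^sub>R x) \<partial>lborel)"
    by (subst nn_integral_density, simp, simp, subst nn_integral_distr) simp_all
  also have "\<dots> = (\<integral>\<^sup>+z. ?f (r/2) z \<partial>lborel)"
  proof (rule nn_integral_cong)
    fix x :: complex
    have "ennreal 4 * ennreal (1 / (cmod (2 *\<^sub>R x))\<^sup>2) = ennreal (1 / (cmod x)\<^sup>2)"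
      by (subst ennreal_mult[symmetric]) (auto simp: power_mult_distrib)
    moreover have "indicator (ball 0 r) (2 *\<^sub>R x) = (indicator (ball 0 (r/2)) x :: ennreal)"
      by (auto simp: indicator_def)
    moreover have "ennreal 4 * ?f r (2 *\<^sub>R x) =
        indicator (ball 0 r) (2 *\<^sub>R x) * (ennreal 4 * ennreal (1 / (cmod (2 *\<^sub>R x))\<^sup>2))"
      by (rule mult.left_commute)
    ultimately show "ennreal 4 * ?f r (2 *\<^sub>R x) = ?f (r/2) x" by simp
  qed
  finally have half: "(\<integral>\<^sup>+z. ?f r z \<partial>lborel) = (\<integral>\<^sup>+z. ?f (r/2) z \<partial>lborel)" .
  have "(\<integral>\<^sup>+z. ?f r z \<partial>lborel) = (\<integral>\<^sup>+z. ?f (r/2) z + ?g z \<partial>lborel)"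
    using assms by (intro nn_integral_cong) (auto simp: indicator_def)
  also have "\<dots> = (\<integral>\<^sup>+z. ?f (r/2) z \<partial>lborel) + (\<integral>\<^sup>+z. ?g z \<partial>lborel)"
    by (rule nn_integral_add) auto
  finally have "(\<integral>\<^sup>+z. ?f r z \<partial>lborel) + (\<integral>\<^sup>+z. ?g z \<partial>lborel) = (\<integral>\<^sup>+z. ?f r z \<partial>lborel) + 0"
    unfolding half[symmetric] by (simp only: add_0_right)
  then have "(\<integral>\<^sup>+z. ?g z \<partial>lborel) = 0"
    unfolding ennreal_add_left_cancel using fin by blast
  then have "AE z in lborel. ?g z = 0"
    by (subst (asm) nn_integral_0_iff_AE) auto
  \<comment> \<open>A disc inside the annulus, tangent to both bounding circles.\<close>
  then have "AE z in lborel. z \<notin> ball (of_real (3 * r / 4) :: complex) (r / 4)"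
  proof (rule AE_mp, intro AE_I2 impI notI)
    fix z :: complex assume z: "?g z = 0" "z \<in> ball (of_real (3 * r / 4)) (r / 4)"
    have "cmod (of_real (3 * r / 4)) \<le> cmod z + dist (of_real (3 * r / 4)) z" 
      using norm_triangle_ineq[of z "of_real (3 * r / 4) - z"] by (simp add: dist_norm)
    moreover have "cmod z \<le> cmod (of_real (3 * r / 4)) + dist (of_real (3 * r / 4)) z"
      using norm_triangle_ineq[of "z - of_real (3 * r / 4)" "of_real (3 * r / 4)"] by (simp add: dist_norm norm_minus_commute)
    ultimately have "cmod z < r" "r / 2 < cmod z"
      using z(2) assms by (auto simp del: of_real_divide of_real_mult)
    then show False using z(1) assms by (auto simp: indicator_def)
  qed
  then have "ball (of_real (3 * r / 4) :: complex) (r / 4) \<in> null_sets lborel"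
    by (subst AE_iff_null_sets) auto
  then have "measure lborel (ball (of_real (3 * r / 4) :: complex) (r / 4)) = 0"
    by (simp add: null_sets_def measure_def)
  then show False using content_ball_pos[of "r/4" "of_real (3 * r / 4) :: complex"] assms by simp
qed

text \<open>Whatever the order of the pole, the reciprocal of \<open>f\<close> extends
  holomorphically by 0 at \<open>a\<close> and is therefore at most linear in the distance to
  \<open>a\<close>. Hence \<open>f\<close> dominates a multiple of the reciprocal distance, whose
  square is not integrable in the plane.\<close>

lemma nn_integral_square_pole:
  assumes f: "f holomorphic_on ball a \<rho> - {a}" "is_pole f a" and "\<rho> > 0"
  shows "(\<integral>\<^sup>+z. indicator (ball a \<rho>) z * ennreal ((cmod (f z))\<^sup>2) \<partial>lborel) = \<infinity>"
proof -
  have "eventually (\<lambda>z. 1 \<le> cmod (f z)) (at a)"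
    using f(2) unfolding is_pole_def filterlim_at_infinity[OF order.refl] by auto
  then obtain d' where d': "d' > 0" "\<And>z. z \<noteq> a \<Longrightarrow> dist z a < d' \<Longrightarrow> 1 \<le> cmod (f z)"
    unfolding eventually_at by auto
  define d where "d = min d' \<rho>"
  have d: "d > 0" "d \<le> \<rho>" "\<forall>z\<in>ball a d - {a}. f z \<noteq> 0"
    using d' assms by (force simp: d_def dist_commute)+
  define g where "g z = (if z = a then 0 else inverse (f z))" for z
  have "g holomorphic_on ball a d"
    unfolding g_def[abs_def]
    by (rule is_pole_inverse_holomorphic) (use d f in \<open>auto intro: holomorphic_on_subset\<close>)
  then obtain g' where "(g has_field_derivative g') (at a)"
    using d(1) by (metis centre_in_ball holomorphic_on_imp_differentiable_at field_differentiable_def open_ball)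
  then have "((\<lambda>z. (g z - g a) / (z - a)) \<longlongrightarrow> g') (at a)"
    by (simp add: has_field_derivative_iff)
  then have "eventually (\<lambda>z. cmod ((g z - g a) / (z - a)) < cmod g' + 1) (at a)"
    by (intro order_tendstoD(2)[OF tendsto_norm]) auto
  then obtain e' where e': "e' > 0" "\<And>z. z \<noteq> a \<Longrightarrow> dist z a < e' \<Longrightarrow> cmod ((g z - g a) / (z - a)) < cmod g' + 1"
    unfolding eventually_at by auto
  define e where "e = min e' d"
  define C where "C = cmod g' + 1"
  have C: "C > 0" by (simp add: C_def add_nonneg_pos)
  have e: "e > 0" "e \<le> d" using e' d by (auto simp: e_def)
  have le: "1 / (cmod (z - a))\<^sup>2 \<le> C\<^sup>2 * (cmod (f z))\<^sup>2" if "z \<in> ball a e" "z \<noteq> a" for z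
  proof -
    have fz: "f z \<noteq> 0" using that e d by auto
    have "cmod (inverse (f z) / (z - a)) \<le> C"
      using e'(2)[of z] that by (auto simp: g_def C_def e_def dist_commute)
    then have *: "inverse (cmod (f z)) / cmod (z - a) \<le> C" by (simp add: norm_divide norm_inverse)
    have "1 \<le> C * (x * y)" if "inverse x / y \<le> C" "x > 0" "y > 0" for x y :: real
      using that by (simp add: field_simps)
    from this[OF *] have "1 \<le> C * (cmod (f z) * cmod (z - a))" using fz that by simp
    then have "1 / cmod (z - a) \<le> C * cmod (f z)"
      using that by (simp add: field_simps)
    then have "(1 / cmod (z - a))\<^sup>2 \<le> (C * cmod (f z))\<^sup>2"
      by (rule power_mono) auto
    then show ?thesis by (simp add: power_divide power_mult_distrib)
  qed
  let ?h = "\<lambda>z. indicator (ball a \<rho>) z * ennreal ((cmod (f z))\<^sup>2)"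
  have fm: "(\<lambda>z. indicator (ball a \<rho> - {a}) z *\<^sub>R f z) \<in> borel_measurable borel"
    by (rule borel_measurable_continuous_on_indicator[OF _ holomorphic_on_imp_continuous_on[OF f(1)]]) auto
  have [measurable]: "ball (0::complex) e \<in> sets borel" by simp
  have "\<infinity> = (\<integral>\<^sup>+z. indicator (ball 0 e) z * ennreal (1 / (cmod z)\<^sup>2) \<partial>(lborel :: complex measure))"
    using nn_integral_inverse_square_disc[OF e(1)] by simp
  also have "\<dots> = (\<integral>\<^sup>+z. indicator (ball 0 e) (z + - a) * ennreal (1 / (cmod (z + - a))\<^sup>2) \<partial>lborel)"
    by (rule nn_integral_lborel_translate[symmetric]) auto
  also have "\<dots> \<le> (\<integral>\<^sup>+z. ennreal (C\<^sup>2) * ennreal ((cmod (indicator (ball a \<rho> - {a}) z *\<^sub>R f z))\<^sup>2) \<partial>lborel)"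
  proof (rule nn_integral_mono)
    fix z
    show "indicator (ball 0 e) (z + - a) * ennreal (1 / (cmod (z + - a))\<^sup>2)
       \<le> ennreal (C\<^sup>2) * ennreal ((cmod (indicator (ball a \<rho> - {a}) z *\<^sub>R f z))\<^sup>2)"
    proof (cases "z \<in> ball a e \<and> z \<noteq> a")
      case True
      then have "z \<in> ball a \<rho> - {a}" using e d by auto
      then show ?thesis using le[of z] True
        by (auto simp: indicator_def dist_norm norm_minus_commute simp flip: ennreal_mult intro!: ennreal_leI)
    qed (auto simp: indicator_def dist_norm norm_minus_commute)
  qed
  also have "\<dots> = ennreal (C\<^sup>2) * (\<integral>\<^sup>+z. ennreal ((cmod (indicator (ball a \<rho> - {a}) z *\<^sub>R f z))\<^sup>2) \<partial>lborel)"
    by (rule nn_integral_cmult) (use fm in measurable)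
  finally have "(\<integral>\<^sup>+z. ennreal ((cmod (indicator (ball a \<rho> - {a}) z *\<^sub>R f z))\<^sup>2) \<partial>lborel) = \<infinity>"
    by (auto simp: ennreal_mult_eq_top_iff top_unique)
  moreover have "(\<integral>\<^sup>+z. ennreal ((cmod (indicator (ball a \<rho> - {a}) z *\<^sub>R f z))\<^sup>2) \<partial>lborel) \<le> (\<integral>\<^sup>+z. ?h z \<partial>lborel)"
    by (rule nn_integral_mono) (auto simp: indicator_def)
  ultimately show ?thesis by (simp add: top_unique)
qed

text \<open>The quotient has at worst poles at the finitely many zeros of \<open>q\<close>, and
  square integrability excludes these, so it extends holomorphically over the disc. The zeros stay
  away from the circle and from the centre, so both sides of the mean value formula show the
  original quotient.\<close>

lemma L2_quotient_mean:
  assumes hol: "p holomorphic_on ball 0 R" "q holomorphic_on ball 0 R" and r: "0 < r" "r < R"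
    and nz: "\<And>t. cmod t = r \<Longrightarrow> q t \<noteq> 0" and q0: "q 0 \<noteq> 0"
    and fin: "(\<integral>\<^sup>+t. indicator (cball 0 r) t * ennreal ((cmod (p t / q t))\<^sup>2) \<partial>lborel) < \<infinity>"
  shows "((\<lambda>x. p (of_real r * unit_circle x) / q (of_real r * unit_circle x)) has_integral p 0 / q 0) {0..1}"
proof -
  define f where "f t = p t / q t" for t
  define Z where "Z = {t \<in> cball 0 r. q t = 0}"
  \<comment> \<open>The finiteness theorem for zeros concerns nonconstant functions; a constant
    \<open>q\<close> has no zeros because \<open>q 0 \<noteq> 0\<close>.\<close>
  have finZ: "finite Z"
  proof (cases "q constant_on ball 0 R")
    case True
    then obtain c where c: "\<And>t. t \<in> ball 0 R \<Longrightarrow> q t = c" by (auto simp: constant_on_def)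
    moreover have "q t \<noteq> 0" if "t \<in> cball 0 r" for t
      using c[of t] c[of 0] q0 r that by auto
    then have "Z = {}" by (auto simp: Z_def)
    then show ?thesis by simp
  next
    case False
    then show ?thesis unfolding Z_def
      using hol r by (intro holomorphic_compact_finite_zeros[of q "ball 0 R"]) auto
  qed
  have fhol: "f holomorphic_on T" if "T \<subseteq> ball 0 R" "\<And>t. t \<in> T \<Longrightarrow> q t \<noteq> 0" for T
    unfolding f_def using hol that by (intro holomorphic_intros) (auto intro: holomorphic_on_subset)
  have ev: "eventually (\<lambda>t. t \<notin> Z) (at a)" for a
  proof -
    have "eventually (\<lambda>t. t \<in> - (Z - {a})) (nhds a)"
      using finZ by (intro eventually_nhds_in_open open_Compl finite_imp_closed) auto
    then show ?thesis by (auto simp: eventually_at_filter elim: eventually_mono)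
  qed
  have "\<exists>l. f \<midarrow>a\<rightarrow> l" if a: "a \<in> Z" for a
  proof -
    have ar: "a \<in> ball 0 r" using a nz[of a] by (auto simp: Z_def less_le)
    have "open (ball 0 r - (Z - {a}))" using finZ by (intro open_Diff finite_imp_closed) auto
    then obtain \<rho> where \<rho>: "\<rho> > 0" "ball a \<rho> \<subseteq> ball 0 r - (Z - {a})"
      using ar openE[of "ball 0 r - (Z - {a})" a] by auto
    have nZ: "q t \<noteq> 0" if "t \<in> ball a \<rho> - {a}" for t
    proof -
      have "t \<in> ball 0 r - (Z - {a})" using that \<rho> by blast
      then show ?thesis using that by (auto simp: Z_def)
    qed
    have b: "ball a \<rho> \<subseteq> ball 0 r" using \<rho> by auto
    then have "ball a \<rho> - {a} \<subseteq> ball 0 R" using r by auto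
    from fhol[OF this nZ] have h: "f holomorphic_on ball a \<rho> - {a}" by simp
    have ho: "p holomorphic_on ball a \<rho>" "q holomorphic_on ball a \<rho>"
      using hol b r by (auto intro!: holomorphic_on_subset[of _ "ball 0 R"])
    have "not_essential f a"
      unfolding f_def[abs_def]
      by (intro not_essential_divide not_essential_holomorphic[of _ "ball a \<rho>"]
          isolated_singularity_at_holomorphic[of _ "ball a \<rho>"])
        (use ho \<rho> in \<open>auto intro: holomorphic_on_subset\<close>)
    moreover have "\<not> is_pole f a"
    proof
      assume "is_pole f a"
      from nn_integral_square_pole[OF h this \<rho>(1)]
      have "\<infinity> = (\<integral>\<^sup>+t. indicator (ball a \<rho>) t * ennreal ((cmod (f t))\<^sup>2) \<partial>lborel)" by simp
      also have "\<dots> \<le> (\<integral>\<^sup>+t. indicator (cball 0 r) t * ennreal ((cmod (p t / q t))\<^sup>2) \<partial>lborel)"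
        by (rule nn_integral_mono) (use b in \<open>auto simp: indicator_def f_def subset_iff less_imp_le\<close>)
      finally show False using fin by simp
    qed
    ultimately show ?thesis by (auto simp: not_essential_def)
  qed
  then obtain l where l: "\<And>a. a \<in> Z \<Longrightarrow> f \<midarrow>a\<rightarrow> l a" by metis
  \<comment> \<open>At a zero of \<open>q\<close> the quotient has the default value 0; the limit
    replaces it.\<close>
  define \<phi> where "\<phi> t = (if t \<in> Z then l t else f t)" for t
  have cont: "isCont \<phi> t" if t: "t \<in> cball 0 r" for t
  proof -
    have e: "eventually (\<lambda>s. f s = \<phi> s) (at t)"
      using ev[of t] by eventually_elim (simp add: \<phi>_def)
    show ?thesis
    proof (cases "t \<in> Z")
      case True
      then show ?thesis using Lim_transform_eventually[OF l[OF True] e] True by (simp add: isCont_def \<phi>_def[of t])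
    next
      case False
      then have "q t \<noteq> 0" using t by (auto simp: Z_def)
      moreover have tR: "t \<in> ball 0 R" using t r by simp
      then have "isCont p t" "isCont q t"
        using hol[THEN holomorphic_on_imp_continuous_on] by (simp_all add: continuous_on_eq_continuous_at)
      ultimately have "f \<midarrow>t\<rightarrow> f t" unfolding f_def by (auto simp: isCont_def intro: tendsto_divide)
      then show ?thesis using Lim_transform_eventually[OF _ e] False by (simp add: isCont_def \<phi>_def[of t])
    qed
  qed
  have "\<phi> holomorphic_on ball 0 r"
  proof (rule no_isolated_singularity)
    have "f holomorphic_on ball 0 r - Z"
      by (rule fhol) (use r in \<open>auto simp: Z_def\<close>)
    then show "\<phi> holomorphic_on ball 0 r - Z"
      by (rule holomorphic_transform) (auto simp: \<phi>_def)
  qed (use finZ cont in \<open>auto intro!: continuous_at_imp_continuous_on\<close>)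
  moreover have "continuous_on (cball 0 r) \<phi>"
    using cont by (auto intro!: continuous_at_imp_continuous_on)
  ultimately have "((\<lambda>x. \<phi> (of_real r * unit_circle x)) has_integral \<phi> 0) {0..1}"
    using r by (intro Cauchy_mean_unit_circle)
  moreover have "\<phi> (of_real r * unit_circle x) = p (of_real r * unit_circle x) / q (of_real r * unit_circle x)" for x
    using nz[of "of_real r * unit_circle x"] r by (auto simp: \<phi>_def f_def Z_def norm_mult)
  ultimately show ?thesis using q0 by (simp add: \<phi>_def f_def Z_def)
qed

section \<open>Zero sets in several variables\<close>

lemma AE_lborel_open:
  assumes "AE x in lborel. P x" "open U" "U \<noteq> {}"
  shows "\<exists>x\<in>U. P x"
proof (rule ccontr)
  assume "\<not> ?thesis"
  then have "AE x in lborel. x \<notin> U" using assms(1) by auto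
  then have "U \<in> null_sets lborel" using assms(2) by (subst AE_iff_null_sets) auto
  then have "negligible U" by (simp add: negligible_iff_null_sets null_sets_completionI)
  then show False using open_not_negligible assms by blast
qed

text \<open>The identity theorem. The interior \<open>W\<close> of the zero set is relatively
  closed: near a limit point every point lies on a complex line through a point of \<open>W\<close>,
  and one-variable continuation along that line carries the vanishing over. Connectedness would then
  make \<open>W\<close> all of \<open>S\<close>, against \<open>q x0 \<noteq> 0\<close>.\<close>

lemma holomorphic_in_nonzero_dense:
  fixes q :: "complex ^ 'm \<Rightarrow> complex"
  assumes S: "open S" "connected S" and q: "holomorphic_in q S" "x0 \<in> S" "q x0 \<noteq> 0"
    and U: "open U" "U \<subseteq> S" "U \<noteq> {}"
  shows "\<exists>x\<in>U. q x \<noteq> 0"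
proof (rule ccontr)
  assume U0: "\<not> ?thesis"
  define W where "W = {x \<in> S. \<exists>e>0. \<forall>y\<in>ball x e. q y = 0}"
  have WS: "W \<subseteq> S" by (auto simp: W_def)
  have "open W"
  proof -
    have "W = S \<inter> interior {x. q x = 0}" by (auto simp: W_def mem_interior subset_iff Ball_def)
    then show ?thesis using S by auto
  qed
  moreover have "closedin (top_of_set S) W"
    unfolding closedin_limpt
  proof (intro conjI allI impI WS)
    fix x assume x: "x islimpt W \<and> x \<in> S"
    then obtain \<rho> where \<rho>: "\<rho> > 0" "ball x \<rho> \<subseteq> S" using S openE by blast
    obtain y where y: "y \<in> W" "y \<in> ball x \<rho>"
      using x \<rho>(1) unfolding islimpt_def by (meson centre_in_ball open_ball)
    obtain e where e: "e > 0" "\<And>u. u \<in> ball y e \<Longrightarrow> q u = 0" using y by (auto simp: W_def)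
    have "q w = 0" if w: "w \<in> ball x \<rho>" for w
    proof -
      \<comment> \<open>\<open>T\<close> is the part of the line inside the ball, convex and hence
        connected; \<open>T0\<close> is an open part around \<open>t = 0\<close> on which
        \<open>q\<close> is already known to vanish.\<close>
      define T where "T = (\<lambda>t::complex. y + t *s (w - y)) -` ball x \<rho>"
      define T0 where "T0 = (\<lambda>t::complex. y + t *s (w - y)) -` (ball y e \<inter> ball x \<rho>)"
      have c: "continuous_on UNIV (\<lambda>t::complex. y + t *s (w - y))" by (intro continuous_intros)
      have lin: "linear (\<lambda>t::complex. t *s (w - y))"
        by (rule bounded_linear.linear[OF bounded_linear_scalar_mult_left])
      have "T = (\<lambda>t::complex. t *s (w - y)) -` ball (x - y) \<rho>"
        by (auto simp: T_def dist_norm algebra_simps)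
      then have "convex T" using convex_linear_vimage[OF lin] by auto
      have "q (y + 1 *s (w - y)) = 0"
      proof (rule analytic_continuation_open[of T0 T "\<lambda>t. q (y + t *s (w - y))" "\<lambda>_. 0"])
        show "open T" "open T0" unfolding T_def T0_def by (intro open_vimage c open_Int open_ball)+
        have "0 \<in> T0" using y e by (simp add: T0_def)
        then show "T0 \<noteq> {}" by blast
        show "connected T" by (rule convex_connected[OF \<open>convex T\<close>])
        show "(\<lambda>t. q (y + t *s (w - y))) holomorphic_on T"
          by (rule holomorphic_on_slice(1)[OF q(1)]) (use \<rho> in \<open>auto simp: T_def\<close>)
      qed (use w e in \<open>auto simp: T_def T0_def\<close>)
      then show ?thesis by simp
    qed
    then show "x \<in> W" using x \<rho> by (auto simp: W_def)
  qed
  moreover have "W \<noteq> {}"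
  proof -
    obtain u where u: "u \<in> U" using U by auto
    then obtain e where "e > 0" "ball u e \<subseteq> U" using U openE by blast
    then have "u \<in> W" using u U U0 by (auto simp: W_def)
    then show ?thesis by auto
  qed
  moreover have "openin (top_of_set S) W" using \<open>open W\<close> WS by (simp add: open_subset)
  ultimately have "W = S" using S by (auto simp: connected_clopen)
  then have "x0 \<in> W" using q by auto
  then show False using q by (auto simp: W_def)
qed

text \<open>Directing \<open>v\<close> from \<open>a\<close> to a nearby nonzero of \<open>q\<close>
  makes \<open>q\<close> nontrivial on the slice through \<open>a\<close>; it has finitely many
  zeros in the unit disc there, and some circle avoids them all. The tube lemma keeps this circle
  free of zeros for all centres close to \<open>a\<close>.\<close>

lemma holomorphic_in_good_direction:
  fixes q :: "complex ^ 'm \<Rightarrow> complex"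
  assumes S: "open S" "connected S" and q: "holomorphic_in q S" "x0 \<in> S" "q x0 \<noteq> 0" and a: "a \<in> S"
  shows "\<exists>v r R e. 0 < r \<and> r < R \<and> e > 0 \<and>
    (\<forall>w t. w \<in> ball a e \<longrightarrow> cmod t < R \<longrightarrow> w + t *s v \<in> S) \<and>
    (\<forall>w t. w \<in> ball a e \<longrightarrow> cmod t = r \<longrightarrow> q (w + t *s v) \<noteq> 0)"
proof -
  obtain d' where d': "d' > 0" "ball a d' \<subseteq> S" using S a openE by blast
  \<comment> \<open>One third is for moving the centre, two thirds for \<open>t *s v\<close> with
    \<open>cmod t < 2\<close>.\<close>
  define d where "d = d' / 3"
  have d: "d > 0" "ball a (3 * d) \<subseteq> S" "ball a d \<subseteq> S" using d' by (auto simp: d_def)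
  obtain y where y: "y \<in> ball a d" "q y \<noteq> 0"
    using holomorphic_in_nonzero_dense[OF S q, of "ball a d"] d by auto
  define v where "v = y - a"
  have v: "norm v < d" using y by (simp add: v_def dist_norm norm_minus_commute)
  have sub: "w + t *s v \<in> S" if "w \<in> ball a d" "cmod t < 2" for w t
  proof -
    have "norm (t *s v) \<le> 2 * d" unfolding norm_scalar_mult using that v by (intro mult_mono) auto
    then have "dist a (w + t *s v) < 3 * d"
      using that(1) norm_triangle_ineq[of "w - a" "t *s v"] by (simp add: dist_norm norm_minus_commute algebra_simps)
    then show ?thesis using d by auto
  qed
  define s where "s t = q (a + t *s v)" for t
  have sh: "s holomorphic_on ball 0 2"
    unfolding s_def[abs_def] by (rule holomorphic_on_slice(1)[OF q(1)]) (use sub d in auto)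
  have s1: "s 1 \<noteq> 0" using y by (simp add: s_def v_def)
  have "finite {t \<in> cball 0 1. s t = 0}"
  proof (cases "s constant_on ball 0 2")
    case True
    then obtain c where c: "\<And>t. t \<in> ball 0 2 \<Longrightarrow> s t = c" by (auto simp: constant_on_def)
    have "s t \<noteq> 0" if "t \<in> cball 0 1" for t using c[of t] c[of 1] s1 that by auto
    then have "{t \<in> cball 0 1. s t = 0} = {}" by auto
    then show ?thesis by (simp only: finite.emptyI)
  next
    case False
    then show ?thesis using sh by (intro holomorphic_compact_finite_zeros[of s "ball 0 2"]) auto
  qed
  then have "finite (cmod ` {t \<in> cball 0 1. s t = 0})" by auto
  then obtain r where r: "0 < r" "r < 1" "r \<notin> cmod ` {t \<in> cball 0 1. s t = 0}"
  proof -
    assume fin: "finite (cmod ` {t \<in> cball 0 1. s t = 0})"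
    have "infinite ({0<..<1::real} - cmod ` {t \<in> cball 0 1. s t = 0})"
      by (rule Diff_infinite_finite[OF fin]) simp
    then have "{0<..<1::real} - cmod ` {t \<in> cball 0 1. s t = 0} \<noteq> {}" by (rule infinite_imp_nonempty)
    then obtain r where "r \<in> {0<..<1::real} - cmod ` {t \<in> cball 0 1. s t = 0}" by blast
    then show thesis by (intro that[of r]) (simp_all only: Diff_iff greaterThanLessThan_iff not_False_eq_True)
  qed
  define D where "D = ball a d \<times> ball (0::complex) 2"
  have "continuous_on D (\<lambda>p. q (fst p + snd p *s v))"
    by (rule continuous_on_compose2[OF holomorphic_in_continuous_on[OF q(1)]])
      (use sub in \<open>auto intro!: continuous_intros simp: D_def\<close>)
  then have o: "open (D \<inter> (\<lambda>p. q (fst p + snd p *s v)) -` (- {0}))"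
    by (intro continuous_open_preimage) (auto simp: D_def open_Times)
  have sub_W: "{a} \<times> sphere 0 r \<subseteq> D \<inter> (\<lambda>p. q (fst p + snd p *s v)) -` (- {0})"
    using r d by (force simp: D_def s_def)
  obtain X where X: "a \<in> X" "open X" "X \<times> sphere 0 r \<subseteq> D \<inter> (\<lambda>p. q (fst p + snd p *s v)) -` (- {0})"
    using Elementary_Topology.tube_lemma[OF compact_sphere o sub_W] by blast
  then obtain e' where e': "e' > 0" "ball a e' \<subseteq> X" using openE by blast
  have nz: "q (w + t *s v) \<noteq> 0" if w: "w \<in> ball a (min e' d)" and t: "cmod t = r" for w t
  proof -
    have "(w, t) \<in> X \<times> sphere 0 r" using w t e'(2) by auto
    from subsetD[OF X(3) this] show "q (w + t *s v) \<noteq> 0" by simp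
  qed
  show ?thesis
    by (rule exI[of _ v], rule exI[of _ r], rule exI[of _ 2], rule exI[of _ "min e' d"])
      (use r d(1) e'(1) sub nz in auto)
qed

lemma holomorphic_in_slice_finite_zeros:
  fixes q :: "complex ^ 'm \<Rightarrow> complex"
  assumes q: "holomorphic_in q S" and r: "0 < r" "r < R"
    and sub: "\<And>t. cmod t < R \<Longrightarrow> w + t *s v \<in> S" and nz: "\<And>t. cmod t = r \<Longrightarrow> q (w + t *s v) \<noteq> 0"
  shows "finite {t \<in> cball 0 r. q (w + t *s v) = 0}"
proof (cases "(\<lambda>t. q (w + t *s v)) constant_on ball 0 R")
  case True
  then obtain c where c: "\<And>t. t \<in> ball 0 R \<Longrightarrow> q (w + t *s v) = c" by (auto simp: constant_on_def)
  have "q (w + t *s v) \<noteq> 0" if "t \<in> cball 0 r" for t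
    using c[of t] c[of "of_real r"] nz[of "of_real r"] r that by auto
  then have "{t \<in> cball 0 r. q (w + t *s v) = 0} = {}" by auto
  then show ?thesis by (simp only: finite.emptyI)
next
  case False
  then show ?thesis
    using r holomorphic_on_slice(1)[OF q, of "ball 0 R" w v] sub
    by (intro holomorphic_compact_finite_zeros[of "\<lambda>t. q (w + t *s v)" "ball 0 R"]) auto
qed

text \<open>Fubini in the skew parametrisation \<open>w + t *s v\<close>: for fixed \<open>w\<close>
  only finitely many \<open>t\<close> hit a zero, so for almost every \<open>t\<close> the set of
  \<open>w\<close> with a zero at \<open>w + t *s v\<close> is null. A single small such
  \<open>t\<close> suffices, since the translate of that null set by \<open>t *s v\<close> covers
  the zeros near \<open>a\<close>.\<close>

lemma holomorphic_in_negligible_zeros: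
  fixes q :: "complex ^ 'm \<Rightarrow> complex"
  assumes S: "open S" "connected S" and q: "holomorphic_in q S" "x0 \<in> S" "q x0 \<noteq> 0"
  shows "negligible {x \<in> S. q x = 0}"
proof (subst locally_negligible_alt, rule ballI)
  fix a assume a: "a \<in> {x \<in> S. q x = 0}"
  then have aS: "a \<in> S" by simp
  obtain v r R e where r: "0 < r" "r < R" "e > 0"
    and sub': "\<forall>w t. w \<in> ball a e \<longrightarrow> cmod t < R \<longrightarrow> w + t *s v \<in> S"
    and nz': "\<forall>w t. w \<in> ball a e \<longrightarrow> cmod t = r \<longrightarrow> q (w + t *s v) \<noteq> 0"
    using holomorphic_in_good_direction[OF S q aS] by (elim exE conjE)
  note sub = sub'[rule_format] and nz = nz'[rule_format]
  define D where "D = ball a e \<times> ball (0::complex) r"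
  define g where "g p = indicator D p *\<^sub>R q (fst p + snd p *s v)" for p
  define W where "W = {p \<in> D. g p = 0}"
  have D: "open D" by (simp add: D_def open_Times)
  have "continuous_on D (\<lambda>p. q (fst p + snd p *s v))"
    by (rule continuous_on_compose2[OF holomorphic_in_continuous_on[OF q(1)]])
      (use sub r in \<open>auto intro!: continuous_intros simp: D_def\<close>)
  then have [measurable]: "g \<in> borel_measurable borel"
    unfolding g_def[abs_def] using D by (intro borel_measurable_continuous_on_indicator) auto
  have [measurable]: "D \<in> sets borel" using D by simp
  have "W = D \<inter> (g -` {0} \<inter> space borel)" by (auto simp: W_def)
  also have "\<dots> \<in> sets borel" by measurable
  finally have W: "W \<in> sets (lborel \<Otimes>\<^sub>M lborel)" unfolding lborel_prod by simp
  have "(\<integral>\<^sup>+t. \<integral>\<^sup>+w. indicator W (w, t) \<partial>lborel \<partial>lborel) = (\<integral>\<^sup>+w. \<integral>\<^sup>+t. indicator W (w, t) \<partial>lborel \<partial>lborel)"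
    by (rule lborel_pair.Fubini') (use W in \<open>auto simp: case_prod_unfold\<close>)
  also have "\<dots> = 0"
  proof -
    have "(\<integral>\<^sup>+t. indicator W (w, t) \<partial>lborel) = 0" for w
    proof (cases "w \<in> ball a e")
      case True
      have f: "finite {t \<in> cball 0 r. q (w + t *s v) = 0}"
        by (rule holomorphic_in_slice_finite_zeros[OF q(1) r(1,2) sub[OF True] nz[OF True]])
      then have "AE t in lborel. t \<notin> {t \<in> cball 0 r. q (w + t *s v) = 0}"
        by (intro AE_not_in) (auto intro: finite_imp_null_set_lborel)
      then have "AE t in lborel. indicator W (w, t) = (0::ennreal)"
        by (rule AE_mp) (auto intro!: AE_I2 simp: indicator_def W_def D_def g_def)
      then show ?thesis by (subst nn_integral_cong_AE[where v="\<lambda>_. 0"]) auto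
    qed (auto simp: indicator_def W_def D_def)
    then show ?thesis by simp
  qed
  finally have "AE t in lborel. (\<integral>\<^sup>+w. indicator W (w, t) \<partial>lborel) = 0"
    by (subst (asm) nn_integral_0_iff_AE)
      (use W in \<open>auto intro!: lborel.borel_measurable_nn_integral simp: case_prod_unfold\<close>)
  note ae = this
  \<comment> \<open>Small enough that \<open>t\<close> lies in the disc used for \<open>D\<close>
    and that the translation moves points by less than \<open>e / 2\<close>.\<close>
  define \<delta> where "\<delta> = min r (e / (2 * (norm v + 1)))"
  have "0 < 2 * (norm v + 1)" by (simp add: add_nonneg_pos)
  then have "\<delta> > 0" using r by (simp add: \<delta>_def)
  then obtain t where "t \<in> ball 0 \<delta>" and t3: "(\<integral>\<^sup>+w. indicator W (w, t) \<partial>lborel) = 0"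
    using AE_lborel_open[OF ae, of "ball 0 \<delta>"] by auto
  then have t: "cmod t < r" "cmod t < e / (2 * (norm v + 1))" by (simp_all add: \<delta>_def)
  let ?N = "{w. (w, t) \<in> W}"
  have Nm: "?N \<in> sets lborel"
    using sets_Pair2[OF W, of t] by (simp add: vimage_def)
  have "emeasure lborel ?N = 0"
  proof -
    have "emeasure lborel ?N = (\<integral>\<^sup>+w. indicator ?N w \<partial>lborel)" using Nm by (simp only: nn_integral_indicator)
    also have "\<dots> = 0" using t3 by (simp add: indicator_def)
    finally show ?thesis .
  qed
  then have "negligible ?N"
    using Nm by (simp add: negligible_iff_null_sets null_sets_def null_sets_completionI)
  then have neg: "negligible ((+) (t *s v) ` ?N)" by (rule negligible_translation)
  have "norm (t *s v) < e / 2"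
  proof -
    have "norm (t *s v) \<le> e / (2 * (norm v + 1)) * norm v"
      unfolding norm_scalar_mult using t by (intro mult_right_mono) auto
    also have "\<dots> < e / 2" using r by (simp add: field_simps add_pos_nonneg)
    finally show ?thesis .
  qed
  then have "{x \<in> S. q x = 0} \<inter> ball a (e / 2) \<subseteq> (+) (t *s v) ` ?N"
  proof (intro subsetI)
    fix x assume x: "x \<in> {x \<in> S. q x = 0} \<inter> ball a (e / 2)" and tv: "norm (t *s v) < e / 2"
    have "dist a (x - t *s v) < e"
      using x tv norm_triangle_ineq[of "a - x" "t *s v"] by (simp add: dist_norm algebra_simps)
    then have "x - t *s v \<in> ?N" using x t by (simp add: W_def D_def g_def)
    then show "x \<in> (+) (t *s v) ` ?N" by (intro image_eqI[of _ _ "x - t *s v"]) auto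
  qed
  then have "negligible ({x \<in> S. q x = 0} \<inter> ball a (e / 2))" using neg negligible_subset by blast
  then show "\<exists>U. openin (top_of_set {x \<in> S. q x = 0}) U \<and> a \<in> U \<and> negligible U"
    using a r by (intro exI[of _ "{x \<in> S. q x = 0} \<inter> ball a (e / 2)"]) auto
qed

text \<open>The extension is the mean of \<open>p / q\<close> over a circle in a fixed direction \<open>v\<close> that avoids the zeros of
  \<open>q\<close>. By Fubini almost every disc parallel to \<open>v\<close> carries a square integrable quotient, which has no
  poles, so there the mean equals the value at the centre.\<close>

lemma L2_quotient_extends_locally:
  fixes p q :: "complex ^ 'm \<Rightarrow> complex"
  assumes S: "open S" "connected S" and q: "holomorphic_in q S" "x0 \<in> S" "q x0 \<noteq> 0"
    and p: "holomorphic_in p S"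
    and fin: "(\<integral>\<^sup>+x. indicator S x * ennreal ((cmod (p x / q x))\<^sup>2) \<partial>lborel) < \<infinity>" and a: "a \<in> S"
  shows "\<exists>e>0. \<exists>H. ball a e \<subseteq> S \<and> holomorphic_in H (ball a e) \<and> (\<forall>x\<in>ball a e. q x \<noteq> 0 \<longrightarrow> H x = p x / q x)"
proof -
  obtain v r R e where r: "0 < r" "r < R" "e > 0"
    and sub': "\<forall>w t. w \<in> ball a e \<longrightarrow> cmod t < R \<longrightarrow> w + t *s v \<in> S"
    and nz': "\<forall>w t. w \<in> ball a e \<longrightarrow> cmod t = r \<longrightarrow> q (w + t *s v) \<noteq> 0"
    using holomorphic_in_good_direction[OF S q a] by (elim exE conjE)
  note sub = sub'[rule_format] and nz = nz'[rule_format]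
  have eS: "ball a e \<subseteq> S" using sub[of _ 0] r by auto
  define S' where "S' = {x \<in> S. q x \<noteq> 0}"
  have S'eq: "S' = S \<inter> q -` (- {0})" by (auto simp: S'_def)
  have S': "open S'"
    unfolding S'eq using holomorphic_in_continuous_on[OF q(1)] S by (intro continuous_open_preimage) auto
  define h where "h x = p x / q x" for x
  have hh: "holomorphic_in h S'"
    unfolding h_def by (rule holomorphic_in_divide) (use p q in \<open>auto simp: S'_def intro: holomorphic_in_subset\<close>)
  define H where "H z = integral {0..1} (\<lambda>x. 1 * h (z + (of_real r * unit_circle x) *s v))" for z
  have Hh: "holomorphic_in H (ball a e)"
    unfolding H_def by (rule holomorphic_in_circle_integral(1)[OF hh S'])
      (use sub nz r in \<open>auto simp: S'_def norm_mult intro!: continuous_intros\<close>)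
  \<comment> \<open>Cutting off at the zeros gives a function that is Borel measurable on the whole
    space, as the product measure argument requires.\<close>
  define k where "k x = indicator S' x *\<^sub>R h x" for x
  have [measurable]: "k \<in> borel_measurable borel"
    unfolding k_def[abs_def] using S' holomorphic_in_continuous_on[OF hh]
    by (intro borel_measurable_continuous_on_indicator) auto
  have [measurable]: "ball a e \<in> sets borel" "cball (0::complex) r \<in> sets borel" by auto
  define F where "F w t = indicator (ball a e) w * (indicator (cball 0 r) t * ennreal ((cmod (k (w + t *s v)))\<^sup>2))" for w t
  have [measurable]: "(\<lambda>p. fst p + snd p *s v) \<in> borel_measurable borel"
    by (intro borel_measurable_continuous_onI continuous_intros)
  have Fm: "case_prod F \<in> borel_measurable (lborel \<Otimes>\<^sub>M lborel)"
  proof -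
    have "(\<lambda>p. k (fst p + snd p *s v)) \<in> borel_measurable borel" by measurable
    then have [measurable]: "(\<lambda>p. k (fst p + snd p *s v)) \<in> borel_measurable (lborel \<Otimes>\<^sub>M lborel)"
      by (simp add: lborel_prod)
    show ?thesis unfolding F_def case_prod_unfold by measurable
  qed
  let ?I = "\<integral>\<^sup>+x. indicator S x * ennreal ((cmod (p x / q x))\<^sup>2) \<partial>lborel"
  have kI: "(\<integral>\<^sup>+x. ennreal ((cmod (k x))\<^sup>2) \<partial>lborel) = ?I"
    by (intro nn_integral_cong) (auto simp: k_def indicator_def S'_def h_def)
  have "(\<integral>\<^sup>+w. \<integral>\<^sup>+t. F w t \<partial>lborel \<partial>lborel) = (\<integral>\<^sup>+t. \<integral>\<^sup>+w. F w t \<partial>lborel \<partial>lborel)"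
    by (rule lborel_pair.Fubini'[OF Fm, symmetric])
  \<comment> \<open>For fixed \<open>t\<close> the integral over \<open>w\<close> is one over a
    translate, so it is bounded by the global norm uniformly in \<open>t\<close>.\<close>
  also have "\<dots> \<le> (\<integral>\<^sup>+t. indicator (cball (0::complex) r) t * ?I \<partial>lborel)"
  proof (rule nn_integral_mono)
    fix t
    have "(\<integral>\<^sup>+w. F w t \<partial>lborel) \<le> (\<integral>\<^sup>+w. indicator (cball 0 r) t * ennreal ((cmod (k (w + t *s v)))\<^sup>2) \<partial>lborel)"
      by (rule nn_integral_mono) (auto simp: F_def indicator_def)
    also have "\<dots> = indicator (cball 0 r) t * (\<integral>\<^sup>+w. ennreal ((cmod (k (w + t *s v)))\<^sup>2) \<partial>lborel)"
      by (rule nn_integral_cmult) measurable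
    also have "(\<integral>\<^sup>+w. ennreal ((cmod (k (w + t *s v)))\<^sup>2) \<partial>lborel) = ?I"
      unfolding kI[symmetric] by (rule nn_integral_lborel_translate) measurable
    finally show "(\<integral>\<^sup>+w. F w t \<partial>lborel) \<le> indicator (cball 0 r) t * ?I" .
  qed
  also have "\<dots> = emeasure lborel (cball (0::complex) r) * ?I"
    by (subst nn_integral_multc) auto
  also have "\<dots> < \<infinity>"
    using fin emeasure_lborel_cball_finite[of "0::complex" r] by (simp add: ennreal_mult_less_top)
  finally have "AE w in lborel. (\<integral>\<^sup>+t. F w t \<partial>lborel) \<noteq> \<infinity>"
    by (intro nn_integral_PInf_AE lborel.borel_measurable_nn_integral Fm) auto
  then have ae: "AE w in lborel. w \<in> ball a e \<longrightarrow> q w \<noteq> 0 \<longrightarrow> H w = h w"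
  proof (rule AE_mp, intro AE_I2 impI)
    fix w assume w: "(\<integral>\<^sup>+t. F w t \<partial>lborel) \<noteq> \<infinity>" "w \<in> ball a e" "q w \<noteq> 0"
    have "(\<integral>\<^sup>+t. indicator (cball 0 r) t * ennreal ((cmod (p (w + t *s v) / q (w + t *s v)))\<^sup>2) \<partial>lborel)
      = (\<integral>\<^sup>+t. F w t \<partial>lborel)"
      by (intro nn_integral_cong)
        (use w sub r in \<open>auto simp: F_def k_def indicator_def S'_def h_def\<close>)
    then have "((\<lambda>x. p (w + (of_real r * unit_circle x) *s v) / q (w + (of_real r * unit_circle x) *s v))
       has_integral p (w + 0 *s v) / q (w + 0 *s v)) {0..1}"
      using w r sub nz
      by (intro L2_quotient_mean[where p="\<lambda>t. p (w + t *s v)" and q="\<lambda>t. q (w + t *s v)" and R=R]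
          holomorphic_on_slice(1)[OF p] holomorphic_on_slice(1)[OF q(1)]) (auto simp: top.not_eq_extremum)
    from integral_unique[OF this] show "H w = h w"
      by (simp add: H_def h_def)
  qed
  \<comment> \<open>From almost everywhere to everywhere: the set of disagreement off the zeros is
    open, and a nonempty open set is not null.\<close>
  have "H x = p x / q x" if x: "x \<in> ball a e" "q x \<noteq> 0" for x
  proof (rule ccontr)
    assume ne: "H x \<noteq> p x / q x"
    let ?U = "(ball a e \<inter> S') \<inter> (\<lambda>x. H x - h x) -` (- {0})"
    have "continuous_on (ball a e \<inter> S') (\<lambda>x. H x - h x)"
      using holomorphic_in_continuous_on[OF Hh] holomorphic_in_continuous_on[OF hh]
      by (auto intro!: continuous_intros intro: continuous_on_subset)
    then have "open ?U" using S' by (intro continuous_open_preimage) auto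
    moreover have "x \<in> ?U" using x ne subsetD[OF eS x(1)] by (simp add: S'_def h_def)
    then have "?U \<noteq> {}" by blast
    ultimately obtain u where "u \<in> ?U" "u \<in> ball a e \<longrightarrow> q u \<noteq> 0 \<longrightarrow> H u = h u"
      using AE_lborel_open[OF ae] by blast
    then show False by (auto simp: S'_def)
  qed
  then show ?thesis using r eS Hh by blast
qed

text \<open>Two local extensions agree with the quotient on the dense set where \<open>q\<close> is
  nonzero, hence with each other on overlaps by continuity. So the extension chosen at the point
  itself, \<open>H x x\<close>, is locally equal to any one of them.\<close>

lemma L2_quotient_extends:
  fixes p q :: "complex ^ 'm \<Rightarrow> complex"
  assumes S: "open S" "connected S" and q: "holomorphic_in q S" "x0 \<in> S" "q x0 \<noteq> 0"
    and p: "holomorphic_in p S"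
    and fin: "(\<integral>\<^sup>+x. indicator S x * ennreal ((cmod (p x / q x))\<^sup>2) \<partial>lborel) < \<infinity>"
  obtains H where "holomorphic_in H S" "\<And>x. x \<in> S \<Longrightarrow> q x \<noteq> 0 \<Longrightarrow> H x = p x / q x"
proof -
  have "\<forall>a\<in>S. \<exists>e H. e > 0 \<and> ball a e \<subseteq> S \<and> holomorphic_in H (ball a e) \<and> (\<forall>x\<in>ball a e. q x \<noteq> 0 \<longrightarrow> H x = p x / q x)"
    using L2_quotient_extends_locally[OF assms] by blast
  then obtain e H where eH: "\<And>a. a \<in> S \<Longrightarrow> e a > 0" "\<And>a. a \<in> S \<Longrightarrow> ball a (e a) \<subseteq> S"
    "\<And>a. a \<in> S \<Longrightarrow> holomorphic_in (H a) (ball a (e a))"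
    "\<And>a x. a \<in> S \<Longrightarrow> x \<in> ball a (e a) \<Longrightarrow> q x \<noteq> 0 \<Longrightarrow> H a x = p x / q x"
    by metis
  have eq: "H a y = H y y" if a: "a \<in> S" and y: "y \<in> ball a (e a)" for a y
  proof (rule ccontr)
    assume ne: "H a y \<noteq> H y y"
    have yS: "y \<in> S" using a y eH(2) by blast
    let ?V = "ball a (e a) \<inter> ball y (e y)"
    let ?U = "?V \<inter> (\<lambda>x. H a x - H y x) -` (- {0})"
    have "continuous_on ?V (\<lambda>x. H a x - H y x)"
      using holomorphic_in_continuous_on[OF eH(3)[OF a]] holomorphic_in_continuous_on[OF eH(3)[OF yS]]
      by (auto intro!: continuous_intros intro: continuous_on_subset)
    then have "open ?U" by (intro continuous_open_preimage) auto
    moreover have "y \<in> ?U" using y ne eH(1)[OF yS] by auto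
    moreover have "?U \<subseteq> S" using eH(2)[OF a] by auto
    ultimately obtain u where "u \<in> ?U" "q u \<noteq> 0"
      using holomorphic_in_nonzero_dense[OF S q] by blast
    then show False using eH(4)[OF a, of u] eH(4)[OF yS, of u] by auto
  qed
  have "holomorphic_in (\<lambda>x. H x x) S"
  proof (rule holomorphic_in_local)
    fix a assume a: "a \<in> S"
    have "holomorphic_in (\<lambda>x. H x x) (ball a (e a))"
      by (rule holomorphic_in_cong[OF open_ball eq[OF a] eH(3)[OF a]])
    then show "\<exists>V. a \<in> V \<and> holomorphic_in (\<lambda>x. H x x) V" using eH(1)[OF a] by (intro exI[of _ "ball a (e a)"]) auto
  qed
  then show ?thesis using that[of "\<lambda>x. H x x"] eH by auto
qed

section \<open>The Bergman kernel, divergences and entropy\<close>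

text \<open>A crude arithmetic-geometric mean inequality; it dominates products by sums of squares
  wherever only integrability or a local bound matters.\<close>

lemma norm_mult_norm_le: "norm a * norm b \<le> (norm a)\<^sup>2 + (norm b)\<^sup>2"
  using sum_squares_bound[of "norm a" "norm b"] mult_nonneg_nonneg[OF norm_ge_zero norm_ge_zero, of a b]
  by linarith

lemma bergman_space_mult_cnj_integrable:
  assumes "open S" "f \<in> bergman_space S" "g \<in> bergman_space S"
  shows "set_integrable lebesgue S (\<lambda>z. f z * cnj (g z))"
proof -
  have hol: "holomorphic_in f S" "holomorphic_in g S"
    and int: "set_integrable lebesgue S (\<lambda>z. (cmod (f z))\<^sup>2)" "set_integrable lebesgue S (\<lambda>z. (cmod (g z))\<^sup>2)"
    using assms by (auto simp: bergman_space_def)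
  have "(\<lambda>z. indicator S z *\<^sub>R (f z * cnj (g z))) \<in> borel_measurable borel"
    using assms(1) hol
    by (intro borel_measurable_continuous_on_indicator continuous_intros holomorphic_in_continuous_on) auto
  then have m: "(\<lambda>z. indicator S z *\<^sub>R (f z * cnj (g z))) \<in> borel_measurable lebesgue"
    by (simp add: measurable_completion)
  have "set_integrable lebesgue S (\<lambda>z. (cmod (f z))\<^sup>2 + (cmod (g z))\<^sup>2)"
    using int by (rule set_integral_add)
  then have "integrable lebesgue (\<lambda>z. indicator S z *\<^sub>R ((cmod (f z))\<^sup>2 + (cmod (g z))\<^sup>2))"
    by (simp add: set_integrable_def)
  then show ?thesis unfolding set_integrable_def
  proof (rule Bochner_Integration.integrable_bound[OF _ m], intro AE_I2)
    fix z
    show "norm (indicator S z *\<^sub>R (f z * cnj (g z))) \<le> norm (indicator S z *\<^sub>R ((cmod (f z))\<^sup>2 + (cmod (g z))\<^sup>2))"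
      using norm_mult_norm_le[of "f z" "g z"] by (auto simp: indicator_def norm_mult)
  qed
qed

lemma bounded_holomorphic_in_bergman_space:
  assumes S: "open S" "bounded S" and f: "holomorphic_in f S" "\<And>z. z \<in> S \<Longrightarrow> cmod (f z) \<le> C"
  shows "f \<in> bergman_space S"
proof -
  have "(\<lambda>z. indicator S z *\<^sub>R ((cmod (f z))\<^sup>2)) \<in> borel_measurable borel"
    using S f by (intro borel_measurable_continuous_on_indicator continuous_intros holomorphic_in_continuous_on) auto
  then have m: "(\<lambda>z. indicator S z *\<^sub>R ((cmod (f z))\<^sup>2)) \<in> borel_measurable lebesgue"
    by (simp add: measurable_completion)
  have "S \<in> lmeasurable" using S by (simp add: lmeasurable_open)
  then have "integrable lebesgue (indicat_real S)" by (simp only: lmeasurable_iff_integrable)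
  then have "integrable lebesgue (\<lambda>z. indicator S z *\<^sub>R (C\<^sup>2))" by simp
  then have "set_integrable lebesgue S (\<lambda>z. (cmod (f z))\<^sup>2)" unfolding set_integrable_def
    by (rule Bochner_Integration.integrable_bound[OF _ m], intro AE_I2)
      (use f(2) in \<open>auto simp: indicator_def intro!: power_mono\<close>)
  then show ?thesis using f by (simp add: bergman_space_def)
qed

section \<open>The kernel of a bounded domain and its statistical model\<close>

locale bergman =
  fixes \<Omega> :: "(complex ^ 'n) set" and B
  assumes domain: "domain \<Omega>" and bounded: "bounded \<Omega>" and kernel: "bergman_kernel \<Omega> B"
begin

lemma open_\<Omega>: "open \<Omega>" and connected_\<Omega>: "connected \<Omega>" and \<Omega>_nonempty: "\<Omega> \<noteq> {}"
  using domain by (auto simp: domain_def)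

lemma \<Omega>_sets [measurable]: "\<Omega> \<in> sets borel" "\<Omega> \<in> sets lebesgue"
  using open_\<Omega> by auto

lemma kernel_in_space: "w \<in> \<Omega> \<Longrightarrow> (\<lambda>z. B z w) \<in> bergman_space \<Omega>"
  and reproducing: "w \<in> \<Omega> \<Longrightarrow> f \<in> bergman_space \<Omega> \<Longrightarrow> f w = (LINT z:\<Omega>|lebesgue. f z * cnj (B z w))"
  using kernel by (auto simp: bergman_kernel_def)

lemma kernel_holomorphic: "w \<in> \<Omega> \<Longrightarrow> holomorphic_in (\<lambda>z. B z w) \<Omega>"
  using kernel_in_space by (auto simp: bergman_space_def)

text \<open>Each of the kernels at \<open>z\<close> and at \<open>w\<close> is reproduced at the
  other point, and the two integrals are conjugate. All regularity in the second slot is derived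
  from this symmetry.\<close>

lemma kernel_hermitian:
  assumes "z \<in> \<Omega>" "w \<in> \<Omega>"
  shows "B z w = cnj (B w z)"
proof -
  have "cnj (B w z) = (LINT \<zeta>:\<Omega>|lebesgue. cnj (B \<zeta> z * cnj (B \<zeta> w)))"
    unfolding reproducing[OF assms(2) kernel_in_space[OF assms(1)]] set_lebesgue_integral_def
      Bochner_Integration.integral_cnj[symmetric] by simp
  also have "\<dots> = (LINT \<zeta>:\<Omega>|lebesgue. B \<zeta> w * cnj (B \<zeta> z))"
    by (simp add: mult.commute)
  also have "\<dots> = B z w" using reproducing[OF assms(1) kernel_in_space[OF assms(2)]] by simp
  finally show ?thesis by simp
qed

definition K :: "complex ^ 'n \<Rightarrow> real" where "K z = Re (B z z)"

lemma kernel_norm_sq: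
  assumes "z \<in> \<Omega>"
  shows "K z = (LINT \<zeta>:\<Omega>|lebesgue. (cmod (B \<zeta> z))\<^sup>2)" "B z z = of_real (K z)"
proof -
  have "B z z = (LINT \<zeta>:\<Omega>|lebesgue. of_real ((cmod (B \<zeta> z))\<^sup>2))"
    using reproducing[OF assms kernel_in_space[OF assms]] by (simp only: complex_norm_square)
  also have "\<dots> = of_real (LINT \<zeta>:\<Omega>|lebesgue. (cmod (B \<zeta> z))\<^sup>2)"
    unfolding set_lebesgue_integral_def
    by (subst integral_complex_of_real[symmetric]) (simp add: scaleR_conv_of_real)
  finally show "K z = (LINT \<zeta>:\<Omega>|lebesgue. (cmod (B \<zeta> z))\<^sup>2)" "B z z = of_real (K z)"
    by (simp_all add: K_def)
qed

lemma one_in_space: "(\<lambda>_. 1) \<in> bergman_space \<Omega>"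
  by (rule bounded_holomorphic_in_bergman_space[OF open_\<Omega> bounded holomorphic_in_const, of _ 1]) simp

lemma component_in_space: "(\<lambda>z. z $ k) \<in> bergman_space \<Omega>"
proof -
  obtain C where C: "\<And>z. z \<in> \<Omega> \<Longrightarrow> norm z \<le> C" using bounded by (auto simp: bounded_iff)
  show ?thesis
  proof (rule bounded_holomorphic_in_bergman_space[OF open_\<Omega> bounded holomorphic_in_component])
    fix z assume "z \<in> \<Omega>"
    then show "cmod (z $ k) \<le> C" using C[of z] Finite_Cartesian_Product.norm_nth_le[of z k] by linarith
  qed
qed

text \<open>If \<open>K z = 0\<close> then B(.,z) vanishes almost everywhere and reproduces every
  function as 0 at \<open>z\<close>, in particular the constant 1, which lies in the space because
  \<open>\<Omega>\<close> is bounded.\<close>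

lemma K_pos:
  assumes "z \<in> \<Omega>"
  shows "K z > 0"
proof (rule ccontr)
  have ge: "K z \<ge> 0"
    unfolding kernel_norm_sq(1)[OF assms] set_lebesgue_integral_def by (rule integral_nonneg_AE) auto
  assume "\<not> K z > 0"
  with ge have "K z = 0" by simp
  then have "(LINT \<zeta>|lebesgue. indicator \<Omega> \<zeta> *\<^sub>R (cmod (B \<zeta> z))\<^sup>2) = 0"
    using kernel_norm_sq(1)[OF assms] by (simp add: set_lebesgue_integral_def)
  moreover have "integrable lebesgue (\<lambda>\<zeta>. indicator \<Omega> \<zeta> *\<^sub>R (cmod (B \<zeta> z))\<^sup>2)"
    using kernel_in_space[OF assms] by (simp add: bergman_space_def set_integrable_def)
  ultimately have "AE \<zeta> in lebesgue. indicator \<Omega> \<zeta> *\<^sub>R (cmod (B \<zeta> z))\<^sup>2 = 0"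
    by (subst (asm) integral_nonneg_eq_0_iff_AE) auto
  then have ae: "AE \<zeta> in lebesgue. indicator \<Omega> \<zeta> *\<^sub>R (1 * cnj (B \<zeta> z)) = 0"
    by eventually_elim auto
  have "1 = (LINT \<zeta>:\<Omega>|lebesgue. 1 * cnj (B \<zeta> z))"
    using reproducing[OF assms one_in_space] by simp
  also have "\<dots> = 0"
    unfolding set_lebesgue_integral_def using ae by (rule integral_eq_zero_AE)
  finally show False by simp
qed

lemma kernel_continuous_right:
  assumes "z \<in> \<Omega>"
  shows "continuous_on \<Omega> (B z)"
proof (rule continuous_on_eq)
  show "continuous_on \<Omega> (\<lambda>\<xi>. cnj (B \<xi> z))"
    using holomorphic_in_continuous_on[OF kernel_holomorphic[OF assms]] by (intro continuous_intros)
  fix \<xi> assume "\<xi> \<in> \<Omega>"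
  from kernel_hermitian[OF assms this] show "cnj (B \<xi> z) = B z \<xi>" by simp
qed

lemma bergman_P_eq:
  assumes "z \<in> \<Omega>" "\<xi> \<in> \<Omega>"
  shows "bergman_P B z \<xi> = (cmod (B \<xi> z))\<^sup>2 / K z"
  using kernel_hermitian[OF assms] by (simp add: bergman_P_def K_def)

lemma bergman_P_measurable:
  assumes "z \<in> \<Omega>"
  shows "bergman_P B z \<in> borel_measurable (lebesgue_on \<Omega>)"
proof -
  have "continuous_on \<Omega> (bergman_P B z)"
    unfolding bergman_P_def[abs_def] using kernel_continuous_right[OF assms]
      K_pos[OF assms] by (intro continuous_intros) (auto simp: K_def)
  then show ?thesis by (rule continuous_imp_measurable_on_sets_lebesgue) auto
qed

lemma bergman_P_nonneg: "z \<in> \<Omega> \<Longrightarrow> bergman_P B z \<xi> \<ge> 0"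
  using K_pos by (simp add: bergman_P_def K_def less_imp_le)

lemma model_integral:
  fixes f :: "complex ^ 'n \<Rightarrow> 'b::{banach, second_countable_topology}"
  assumes "z \<in> \<Omega>" "f \<in> borel_measurable (lebesgue_on \<Omega>)"
  shows "integral\<^sup>L (bergman_model \<Omega> B z) f = (LINT \<xi>:\<Omega>|lebesgue. bergman_P B z \<xi> *\<^sub>R f \<xi>)"
    and "integrable (bergman_model \<Omega> B z) f \<longleftrightarrow> set_integrable lebesgue \<Omega> (\<lambda>\<xi>. bergman_P B z \<xi> *\<^sub>R f \<xi>)"
proof -
  show "integral\<^sup>L (bergman_model \<Omega> B z) f = (LINT \<xi>:\<Omega>|lebesgue. bergman_P B z \<xi> *\<^sub>R f \<xi>)"
    unfolding bergman_model_def set_lebesgue_integral_def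
    using assms bergman_P_measurable[OF assms(1)] bergman_P_nonneg[OF assms(1)]
    by (subst integral_density) (auto simp: integral_restrict_space)
  show "integrable (bergman_model \<Omega> B z) f \<longleftrightarrow> set_integrable lebesgue \<Omega> (\<lambda>\<xi>. bergman_P B z \<xi> *\<^sub>R f \<xi>)"
    unfolding bergman_model_def set_integrable_def
    using assms bergman_P_measurable[OF assms(1)] bergman_P_nonneg[OF assms(1)]
    by (subst integrable_density) (auto simp: integrable_restrict_space)
qed

lemma model_integral_one:
  assumes "z \<in> \<Omega>"
  shows "set_integrable lebesgue \<Omega> (bergman_P B z)" "(LINT \<xi>:\<Omega>|lebesgue. bergman_P B z \<xi>) = 1"
proof -
  have i: "set_integrable lebesgue \<Omega> (\<lambda>\<xi>. (cmod (B \<xi> z))\<^sup>2)"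
    using kernel_in_space[OF assms] by (simp add: bergman_space_def)
  then have "set_integrable lebesgue \<Omega> (\<lambda>\<xi>. (cmod (B \<xi> z))\<^sup>2 / K z)" by simp
  then show "set_integrable lebesgue \<Omega> (bergman_P B z)"
    by (rule set_integrable_cong[THEN iffD1, rotated -1]) (auto simp: bergman_P_eq assms)
  have "(LINT \<xi>:\<Omega>|lebesgue. bergman_P B z \<xi>) = (LINT \<xi>:\<Omega>|lebesgue. (cmod (B \<xi> z))\<^sup>2 / K z)"
    by (rule set_lebesgue_integral_cong) (auto simp: bergman_P_eq assms)
  also have "\<dots> = 1" using kernel_norm_sq(1)[OF assms] K_pos[OF assms] by simp
  finally show "(LINT \<xi>:\<Omega>|lebesgue. bergman_P B z \<xi>) = 1" .
qed

lemma finite_model: "z \<in> \<Omega> \<Longrightarrow> finite_measure (bergman_model \<Omega> B z)"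
  using model_integral(2)[of z "\<lambda>_. 1::real"] model_integral_one(1)
  by (intro finite_measureI) (auto simp: integrable_iff_bounded top.not_eq_extremum)

text \<open>The reproducing property evaluates the mean of \<open>Re L\<close>, since \<open>B(\<cdot>,z) L\<close> lies in the
  Bergman space.\<close>

lemma mean_holomorphic:
  assumes z: "z \<in> \<Omega>" and L: "(\<lambda>\<xi>. B \<xi> z * L \<xi>) \<in> bergman_space \<Omega>"
    and u: "\<forall>\<xi>\<in>\<Omega>. u \<xi> = a * Re (L \<xi>) + c"
  shows "set_integrable lebesgue \<Omega> (\<lambda>\<xi>. bergman_P B z \<xi> * u \<xi>)"
    and "(LINT \<xi>:\<Omega>|lebesgue. bergman_P B z \<xi> * u \<xi>) = a * Re (L z) + c"
proof -
  let ?f = "\<lambda>\<xi>. B \<xi> z * L \<xi> * cnj (B \<xi> z)"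
  have i: "set_integrable lebesgue \<Omega> ?f"
    by (rule bergman_space_mult_cnj_integrable[OF open_\<Omega> L kernel_in_space[OF z]])
  have Re: "set_integrable lebesgue \<Omega> (\<lambda>\<xi>. Re (?f \<xi>))" 
    "(LINT \<xi>:\<Omega>|lebesgue. Re (?f \<xi>)) = Re (LINT \<xi>:\<Omega>|lebesgue. ?f \<xi>)"
    using integrable_Re[OF i[unfolded set_integrable_def]] integral_Re[OF i[unfolded set_integrable_def]]
    by (simp_all add: set_integrable_def set_lebesgue_integral_def)
  have val: "(LINT \<xi>:\<Omega>|lebesgue. ?f \<xi>) = of_real (K z) * L z"
    using reproducing[OF z L] kernel_norm_sq(2)[OF z] by simp
  have eq: "bergman_P B z \<xi> * u \<xi> = (a / K z) * Re (?f \<xi>) + c * bergman_P B z \<xi>" if "\<xi> \<in> \<Omega>" for \<xi>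
  proof -
    have "?f \<xi> = of_real ((cmod (B \<xi> z))\<^sup>2) * L \<xi>"
      by (simp only: complex_norm_square) (simp add: mult_ac)
    moreover have "Re (of_real x * y) = x * Re y" for x y by simp
    ultimately have "Re (?f \<xi>) = (cmod (B \<xi> z))\<^sup>2 * Re (L \<xi>)" by metis
    then show ?thesis using u that by (simp add: bergman_P_eq[OF z that] algebra_simps add_divide_distrib)
  qed
  note P = model_integral_one[OF z]
  have i2: "set_integrable lebesgue \<Omega> (\<lambda>\<xi>. (a / K z) * Re (?f \<xi>) + c * bergman_P B z \<xi>)"
    using Re(1) P(1) by (intro set_integral_add set_integrable_mult_right) auto
  then show "set_integrable lebesgue \<Omega> (\<lambda>\<xi>. bergman_P B z \<xi> * u \<xi>)"
    by (rule set_integrable_cong[THEN iffD1, rotated -1]) (auto simp: eq)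
  have "(LINT \<xi>:\<Omega>|lebesgue. bergman_P B z \<xi> * u \<xi>) = (LINT \<xi>:\<Omega>|lebesgue. (a / K z) * Re (?f \<xi>) + c * bergman_P B z \<xi>)"
    by (rule set_lebesgue_integral_cong) (auto simp: eq)
  also have "\<dots> = (a / K z) * Re (of_real (K z) * L z) + c"
    using Re P by (subst set_integral_add) (auto intro: set_integrable_mult_right simp: val)
  finally show "(LINT \<xi>:\<Omega>|lebesgue. bergman_P B z \<xi> * u \<xi>) = a * Re (L z) + c"
    using K_pos[OF z] by simp
qed

text \<open>The logarithm of the density is \<open>2 * Re (L \<xi>) - ln (K z)\<close>, and
  \<open>Re (L z) = ln (K z)\<close>, so its mean is twice \<open>ln (K z)\<close> minus
  once.\<close>

lemma entropy:
  assumes z: "z \<in> \<Omega>" and L: "log_branch \<Omega> (\<lambda>\<xi>. B \<xi> z) L" "(\<lambda>\<xi>. B \<xi> z * L \<xi>) \<in> bergman_space \<Omega>"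
  shows "set_integrable lebesgue \<Omega> (\<lambda>\<xi>. bergman_P B z \<xi> * ln (bergman_P B z \<xi>))"
    and "bergman_entropy \<Omega> B z = - ln (Re (B z z))"
proof -
  have eL: "\<And>\<xi>. \<xi> \<in> \<Omega> \<Longrightarrow> B \<xi> z = exp (L \<xi>)" using L by (auto simp: log_branch_def)
  have "\<forall>\<xi>\<in>\<Omega>. ln (bergman_P B z \<xi>) = 2 * Re (L \<xi>) + (- ln (K z))"
    using K_pos[OF z] by (simp add: bergman_P_eq[OF z] eL ln_div ln_realpow)
  note M = mean_holomorphic[OF z L(2) this]
  then show "set_integrable lebesgue \<Omega> (\<lambda>\<xi>. bergman_P B z \<xi> * ln (bergman_P B z \<xi>))" by blast
  have "K z = exp (Re (L z))"
    using kernel_norm_sq(2)[OF z] eL[OF z] K_pos[OF z]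
    by (metis abs_of_pos norm_exp_eq_Re norm_of_real)
  then show "bergman_entropy \<Omega> B z = - ln (Re (B z z))"
    using M(2) by (simp add: bergman_entropy_def K_def[symmetric])
qed

text \<open>A Kullback-Leibler integral. Up to the constant \<open>ln (K w / K z)\<close> the
  log-ratio is \<open>2 * Re (L \<xi>)\<close>; evaluation at \<open>z\<close>, where
  \<open>exp (Re (L z)) = K z / cmod (B z w)\<close>, assembles the diastasis.\<close>

lemma log_ratio_mean:
  assumes zw: "z \<in> \<Omega>" "w \<in> \<Omega>"
    and L: "log_branch \<Omega> (\<lambda>\<xi>. B \<xi> z / B \<xi> w) L" "(\<lambda>\<xi>. B \<xi> z * L \<xi>) \<in> bergman_space \<Omega>"
  shows "\<And>\<xi>. \<xi> \<in> \<Omega> \<Longrightarrow> bergman_P B z \<xi> > 0 \<and> bergman_P B w \<xi> > 0"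
    and "set_integrable lebesgue \<Omega> (\<lambda>\<xi>. bergman_P B z \<xi> * ln (bergman_P B z \<xi> / bergman_P B w \<xi>))"
    and "(LINT \<xi>:\<Omega>|lebesgue. bergman_P B z \<xi> * ln (bergman_P B z \<xi> / bergman_P B w \<xi>)) = diastasis B z w"
proof -
  have eL: "exp (L \<xi>) = B \<xi> z / B \<xi> w" if "\<xi> \<in> \<Omega>" for \<xi> using L that by (auto simp: log_branch_def)
  \<comment> \<open>Division by zero yields 0, whereas an exponential never vanishes, so numerator
    and denominator are both nonzero.\<close>
  have nz: "B \<xi> z \<noteq> 0 \<and> B \<xi> w \<noteq> 0" if "\<xi> \<in> \<Omega>" for \<xi> using eL[OF that] by (metis div_by_0 divide_eq_0_iff exp_not_eq_zero)
  have Kp: "K z > 0" "K w > 0" using K_pos zw by auto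
  show "\<And>\<xi>. \<xi> \<in> \<Omega> \<Longrightarrow> bergman_P B z \<xi> > 0 \<and> bergman_P B w \<xi> > 0"
    using nz Kp by (simp add: bergman_P_eq zw)
  have "\<forall>\<xi>\<in>\<Omega>. ln (bergman_P B z \<xi> / bergman_P B w \<xi>) = 2 * Re (L \<xi>) + ln (K w / K z)"
  proof
    fix \<xi> assume that: "\<xi> \<in> \<Omega>"
    have "cmod (B \<xi> z) / cmod (B \<xi> w) = exp (Re (L \<xi>))" 
      using arg_cong[OF eL[OF that], of cmod] by (simp add: norm_divide)
    then have "bergman_P B z \<xi> / bergman_P B w \<xi> = (exp (Re (L \<xi>)))\<^sup>2 * (K w / K z)"
      using Kp nz[OF that] by (simp add: bergman_P_eq zw that power_divide field_simps flip: power_mult_distrib)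
    also have "\<dots> = exp (2 * Re (L \<xi>) + ln (K w / K z))"
      using Kp by (simp add: exp_add exp_double)
    finally show "ln (bergman_P B z \<xi> / bergman_P B w \<xi>) = 2 * Re (L \<xi>) + ln (K w / K z)"
      by (simp only: ln_exp)
  qed
  note M = mean_holomorphic[OF zw(1) L(2) this]
  then show "set_integrable lebesgue \<Omega> (\<lambda>\<xi>. bergman_P B z \<xi> * ln (bergman_P B z \<xi> / bergman_P B w \<xi>))" by blast
  have "exp (Re (L z)) = K z / cmod (B z w)"
    using arg_cong[OF eL[OF zw(1)], of cmod] kernel_norm_sq(2)[OF zw(1)] Kp by (simp add: norm_divide)
  then have "Re (L z) = ln (K z / cmod (B z w))" by (metis ln_exp)
  then have "2 * Re (L z) + ln (K w / K z) = diastasis B z w"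
    using Kp nz[OF zw(1)] by (simp add: diastasis_def K_def[symmetric] ln_div ln_mult ln_realpow)
  then show "(LINT \<xi>:\<Omega>|lebesgue. bergman_P B z \<xi> * ln (bergman_P B z \<xi> / bergman_P B w \<xi>)) = diastasis B z w"
    using M(2) by simp
qed

text \<open>Both models have densities over the same measure and the one at \<open>z\<close> is
  positive on all of \<open>\<Omega>\<close>, so the quotient of densities is a derivative;
  finiteness of the first model makes it the derivative almost everywhere.\<close>

lemma RN_deriv_model:
  assumes zw: "z \<in> \<Omega>" "w \<in> \<Omega>"
    and pos: "\<forall>\<xi>\<in>\<Omega>. bergman_P B z \<xi> > 0"
  shows "AE \<xi> in bergman_model \<Omega> B z.
    enn2real (RN_deriv (bergman_model \<Omega> B z) (bergman_model \<Omega> B w) \<xi>) = bergman_P B w \<xi> / bergman_P B z \<xi>"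
proof -
  interpret finite_measure "bergman_model \<Omega> B z" by (rule finite_model[OF zw(1)])
  note [measurable] = bergman_P_measurable[OF zw(1)] bergman_P_measurable[OF zw(2)]
  have "density (bergman_model \<Omega> B z) (\<lambda>\<xi>. ennreal (bergman_P B w \<xi> / bergman_P B z \<xi>)) = bergman_model \<Omega> B w"
    unfolding bergman_model_def
  proof (subst density_density_eq)
    show "density (lebesgue_on \<Omega>) (\<lambda>\<xi>. ennreal (bergman_P B z \<xi>) * ennreal (bergman_P B w \<xi> / bergman_P B z \<xi>)) =
      density (lebesgue_on \<Omega>) (\<lambda>\<xi>. ennreal (bergman_P B w \<xi>))"
    proof (rule density_cong)
      show "AE \<xi> in lebesgue_on \<Omega>. ennreal (bergman_P B z \<xi>) * ennreal (bergman_P B w \<xi> / bergman_P B z \<xi>) = ennreal (bergman_P B w \<xi>)"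
        using pos bergman_P_nonneg[OF zw(1)] bergman_P_nonneg[OF zw(2)]
        by (intro AE_I2) (auto simp: less_le simp flip: ennreal_mult)
    qed measurable
  qed measurable
  from RN_deriv_unique[OF _ this]
  have "AE \<xi> in bergman_model \<Omega> B z. ennreal (bergman_P B w \<xi> / bergman_P B z \<xi>) =
     RN_deriv (bergman_model \<Omega> B z) (bergman_model \<Omega> B w) \<xi>"
    by (simp add: bergman_model_def)
  then show ?thesis
    by eventually_elim (metis bergman_P_nonneg divide_nonneg_nonneg enn2real_ennreal zw)
qed

lemma chi_divergence_model:
  assumes zw: "z \<in> \<Omega>" "w \<in> \<Omega>"
    and pos: "\<forall>\<xi>\<in>\<Omega>. bergman_P B z \<xi> > 0" and h [measurable]: "h \<in> borel_measurable borel"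
    and g: "\<forall>\<xi>\<in>\<Omega>. bergman_P B z \<xi> * h (bergman_P B w \<xi> / bergman_P B z \<xi>) = g \<xi>"
    and int: "set_integrable lebesgue \<Omega> g"
  shows "chi_divergence_finite h (bergman_model \<Omega> B z) (bergman_model \<Omega> B w)"
    and "chi_divergence h (bergman_model \<Omega> B z) (bergman_model \<Omega> B w) = (LINT \<xi>:\<Omega>|lebesgue. g \<xi>)"
proof -
  let ?M = "bergman_model \<Omega> B z" and ?N = "bergman_model \<Omega> B w"
  let ?h = "\<lambda>\<xi>. h (bergman_P B w \<xi> / bergman_P B z \<xi>)"
  note [measurable] = bergman_P_measurable[OF zw(1)] bergman_P_measurable[OF zw(2)]
  have m: "?h \<in> borel_measurable (lebesgue_on \<Omega>)" by measurable
  then have m': "?h \<in> borel_measurable ?M" by (simp add: bergman_model_def)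
  have ae: "AE \<xi> in ?M. h (enn2real (RN_deriv ?M ?N \<xi>)) = ?h \<xi>"
    using RN_deriv_model[OF zw pos] by eventually_elim simp
  have "set_integrable lebesgue \<Omega> (\<lambda>\<xi>. bergman_P B z \<xi> *\<^sub>R ?h \<xi>)"
    using int by (rule set_integrable_cong[THEN iffD1, rotated -1]) (auto simp: g)
  then have "integrable ?M ?h" using model_integral(2)[OF zw(1) m] by simp
  then show "chi_divergence_finite h ?M ?N"
    unfolding chi_divergence_finite_def
    by (rule integrable_cong_AE[THEN iffD1, rotated -1]) (use ae m' in \<open>auto elim: eventually_mono\<close>)
  have "chi_divergence h ?M ?N = integral\<^sup>L ?M ?h"
    unfolding chi_divergence_def by (rule integral_cong_AE) (use ae m' in auto)
  also have "\<dots> = (LINT \<xi>:\<Omega>|lebesgue. bergman_P B z \<xi> *\<^sub>R ?h \<xi>)"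
    by (rule model_integral(1)[OF zw(1) m])
  also have "\<dots> = (LINT \<xi>:\<Omega>|lebesgue. g \<xi>)"
    by (rule set_lebesgue_integral_cong) (auto simp: g)
  finally show "chi_divergence h ?M ?N = (LINT \<xi>:\<Omega>|lebesgue. g \<xi>)" .
qed

lemma diastasis_sym: "z \<in> \<Omega> \<Longrightarrow> w \<in> \<Omega> \<Longrightarrow> diastasis B z w = diastasis B w z"
  using kernel_hermitian[of z w] by (simp add: diastasis_def mult.commute)

text \<open>\<open>chi_plus\<close> moves the weight from the density at \<open>z\<close> to the one
  at \<open>w\<close> and so yields the log-ratio mean with the points exchanged, while
  \<open>chi_minus\<close> yields it in the given order. Branches for both orders are used, and the
  diastasis is symmetric.\<close>

lemma divergences:
  assumes L: "\<And>z w. z \<in> \<Omega> \<Longrightarrow> w \<in> \<Omega> \<Longrightarrow> \<exists>L. log_branch \<Omega> (\<lambda>\<xi>. B \<xi> z / B \<xi> w) L \<and>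
          (\<lambda>\<xi>. B \<xi> z * L \<xi>) \<in> bergman_space \<Omega>"
    and zw: "z \<in> \<Omega>" "w \<in> \<Omega>"
  shows "chi_divergence_finite chi_plus (bergman_model \<Omega> B z) (bergman_model \<Omega> B w)"
    and "chi_divergence_finite chi_minus (bergman_model \<Omega> B z) (bergman_model \<Omega> B w)"
    and "chi_divergence chi_plus (bergman_model \<Omega> B z) (bergman_model \<Omega> B w) = diastasis B z w"
    and "chi_divergence chi_minus (bergman_model \<Omega> B z) (bergman_model \<Omega> B w) = diastasis B z w"
proof -
  obtain L1 where "log_branch \<Omega> (\<lambda>\<xi>. B \<xi> z / B \<xi> w) L1" "(\<lambda>\<xi>. B \<xi> z * L1 \<xi>) \<in> bergman_space \<Omega>"
    using L[OF zw] by blast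
  note zw1 = log_ratio_mean[OF zw this]
  obtain L2 where "log_branch \<Omega> (\<lambda>\<xi>. B \<xi> w / B \<xi> z) L2" "(\<lambda>\<xi>. B \<xi> w * L2 \<xi>) \<in> bergman_space \<Omega>"
    using L[OF zw(2,1)] by blast
  note wz = log_ratio_mean[OF zw(2,1) this]
  have pos: "\<forall>\<xi>\<in>\<Omega>. bergman_P B z \<xi> > 0" and pos': "\<forall>\<xi>\<in>\<Omega>. bergman_P B w \<xi> > 0"
    using zw1(1) by blast+
  have m: "chi_plus \<in> borel_measurable borel" "chi_minus \<in> borel_measurable borel"
    unfolding chi_plus_def[abs_def] chi_minus_def[abs_def] by measurable
  have "\<forall>\<xi>\<in>\<Omega>. bergman_P B z \<xi> * chi_plus (bergman_P B w \<xi> / bergman_P B z \<xi>) =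
      bergman_P B w \<xi> * ln (bergman_P B w \<xi> / bergman_P B z \<xi>)"
    using pos by (auto simp: chi_plus_def)
  note plus = chi_divergence_model[OF zw pos m(1) this wz(2)]
  have "\<forall>\<xi>\<in>\<Omega>. bergman_P B z \<xi> * chi_minus (bergman_P B w \<xi> / bergman_P B z \<xi>) =
      bergman_P B z \<xi> * ln (bergman_P B z \<xi> / bergman_P B w \<xi>)"
    using pos pos' by (auto simp: chi_minus_def ln_div algebra_simps)
  note minus = chi_divergence_model[OF zw pos m(2) this zw1(2)]
  show "chi_divergence_finite chi_plus (bergman_model \<Omega> B z) (bergman_model \<Omega> B w)"
    "chi_divergence_finite chi_minus (bergman_model \<Omega> B z) (bergman_model \<Omega> B w)"
    using plus(1) minus(1) by auto
  show "chi_divergence chi_plus (bergman_model \<Omega> B z) (bergman_model \<Omega> B w) = diastasis B z w"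
    using plus(2) wz(3) diastasis_sym[OF zw] by simp
  show "chi_divergence chi_minus (bergman_model \<Omega> B z) (bergman_model \<Omega> B w) = diastasis B z w"
    using minus(2) zw1(3) by simp
qed

end

section \<open>Joint regularity of the kernel\<close>

text \<open>A pair of vectors is encoded over a sum index type, so that the results on holomorphic
  functions of one vector apply verbatim to functions of both variables.\<close>

definition vjoin :: "complex ^ 'n \<Rightarrow> complex ^ 'n \<Rightarrow> complex ^ ('n + 'n)" where
  "vjoin z w = (\<chi> s. case s of Inl k \<Rightarrow> z $ k | Inr k \<Rightarrow> w $ k)"

definition vfst :: "complex ^ ('n + 'n) \<Rightarrow> complex ^ 'n" where "vfst u = (\<chi> k. u $ Inl k)"

definition vsnd :: "complex ^ ('n + 'n) \<Rightarrow> complex ^ 'n" where "vsnd u = (\<chi> k. u $ Inr k)"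

definition vcnj :: "complex ^ 'n \<Rightarrow> complex ^ 'n" where "vcnj z = (\<chi> k. cnj (z $ k))"

lemma vjoin_simps [simp]:
  "vfst (vjoin z w) = z" "vsnd (vjoin z w) = w" "vjoin (vfst u) (vsnd u) = u"
  by (auto simp: vjoin_def vfst_def vsnd_def vec_eq_iff split: sum.split)

lemma vjoin_arith:
  "vjoin z w + vjoin z' w' = vjoin (z + z') (w + w')"
  "vjoin z w - vjoin z' w' = vjoin (z - z') (w - w')"
  "c *s vjoin z w = vjoin (c *s z) (c *s w)"
  "t *\<^sub>R vjoin z w = vjoin (t *\<^sub>R z) (t *\<^sub>R w)"
  by (auto simp: vjoin_def vec_eq_iff split: sum.split)

lemma vcnj_vcnj [simp]: "vcnj (vcnj z) = z"
  by (simp add: vcnj_def vec_eq_iff)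

lemma vcnj_arith:
  "vcnj (z + w) = vcnj z + vcnj w" "vcnj (c *s z) = cnj c *s vcnj z" "vcnj (t *\<^sub>R z) = t *\<^sub>R vcnj z"
  "vcnj 0 = 0"
  by (auto simp: vcnj_def vec_eq_iff)

lemma vfst_scalar_mult: "vfst (c *s u) = c *s vfst u" and vsnd_scalar_mult: "vsnd (c *s u) = c *s vsnd u"
  by (auto simp: vfst_def vsnd_def vec_eq_iff)

lemma bounded_linear_vfst: "bounded_linear vfst"
  by (rule linear_conv_bounded_linear[THEN iffD1], rule linearI) (auto simp: vfst_def vec_eq_iff)

lemma bounded_linear_vsnd: "bounded_linear vsnd"
  by (rule linear_conv_bounded_linear[THEN iffD1], rule linearI) (auto simp: vsnd_def vec_eq_iff)

lemma bounded_linear_vcnj: "bounded_linear vcnj"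
  by (rule linear_conv_bounded_linear[THEN iffD1], rule linearI) (auto simp: vcnj_def vec_eq_iff)

lemma bounded_linear_vjoin_left: "bounded_linear (\<lambda>z. vjoin z 0)"
  by (rule linear_conv_bounded_linear[THEN iffD1], rule linearI) (auto simp: vjoin_arith)

lemma bounded_linear_vjoin_cnj: "bounded_linear (\<lambda>z. vjoin z (vcnj z))"
  by (rule linear_conv_bounded_linear[THEN iffD1], rule linearI) (auto simp: vjoin_arith vcnj_arith)

text \<open>The Cauchy estimate. The parameter circle has radius \<open>r / norm v\<close>, so that
  \<open>t *s v\<close> stays within distance \<open>r\<close>.\<close>

lemma rpart_bound:
  fixes f :: "complex ^ 'm \<Rightarrow> complex"
  assumes f: "holomorphic_in f S" and r: "r > 0" "cball z r \<subseteq> S"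
    and M: "\<And>w. w \<in> cball z r \<Longrightarrow> cmod (f w) \<le> M"
  shows "cmod (rpart v f z) \<le> M / r * norm v"
proof (cases "v = 0")
  case True
  have "z \<in> S" using r by auto
  then show ?thesis using True rpart_scalar_mult[OF f, of z 0 v] by simp
next
  case False
  define \<rho> where "\<rho> = r / norm v"
  have \<rho>: "\<rho> > 0" using r False by (simp add: \<rho>_def)
  have in_cball: "z + t *s v \<in> cball z r" if "cmod t \<le> \<rho>" for t
  proof -
    have "cmod t * norm v \<le> \<rho> * norm v" using that by (intro mult_right_mono) auto
    then show ?thesis using False by (simp add: \<rho>_def dist_norm norm_scalar_mult)
  qed
  then have I: "((\<lambda>x. f (z + (of_real \<rho> * unit_circle x) *s v) / (of_real \<rho> * unit_circle x)) has_integral rpart v f z) {0..1}"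
    using r(2) by (intro circle_mean(2)[OF f \<rho>]) blast
  have "norm (rpart v f z) \<le> M / \<rho> * measure lborel (cbox 0 (1::real))"
  proof (rule has_integral_bound)
    have "0 \<le> cmod (f z)" by simp
    also have "\<dots> \<le> M" using M r by simp
    finally show "0 \<le> M / \<rho>" using \<rho> by simp
    show "norm (f (z + (of_real \<rho> * unit_circle x) *s v) / (of_real \<rho> * unit_circle x)) \<le> M / \<rho>" for x
      using M[OF in_cball, of "of_real \<rho> * unit_circle x"] \<rho>
      by (simp add: norm_divide norm_mult divide_right_mono)
  qed (use I in simp)
  then show ?thesis using False by (simp add: \<rho>_def)
qed

context bergman
begin

lemma kernel_norm_le:
  assumes "z \<in> \<Omega>" "w \<in> \<Omega>"
  shows "cmod (B z w) \<le> K z + K w"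
proof -
  have i: "set_integrable lebesgue \<Omega> (\<lambda>\<zeta>. (cmod (B \<zeta> z))\<^sup>2)" "set_integrable lebesgue \<Omega> (\<lambda>\<zeta>. (cmod (B \<zeta> w))\<^sup>2)"
    using kernel_in_space assms by (auto simp: bergman_space_def)
  have "cmod (B z w) \<le> (LINT \<zeta>|lebesgue. norm (indicator \<Omega> \<zeta> *\<^sub>R (B \<zeta> w * cnj (B \<zeta> z))))"
    using reproducing[OF assms(1) kernel_in_space[OF assms(2)]]
    unfolding set_lebesgue_integral_def by (metis integral_norm_bound)
  also have "\<dots> \<le> (LINT \<zeta>:\<Omega>|lebesgue. (cmod (B \<zeta> z))\<^sup>2 + (cmod (B \<zeta> w))\<^sup>2)"
    unfolding set_lebesgue_integral_def
  proof (rule integral_mono')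
    show "integrable lebesgue (\<lambda>\<zeta>. indicator \<Omega> \<zeta> *\<^sub>R ((cmod (B \<zeta> z))\<^sup>2 + (cmod (B \<zeta> w))\<^sup>2))"
      using set_integral_add(1)[OF i] by (simp add: set_integrable_def)
    fix \<zeta>
    show "norm (indicator \<Omega> \<zeta> *\<^sub>R (B \<zeta> w * cnj (B \<zeta> z))) \<le> indicator \<Omega> \<zeta> *\<^sub>R ((cmod (B \<zeta> z))\<^sup>2 + (cmod (B \<zeta> w))\<^sup>2)"
      using norm_mult_norm_le[of "B \<zeta> w" "B \<zeta> z"] by (auto simp: indicator_def norm_mult)
  qed (auto simp: indicator_def)
  also have "\<dots> = K z + K w"
    using set_integral_add(2)[OF i] kernel_norm_sq(1) assms by simp
  finally show ?thesis .
qed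

text \<open>The point bound for B(.,w) at its own base point reads
  \<open>K w * (K w * V) \<le> K w\<close>, so \<open>K w \<le> 1 / V\<close>, where the volume
  \<open>V\<close> depends on the radius alone.\<close>

lemma K_locally_bounded:
  assumes "z \<in> \<Omega>"
  obtains r M where "r > 0" "M > 0" "cball z r \<subseteq> \<Omega>" "\<And>w. w \<in> cball z r \<Longrightarrow> K w \<le> M"
proof -
  obtain e where e: "e > 0" "ball z e \<subseteq> \<Omega>" using open_\<Omega> assms openE by blast
  define r where "r = e / 3"
  have r: "r > 0" using e by (simp add: r_def)
  have sub: "cball w r \<subseteq> \<Omega>" if "w \<in> cball z r" for w
  proof
    fix x assume "x \<in> cball w r"
    then have "dist z x < e" using that e(1) dist_triangle[of z x w] by (simp add: r_def)
    then show "x \<in> \<Omega>" using e by auto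
  qed
  define V where "V = measure lborel (cball (0::complex ^ 'n) r)"
  have V: "V > 0" using content_cball_pos[OF r, of "0::complex ^ 'n"] by (simp add: V_def)
  have "K w \<le> 1 / V" if w: "w \<in> cball z r" for w
  proof -
    have w\<Omega>: "w \<in> \<Omega>" using sub[OF w] r by auto
    have "(cmod (B w w))\<^sup>2 * V \<le> K w"
      using bergman_space_point_bound[OF kernel_in_space[OF w\<Omega>] open_\<Omega> r sub[OF w]] kernel_norm_sq(1)[OF w\<Omega>]
      by (simp add: V_def)
    then have "K w * (K w * V) \<le> K w * 1"
      using kernel_norm_sq(2)[OF w\<Omega>] by (simp add: power2_eq_square mult.assoc)
    then show ?thesis using K_pos[OF w\<Omega>] V by (simp add: field_simps)
  qed
  then show ?thesis using that[of r "1 / V"] r V sub[of z] by auto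
qed

text \<open>Separate continuity becomes joint because the Lipschitz constant in the first slot is
  uniform in the second: \<open>kernel_norm_le\<close> and the local bound on \<open>K\<close>
  control the kernel near the point, and the Cauchy estimate controls its derivative.\<close>

lemma kernel_continuous: "continuous_on (\<Omega> \<times> \<Omega>) (\<lambda>(z, w). B z w)"
proof -
  have "((\<lambda>(z, w). B z w) \<longlongrightarrow> B a b) (at (a, b) within \<Omega> \<times> \<Omega>)" if ab: "a \<in> \<Omega>" "b \<in> \<Omega>" for a b
  proof -
    obtain r M where r: "r > 0" "M > 0" "cball a r \<subseteq> \<Omega>" "\<And>w. w \<in> cball a r \<Longrightarrow> K w \<le> M"
      using K_locally_bounded[OF ab(1)] by metis
    obtain s N where s: "s > 0" "N > 0" "cball b s \<subseteq> \<Omega>" "\<And>w. w \<in> cball b s \<Longrightarrow> K w \<le> N"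
      using K_locally_bounded[OF ab(2)] by metis
    define C where "C = (M + N) / (r / 2)"
    have lip: "cmod (B z w - B a w) \<le> C * norm (z - a)" if z: "z \<in> ball a (r / 2)" and w: "w \<in> cball b s" for z w
    proof (rule differentiable_bound[where S="ball a (r / 2)" and f'="\<lambda>x v. rpart v (\<lambda>z. B z w) x"])
      fix x assume x: "x \<in> ball a (r / 2)"
      have wo: "w \<in> \<Omega>" using w s by auto
      have sub: "cball x (r / 2) \<subseteq> cball a r"
      proof
        fix y assume "y \<in> cball x (r / 2)"
        then show "y \<in> cball a r" using x dist_triangle[of a y x] by simp
      qed
      have "x \<in> \<Omega>" using x r by (auto simp: subset_iff)
      then show "((\<lambda>z. B z w) has_derivative (\<lambda>v. rpart v (\<lambda>z. B z w) x)) (at x within ball a (r / 2))"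
        by (rule has_derivative_at_withinI[OF holomorphic_in_has_derivative[OF kernel_holomorphic[OF wo]]])
      have "cmod (B y w) \<le> M + N" if "y \<in> cball x (r / 2)" for y
      proof -
        have y: "y \<in> cball a r" using that sub by blast
        have yo: "y \<in> \<Omega>" using y r(3) by blast
        show ?thesis using kernel_norm_le[OF yo wo] r(4)[OF y] s(4)[OF w] by linarith
      qed
      then have "cmod (rpart v (\<lambda>z. B z w) x) \<le> C * norm v" for v
        unfolding C_def using r sub
        by (intro rpart_bound[OF kernel_holomorphic[OF wo]]) auto
      then show "onorm (\<lambda>v. rpart v (\<lambda>z. B z w) x) \<le> C"
        by (intro onorm_le) (simp add: mult.commute)
    qed (use r z in auto)
    have "((\<lambda>p. B a (snd p)) \<longlongrightarrow> B a (snd (a, b))) (at (a, b) within \<Omega> \<times> \<Omega>)"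
    proof -
      have "continuous_on (\<Omega> \<times> \<Omega>) (\<lambda>p. B a (snd p))"
        by (rule continuous_on_compose2[OF kernel_continuous_right[OF ab(1)]]) (auto intro!: continuous_intros)
      then show ?thesis using ab unfolding continuous_on_def by blast
    qed
    moreover have "((\<lambda>p. B (fst p) (snd p) - B a (snd p)) \<longlongrightarrow> 0) (at (a, b) within \<Omega> \<times> \<Omega>)"
    proof (rule Lim_null_comparison)
      have "eventually (\<lambda>p. p \<in> ball a (r / 2) \<times> ball b s) (at (a, b) within \<Omega> \<times> \<Omega>)"
        unfolding eventually_at_topological using r(1) s(1)
        by (intro exI[of _ "ball a (r / 2) \<times> ball b s"]) (simp add: open_Times)
      then show "eventually (\<lambda>p. norm (B (fst p) (snd p) - B a (snd p)) \<le> C * norm (fst p - a)) (at (a, b) within \<Omega> \<times> \<Omega>)"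
        by eventually_elim (use lip in auto)
      have "((\<lambda>p. C * norm (fst p - a)) \<longlongrightarrow> C * norm (fst (a, b) - a)) (at (a, b) within \<Omega> \<times> \<Omega>)"
        by (intro tendsto_intros)
      then show "((\<lambda>p. C * norm (fst p - a)) \<longlongrightarrow> 0) (at (a, b) within \<Omega> \<times> \<Omega>)" by simp
    qed
    ultimately have "((\<lambda>p. B a (snd p) + (B (fst p) (snd p) - B a (snd p))) \<longlongrightarrow> B a (snd (a, b)) + 0) (at (a, b) within \<Omega> \<times> \<Omega>)"
      by (rule tendsto_add)
    then show ?thesis by (simp add: case_prod_unfold)
  qed
  then show ?thesis unfolding continuous_on_def by auto
qed

lemma kernel_continuous_on_compose:
  assumes "continuous_on S f" "continuous_on S g" "\<And>x. x \<in> S \<Longrightarrow> f x \<in> \<Omega> \<and> g x \<in> \<Omega>"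
  shows "continuous_on S (\<lambda>x. B (f x) (g x))"
  using continuous_on_compose2[OF kernel_continuous, of S "\<lambda>x. (f x, g x)"] assms
  by (auto intro!: continuous_intros)

text \<open>The derivative is a circle mean of kernel values, and these depend continuously on both
  slots at once.\<close>

lemma kernel_rpart_continuous: "continuous_on (\<Omega> \<times> \<Omega>) (\<lambda>p. rpart v (\<lambda>z. B z (snd p)) (fst p))"
proof -
  have "isCont (\<lambda>p. rpart v (\<lambda>z. B z (snd p)) (fst p)) p"
    if p: "p \<in> \<Omega> \<times> \<Omega>" for p
  proof -
    obtain r e where re: "r > 0" "e > 0" "\<And>w t. w \<in> ball (fst p) e \<Longrightarrow> cmod t \<le> r \<Longrightarrow> w + t *s v \<in> \<Omega>"
      using circle_radius[OF open_\<Omega>, of "fst p" v] p by (metis mem_Times_iff)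
    let ?N = "ball (fst p) e \<times> \<Omega>"
    let ?f = "\<lambda>q x. B (fst q + (of_real r * unit_circle x) *s v) (snd q) / (of_real r * unit_circle x)"
    have in\<Omega>: "w + (of_real r * unit_circle x) *s v \<in> \<Omega>" if "w \<in> ball (fst p) e" for w x
      using re that by (auto simp: norm_mult)
    have "continuous_on (?N \<times> cbox 0 1) (\<lambda>y. ?f (fst y) (snd y))"
      by (intro continuous_on_divide kernel_continuous_on_compose continuous_on_add
          continuous_on_scalar_mult_left continuous_on_mult continuous_on_const
          continuous_on_compose2[OF continuous_on_unit_circle[of UNIV]] continuous_on_fst continuous_on_snd continuous_on_id)
        (use in\<Omega> re in auto)
    then have "continuous_on (?N \<times> cbox 0 1) (\<lambda>(q, x). ?f q x)" by (simp add: case_prod_unfold)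
    then have "continuous_on ?N (\<lambda>q. integral (cbox 0 1) (?f q))"
      by (rule integral_continuous_on_param)
    moreover have "integral (cbox 0 1) (?f q) = rpart v (\<lambda>z. B z (snd q)) (fst q)" if "q \<in> ?N" for q
      using integral_unique[OF circle_mean(2)[OF kernel_holomorphic[of "snd q"] re(1) re(3)[of "fst q"]]] that
      by auto
    ultimately have "continuous_on ?N (\<lambda>q. rpart v (\<lambda>z. B z (snd q)) (fst q))" by (rule continuous_on_eq)
    moreover have "open ?N" "p \<in> ?N" using re p open_\<Omega> by (auto simp: open_Times mem_Times_iff)
    ultimately show ?thesis by (simp only: continuous_on_eq_continuous_at)
  qed
  then show ?thesis by (intro continuous_at_imp_continuous_on ballI)
qed

end

text \<open>The antilinear involution behind Hermitian symmetry: it exchanges the slots of the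
  polarised kernel and fixes every diagonal point \<open>vjoin z (vcnj z)\<close>.\<close>

definition vswap :: "complex ^ ('n::finite + 'n) \<Rightarrow> complex ^ ('n + 'n)" where
  "vswap u = vjoin (vcnj (vsnd u)) (vcnj (vfst u))"

lemma vswap_simps [simp]: "vswap (vswap u) = u" "vswap (vjoin z w) = vjoin (vcnj w) (vcnj z)"
  by (simp_all add: vswap_def)

lemma vswap_arith: "vswap (u + v) = vswap u + vswap v" "vswap (t *\<^sub>R u) = t *\<^sub>R vswap u"
  by (auto simp: vswap_def vjoin_def vcnj_def vfst_def vsnd_def vec_eq_iff split: sum.split)

text \<open>\<open>vswap\<close> is real linear, so directional derivatives along real lines inherit
  a conjugation symmetry. Two functions are involved because the direction of an earlier derivative
  is itself swapped when the lemma is iterated.\<close>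

lemma rpart_vswap:
  assumes D: "(\<Phi> has_derivative D) (at u)" and U: "open U" "u \<in> U"
    and eq: "\<And>x. x \<in> U \<Longrightarrow> cnj (\<Phi> x) = \<Phi>' (vswap x)"
  shows "rpart (vswap w) \<Phi>' (vswap u) = cnj (rpart w \<Phi> u)"
proof -
  have "((\<lambda>t. \<Phi> (u + t *\<^sub>R w)) has_vector_derivative D w) (at 0)"
    by (rule has_derivative_imp_has_vector_derivative_line[OF D])
  then have "((\<lambda>t. cnj (\<Phi> (u + t *\<^sub>R w))) has_vector_derivative cnj (D w)) (at 0)"
    by (rule bounded_linear.has_vector_derivative[OF bounded_linear_cnj])
  then have "((\<lambda>t. \<Phi>' (vswap u + t *\<^sub>R vswap w)) has_vector_derivative cnj (D w)) (at 0)"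
  proof (rule has_vector_derivative_transform_within_open)
    show "open ((\<lambda>t. u + t *\<^sub>R w) -` U)" by (intro open_vimage U continuous_intros)
    show "0 \<in> (\<lambda>t. u + t *\<^sub>R w) -` U" using U by simp
    fix t assume "t \<in> (\<lambda>t. u + t *\<^sub>R w) -` U"
    then show "cnj (\<Phi> (u + t *\<^sub>R w)) = \<Phi>' (vswap u + t *\<^sub>R vswap w)"
      using eq by (simp add: vswap_arith)
  qed
  then show ?thesis unfolding rpart_def rpart_eqI[OF D, unfolded rpart_def]
    by (rule vector_derivative_at)
qed

section \<open>The kernel as a holomorphic function of 2n variables, and its logarithmic
  derivatives\<close>

context bergman
begin

text \<open>Conjugating the second variable turns the kernel into a holomorphic function \<open>G\<close> of \<open>2n\<close> variables.\<close>

definition \<Omega>2 where "\<Omega>2 = {u. vfst u \<in> \<Omega> \<and> vcnj (vsnd u) \<in> \<Omega>}"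

definition G where "G u = B (vfst u) (vcnj (vsnd u))"

lemma open_vcnj_\<Omega>: "open {w. vcnj w \<in> \<Omega>}"
  using open_vimage[OF open_\<Omega> linear_continuous_on[OF bounded_linear_vcnj]] by (simp add: vimage_def)

lemma open_\<Omega>2: "open \<Omega>2"
proof -
  have "open (vfst -` \<Omega> \<inter> vsnd -` {w. vcnj w \<in> \<Omega>})"
    by (intro open_Int open_vimage open_\<Omega> open_vcnj_\<Omega> linear_continuous_on bounded_linear_vfst bounded_linear_vsnd)
  then show ?thesis by (simp add: \<Omega>2_def vimage_def Collect_conj_eq)
qed

lemma vjoin_\<Omega>2: "z \<in> \<Omega> \<Longrightarrow> w \<in> \<Omega> \<Longrightarrow> vjoin z (vcnj w) \<in> \<Omega>2"
  by (simp add: \<Omega>2_def)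

lemma G_vjoin [simp]: "G (vjoin z (vcnj w)) = B z w"
  by (simp add: G_def)

lemma kernel_cnj_holomorphic:
  assumes "a \<in> \<Omega>"
  shows "holomorphic_in (\<lambda>w. B a (vcnj w)) {w. vcnj w \<in> \<Omega>}"
proof (rule holomorphic_in_cong[OF open_vcnj_\<Omega>])
  show "holomorphic_in (\<lambda>w. cnj (B (0 + vcnj w) a)) {w. vcnj w \<in> \<Omega>}"
    by (rule holomorphic_in_cnj_compose[OF kernel_holomorphic[OF assms] bounded_linear_vcnj])
      (auto simp: vcnj_arith)
  fix w assume "w \<in> {w. vcnj w \<in> \<Omega>}"
  then show "cnj (B (0 + vcnj w) a) = B a (vcnj w)" using kernel_hermitian[OF assms, of "vcnj w"] by simp
qed

text \<open>Partial derivatives give a total one once one of them is jointly continuous, here that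
  in the first slot of the kernel. The pair is written \<open>(w, z)\<close> because the criterion
  asks for continuity of the partial derivative in its second argument.\<close>

lemma G_has_derivative:
  assumes "u \<in> \<Omega>2"
  shows "(G has_derivative (\<lambda>v. rpart (vsnd v) (\<lambda>w. B (vfst u) (vcnj w)) (vsnd u)
    + rpart (vfst v) (\<lambda>z. B z (vcnj (vsnd u))) (vfst u))) (at u)"
proof -
  define a b where "a = vfst u" and "b = vsnd u"
  have a: "a \<in> \<Omega>" and b: "vcnj b \<in> \<Omega>" using assms by (auto simp: a_def b_def \<Omega>2_def)
  define X where "X = {w. vcnj w \<in> \<Omega>}"
  have X: "open X" "b \<in> X" using open_vcnj_\<Omega> b by (auto simp: X_def)
  obtain e where e: "e > 0" "ball a e \<subseteq> \<Omega>" using open_\<Omega> a openE by blast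
  define fy where "fy w z = Blinfun (\<lambda>v. rpart v (\<lambda>z. B z (vcnj w)) z)" for w z
  have der: "((\<lambda>z. B z (vcnj w)) has_derivative (\<lambda>v. rpart v (\<lambda>z. B z (vcnj w)) z)) (at z)"
    if "w \<in> X" "z \<in> \<Omega>" for w z
    using that by (intro holomorphic_in_has_derivative[OF kernel_holomorphic]) (auto simp: X_def)
  have fy: "blinfun_apply (fy w z) = (\<lambda>v. rpart v (\<lambda>z. B z (vcnj w)) z)" if "w \<in> X" "z \<in> \<Omega>" for w z
    unfolding fy_def by (rule bounded_linear_Blinfun_apply[OF has_derivative_bounded_linear[OF der[OF that]]])
  have "((\<lambda>(w, z). B z (vcnj w)) has_derivative
      (\<lambda>(tx, ty). rpart tx (\<lambda>w. B a (vcnj w)) b + blinfun_apply (fy b a) ty)) (at (b, a) within X \<times> ball a e)"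
  proof (rule has_derivative_partialsI)
    show "((\<lambda>w. B a (vcnj w)) has_derivative (\<lambda>v. rpart v (\<lambda>w. B a (vcnj w)) b)) (at b within X)"
      by (rule has_derivative_at_withinI, rule holomorphic_in_has_derivative[OF kernel_cnj_holomorphic[OF a]])
        (use b in simp)
    show "((\<lambda>z. B z (vcnj w)) has_derivative blinfun_apply (fy w z)) (at z within ball a e)"
      if "w \<in> X" "z \<in> ball a e" for w z
    proof -
      have z: "z \<in> \<Omega>" using that e by auto
      show ?thesis unfolding fy[OF that(1) z] by (rule has_derivative_at_withinI[OF der[OF that(1) z]])
    qed
    have "continuous_on (X \<times> ball a e) (\<lambda>(w, z). fy w z)"
    proof (rule continuous_on_blinfun_componentwise)
      fix i :: "complex ^ 'n"
      have "continuous_on (X \<times> ball a e) (\<lambda>q. (snd q, vcnj (fst q)))"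
        by (intro continuous_on_Pair continuous_on_snd continuous_on_id
            continuous_on_compose2[OF linear_continuous_on[OF bounded_linear_vcnj, of UNIV]] continuous_on_fst) auto
      moreover have "(\<lambda>q. (snd q, vcnj (fst q))) ` (X \<times> ball a e) \<subseteq> \<Omega> \<times> \<Omega>"
        using e by (auto simp: X_def)
      ultimately have "continuous_on (X \<times> ball a e) (\<lambda>q. rpart i (\<lambda>z. B z (vcnj (fst q))) (snd q))"
        using continuous_on_compose2[OF kernel_rpart_continuous[of i]] by fastforce
      then show "continuous_on (X \<times> ball a e) (\<lambda>q. blinfun_apply (case q of (w, z) \<Rightarrow> fy w z) i)"
        by (rule continuous_on_eq) (use fy e in \<open>auto simp: subset_iff\<close>)
    qed
    then show "continuous (at (b, a) within X \<times> ball a e) (\<lambda>(w, z). fy w z)"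
      using X e by (simp add: continuous_on_eq_continuous_within)
  qed (use e in auto)
  moreover have "at (b, a) within X \<times> ball a e = at (b, a)"
    using X e by (intro at_within_open open_Times) auto
  ultimately have D: "((\<lambda>p. B (snd p) (vcnj (fst p))) has_derivative
      (\<lambda>p. rpart (fst p) (\<lambda>w. B a (vcnj w)) b + rpart (snd p) (\<lambda>z. B z (vcnj b)) a)) (at (b, a))"
    using fy[OF X(2) a] by (simp add: case_prod_unfold)
  have L: "((\<lambda>u. (vsnd u, vfst u)) has_derivative (\<lambda>v. (vsnd v, vfst v))) (at u)"
    by (intro has_derivative_Pair bounded_linear_imp_has_derivative bounded_linear_vfst bounded_linear_vsnd)
  have "((\<lambda>u. B (vfst u) (vcnj (vsnd u))) has_derivative
      (\<lambda>v. rpart (vsnd v) (\<lambda>w. B a (vcnj w)) b + rpart (vfst v) (\<lambda>z. B z (vcnj b)) a)) (at u)"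
    using has_derivative_compose[OF L D[unfolded a_def b_def]] by (simp add: a_def b_def)
  then show ?thesis by (simp add: G_def[abs_def] a_def b_def)
qed

lemma G_holomorphic: "holomorphic_in G \<Omega>2"
proof (rule holomorphic_inI[OF G_has_derivative])
  fix u v c assume u: "u \<in> \<Omega>2"
  then have "vfst u \<in> \<Omega>" "vcnj (vsnd u) \<in> \<Omega>" by (auto simp: \<Omega>2_def)
  then show "rpart (vsnd (c *s v)) (\<lambda>w. B (vfst u) (vcnj w)) (vsnd u)
    + rpart (vfst (c *s v)) (\<lambda>z. B z (vcnj (vsnd u))) (vfst u) = c * (rpart (vsnd v) (\<lambda>w. B (vfst u) (vcnj w)) (vsnd u)
    + rpart (vfst v) (\<lambda>z. B z (vcnj (vsnd u))) (vfst u))"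
    using rpart_scalar_mult[OF kernel_holomorphic, of "vcnj (vsnd u)" "vfst u"]
      rpart_scalar_mult[OF kernel_cnj_holomorphic, of "vfst u" "vsnd u"]
    by (simp add: vfst_scalar_mult vsnd_scalar_mult algebra_simps)
qed

lemma rpart_G_left:
  assumes "z \<in> \<Omega>" "w \<in> \<Omega>"
  shows "rpart (vjoin v 0) G (vjoin z (vcnj w)) = rpart v (\<lambda>z. B z w) z"
proof -
  have "rpart 0 (\<lambda>w. B z (vcnj w)) (vcnj w) = 0"
    using rpart_scalar_mult[OF kernel_cnj_holomorphic[OF assms(1)], of "vcnj w" 0 0] assms by simp
  then show ?thesis
    using rpart_eqI[OF G_has_derivative[OF vjoin_\<Omega>2[OF assms]], of "vjoin v 0"] by simp
qed

lemma G_vswap: "u \<in> \<Omega>2 \<Longrightarrow> G (vswap u) = cnj (G u)"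
  using kernel_hermitian[of "vcnj (vsnd u)" "vfst u"] by (simp add: G_def vswap_def \<Omega>2_def)

lemma rpart_G_vswap:
  assumes "u \<in> \<Omega>2"
  shows "rpart (vswap v) G (vswap u) = cnj (rpart v G u)"
  by (rule rpart_vswap[OF G_has_derivative[OF assms] open_\<Omega>2 assms]) (simp add: G_vswap)

definition \<Omega>2' where "\<Omega>2' = {u \<in> \<Omega>2. G u \<noteq> 0}"

text \<open>\<open>F v\<close> is the derivative of \<open>log G\<close> in direction \<open>v\<close>.\<close>

definition F where "F v u = rpart v G u / G u"

lemma open_\<Omega>2': "open \<Omega>2'"
proof -
  have "\<Omega>2' = \<Omega>2 \<inter> G -` (- {0})" by (auto simp: \<Omega>2'_def)
  then show ?thesis
    using continuous_open_preimage[OF holomorphic_in_continuous_on[OF G_holomorphic] open_\<Omega>2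
        open_Compl[OF closed_singleton]] by (simp only:)
qed

lemma \<Omega>2'_sub: "\<Omega>2' \<subseteq> \<Omega>2"
  by (auto simp: \<Omega>2'_def)

lemma vjoin_\<Omega>2': "z \<in> \<Omega> \<Longrightarrow> w \<in> \<Omega> \<Longrightarrow> vjoin z (vcnj w) \<in> \<Omega>2' \<longleftrightarrow> B z w \<noteq> 0"
  by (simp add: \<Omega>2'_def vjoin_\<Omega>2)

lemma diag_\<Omega>2': "z \<in> \<Omega> \<Longrightarrow> vjoin z (vcnj z) \<in> \<Omega>2'"
  using K_pos[of z] by (auto simp: vjoin_\<Omega>2' K_def)

lemma G_holomorphic': "holomorphic_in G \<Omega>2'" "holomorphic_in (rpart v G) \<Omega>2'"
  using holomorphic_in_subset[OF _ \<Omega>2'_sub] G_holomorphic holomorphic_in_rpart[OF G_holomorphic open_\<Omega>2] by auto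

lemma F_holomorphic: "holomorphic_in (F v) \<Omega>2'" "holomorphic_in (rpart w (F v)) \<Omega>2'"
proof -
  show "holomorphic_in (F v) \<Omega>2'" for v
    unfolding F_def[abs_def] by (rule holomorphic_in_divide[OF G_holomorphic'(2,1)]) (simp add: \<Omega>2'_def)
  then show "holomorphic_in (rpart w (F v)) \<Omega>2'" by (rule holomorphic_in_rpart[OF _ open_\<Omega>2'])
qed

lemma rpart_F:
  assumes "u \<in> \<Omega>2'"
  shows "rpart w (F v) u = (rpart w (rpart v G) u * G u - rpart v G u * rpart w G u) / (G u * G u)"
  unfolding F_def[abs_def]
  by (rule rpart_divide[OF G_holomorphic'(2,1) assms]) (use assms in \<open>simp add: \<Omega>2'_def\<close>)

text \<open>The quotient-rule expression in \<open>rpart_F\<close> is symmetric up to exchanging two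
  derivatives of \<open>G\<close>.\<close>

lemma rpart_F_commute:
  assumes "u \<in> \<Omega>2'"
  shows "rpart w (F v) u = rpart v (F w) u"
  using rpart_commute[OF G_holomorphic open_\<Omega>2, of u w v] assms \<Omega>2'_sub
  by (auto simp: rpart_F)

lemma F_scalar_mult: "u \<in> \<Omega>2' \<Longrightarrow> F (c *s v) u = c * F v u"
  by (simp add: F_def rpart_scalar_mult[OF G_holomorphic'(1)])

lemma rpart_F_scalar_mult:
  assumes "u \<in> \<Omega>2'"
  shows "rpart (c *s w) (F v) u = c * rpart w (F v) u" "rpart w (F (c *s v)) u = c * rpart w (F v) u"
proof -
  show "rpart (c *s w) (F v) u = c * rpart w (F v) u" for v w
    by (rule rpart_scalar_mult[OF F_holomorphic(1) assms])
  then show "rpart w (F (c *s v)) u = c * rpart w (F v) u"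
    using rpart_F_commute[OF assms] by metis
qed

lemma rpart_F_add:
  assumes "u \<in> \<Omega>2'"
  shows "rpart (w + w') (F v) u = rpart w (F v) u + rpart w' (F v) u"
    "rpart w (F (v + v')) u = rpart w (F v) u + rpart w (F v') u"
proof -
  show "rpart (w + w') (F v) u = rpart w (F v) u + rpart w' (F v) u" for v w w'
    by (rule rpart_add_direction[OF holomorphic_in_has_derivative[OF F_holomorphic(1) assms]])
  then show "rpart w (F (v + v')) u = rpart w (F v) u + rpart w (F v') u"
    using rpart_F_commute[OF assms] by metis
qed

lemma rpart_rpart_F_commute:
  assumes "u \<in> \<Omega>2'"
  shows "rpart x (rpart w (F v)) u = rpart w (rpart x (F v)) u"
    "rpart x (rpart w (F v)) u = rpart x (rpart v (F w)) u"
  by (rule rpart_commute[OF F_holomorphic(1) open_\<Omega>2' assms])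
    (rule rpart_cong[OF open_\<Omega>2' assms rpart_F_commute])

lemma F_vswap:
  assumes "u \<in> \<Omega>2'"
  shows "cnj (F v u) = F (vswap v) (vswap u)"
  using assms \<Omega>2'_sub by (auto simp: F_def rpart_G_vswap G_vswap)

lemma rpart_F_vswap:
  assumes "u \<in> \<Omega>2'"
  shows "cnj (rpart w (F v) u) = rpart (vswap w) (F (vswap v)) (vswap u)"
  using rpart_vswap[OF holomorphic_in_has_derivative[OF F_holomorphic(1) assms] open_\<Omega>2' assms F_vswap]
  by simp

lemma rpart_rpart_F_vswap:
  assumes "u \<in> \<Omega>2'"
  shows "cnj (rpart x (rpart w (F v)) u) = rpart (vswap x) (rpart (vswap w) (F (vswap v))) (vswap u)"
  using rpart_vswap[OF holomorphic_in_has_derivative[OF F_holomorphic(2) assms] open_\<Omega>2' assms rpart_F_vswap]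
  by simp

text \<open>On the diagonal the derivative splits into a part complex linear in \<open>v\<close> and
  a part antilinear in \<open>v\<close>, the two that Wirtinger derivatives separate.\<close>

lemma diag_has_derivative:
  assumes "holomorphic_in \<Phi> \<Omega>2'" "z \<in> \<Omega>"
  shows "((\<lambda>z. \<Phi> (vjoin z (vcnj z))) has_derivative
    (\<lambda>v. rpart (vjoin v 0) \<Phi> (vjoin z (vcnj z)) + rpart (vjoin 0 (vcnj v)) \<Phi> (vjoin z (vcnj z)))) (at z)"
proof -
  note D = holomorphic_in_has_derivative[OF assms(1) diag_\<Omega>2'[OF assms(2)]]
  have "((\<lambda>z. \<Phi> (vjoin z (vcnj z))) has_derivative (\<lambda>v. rpart (vjoin v (vcnj v)) \<Phi> (vjoin z (vcnj z)))) (at z)"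
    by (rule has_derivative_compose[OF bounded_linear_imp_has_derivative[OF bounded_linear_vjoin_cnj] D])
  moreover have "rpart (vjoin v (vcnj v)) \<Phi> (vjoin z (vcnj z)) =
    rpart (vjoin v 0) \<Phi> (vjoin z (vcnj z)) + rpart (vjoin 0 (vcnj v)) \<Phi> (vjoin z (vcnj z))" for v
    using rpart_add_direction[OF D, of "vjoin v 0" "vjoin 0 (vcnj v)"] by (simp add: vjoin_arith)
  ultimately show ?thesis by simp
qed

lemma left_has_derivative:
  assumes "holomorphic_in \<Phi> \<Omega>2'" "vjoin z w \<in> \<Omega>2'"
  shows "((\<lambda>z. \<Phi> (vjoin z w)) has_derivative (\<lambda>v. rpart (vjoin v 0) \<Phi> (vjoin z w))) (at z)"
proof -
  have L: "((\<lambda>z. vjoin 0 w + vjoin z 0) has_derivative (\<lambda>v. vjoin v 0)) (at z)"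
    using has_derivative_add[OF has_derivative_const bounded_linear_imp_has_derivative[OF bounded_linear_vjoin_left]]
    by simp
  have "vjoin 0 w + vjoin z 0 = vjoin z w" for z by (simp add: vjoin_arith)
  then show ?thesis
    using has_derivative_compose[OF L, of \<Phi> "\<lambda>v. rpart v \<Phi> (vjoin z w)"]
      holomorphic_in_has_derivative[OF assms] by simp
qed

lemma holomorphic_in_left:
  assumes "holomorphic_in \<Phi> S" "\<And>z. z \<in> T \<Longrightarrow> vjoin z w \<in> S"
  shows "holomorphic_in (\<lambda>z. \<Phi> (vjoin z w)) T"
  using holomorphic_in_compose_linear[OF assms(1) bounded_linear_vjoin_left, of T "vjoin 0 w"] assms(2)
  by (simp add: vjoin_arith)

end

section \<open>The reproducing property for derivatives\<close>

context bergman
begin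

text \<open>The derivative of the kernel in \<open>z\<close> is a circle average of its values.
  Fubini moves this average outside the integral over \<open>\<xi>\<close>, the reproducing property
  turns the kernel into \<open>f\<close> on the circle, and averaging those values yields the
  derivative of \<open>f\<close>.\<close>

lemma reproducing_derivative:
  assumes z: "z \<in> \<Omega>" and f: "f \<in> bergman_space \<Omega>"
  shows "set_integrable lebesgue \<Omega> (\<lambda>\<xi>. f \<xi> * rpart (vjoin v 0) G (vjoin z (vcnj \<xi>)))"
    and "(LINT \<xi>:\<Omega>|lebesgue. f \<xi> * rpart (vjoin v 0) G (vjoin z (vcnj \<xi>))) = rpart v f z"
proof -
  obtain r0 M where r0: "r0 > 0" "M > 0" "cball z r0 \<subseteq> \<Omega>" "\<And>w. w \<in> cball z r0 \<Longrightarrow> K w \<le> M"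
    using K_locally_bounded[OF z] by metis
  have fh: "holomorphic_in f \<Omega>" and fi: "set_integrable lebesgue \<Omega> (\<lambda>\<xi>. (cmod (f \<xi>))\<^sup>2)"
    using f by (auto simp: bergman_space_def)
  define r where "r = r0 / (norm v + 1)"
  have n1: "norm v + 1 > 0" by (simp add: add_nonneg_pos)
  have r: "r > 0" using r0 n1 by (simp add: r_def)
  have in_cb: "z + t *s v \<in> cball z r0" if "cmod t \<le> r" for t
  proof -
    have "cmod t * norm v \<le> r * (norm v + 1)" using that r by (intro mult_mono) auto
    then show ?thesis using n1 by (simp add: r_def dist_norm norm_scalar_mult)
  qed
  then have in\<Omega>: "z + t *s v \<in> \<Omega>" if "cmod t \<le> r" for t using that r0(3) by blast
  define c where "c x = of_real r * unit_circle x" for x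
  have c: "cmod (c x) = r" "c x \<noteq> 0" for x using r by (auto simp: c_def norm_mult)
  define b where "b \<xi> x = f \<xi> * B (z + c x *s v) \<xi> / c x" for \<xi> x
  define H where "H \<xi> x = indicator (\<Omega> \<times> {0..1}) (\<xi>, x :: real) *\<^sub>R b \<xi> x" for \<xi> x
  have "continuous_on (\<Omega> \<times> {0..1}) (\<lambda>p. b (fst p) (snd p))"
    unfolding b_def c_def
    by (intro continuous_on_divide kernel_continuous_on_compose continuous_on_add
          continuous_on_scalar_mult_left continuous_on_mult continuous_on_const
          continuous_on_compose2[OF continuous_on_unit_circle[of UNIV]]
          continuous_on_compose2[OF holomorphic_in_continuous_on[OF fh]] continuous_on_fst continuous_on_snd continuous_on_id)
      (use in\<Omega> c r in \<open>auto simp: c_def norm_mult\<close>)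
  then have "(\<lambda>p. indicator (\<Omega> \<times> {0..1}) p *\<^sub>R b (fst p) (snd p)) \<in> borel_measurable borel"
    using \<Omega>_sets(1) by (intro borel_measurable_continuous_on_indicator borel_Times) auto
  then have Hm: "case_prod H \<in> borel_measurable (lborel \<Otimes>\<^sub>M lborel)"
    unfolding lborel_prod by (simp add: H_def case_prod_unfold)
  define k where "k w \<xi> = indicator \<Omega> \<xi> *\<^sub>R (((cmod (f \<xi>))\<^sup>2 + (cmod (B \<xi> w))\<^sup>2) / r)" for w \<xi>
  have k: "integrable lborel (k w)" "(LINT \<xi>|lborel. k w \<xi>) = ((LINT \<xi>:\<Omega>|lebesgue. (cmod (f \<xi>))\<^sup>2) + K w) / r"
    if w: "w \<in> \<Omega>" for w
  proof -
    have i: "set_integrable lebesgue \<Omega> (\<lambda>\<xi>. (cmod (B \<xi> w))\<^sup>2)"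
      using kernel_in_space[OF w] by (simp add: bergman_space_def)
    have m: "k w \<in> borel_measurable borel"
      unfolding k_def[abs_def] using r
      by (intro borel_measurable_continuous_on_indicator continuous_intros
          holomorphic_in_continuous_on[OF fh] holomorphic_in_continuous_on[OF kernel_holomorphic[OF w]]) auto
    have "set_integrable lebesgue \<Omega> (\<lambda>\<xi>. ((cmod (f \<xi>))\<^sup>2 + (cmod (B \<xi> w))\<^sup>2) / r)"
      using set_integral_add(1)[OF fi i] by simp
    then have "integrable lebesgue (k w)" by (simp add: set_integrable_def k_def[abs_def])
    then show "integrable lborel (k w)" using m by (simp add: integrable_completion)
    have "(LINT \<xi>|lborel. k w \<xi>) = (LINT \<xi>|lebesgue. k w \<xi>)"
      using m by (simp add: integral_completion)
    also have "\<dots> = (LINT \<xi>:\<Omega>|lebesgue. ((cmod (f \<xi>))\<^sup>2 + (cmod (B \<xi> w))\<^sup>2) / r)"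
      by (simp only: set_lebesgue_integral_def k_def)
    finally have "(LINT \<xi>|lborel. k w \<xi>) = (LINT \<xi>:\<Omega>|lebesgue. ((cmod (f \<xi>))\<^sup>2 + (cmod (B \<xi> w))\<^sup>2) / r)" .
    then show "(LINT \<xi>|lborel. k w \<xi>) = ((LINT \<xi>:\<Omega>|lebesgue. (cmod (f \<xi>))\<^sup>2) + K w) / r"
      using set_integral_add(2)[OF fi i] kernel_norm_sq(1)[OF w] by simp
  qed
  have knn: "k w \<xi> \<ge> 0" for w \<xi> using r by (simp add: k_def indicator_def)
  \<comment> \<open>Bounds the integral over \<open>\<xi>\<close> uniformly on the circle, where
    \<open>K\<close> is at most \<open>M\<close>; this makes the joint integrand absolutely
    integrable.\<close>
  define C where "C = ((LINT \<xi>:\<Omega>|lebesgue. (cmod (f \<xi>))\<^sup>2) + M) / r"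
  have Hk: "cmod (H \<xi> x) \<le> indicator {0..1} x * k (z + c x *s v) \<xi>" for \<xi> x
  proof (cases "\<xi> \<in> \<Omega> \<and> x \<in> {0..1}")
    case True
    let ?w = "z + c x *s v"
    have w: "?w \<in> \<Omega>" using in\<Omega> c by simp
    note norm_mult_norm_le[of "f \<xi>" "B \<xi> ?w"]
    moreover have "cmod (B ?w \<xi>) = cmod (B \<xi> ?w)" using kernel_hermitian[OF w, of \<xi>] True by simp
    ultimately show ?thesis using True c r
      by (simp add: H_def k_def b_def norm_mult norm_divide divide_right_mono)
  qed (auto simp: H_def indicator_def knn)
  have int: "integrable (lborel \<Otimes>\<^sub>M lborel) (case_prod H)"
  proof (rule integrableI_bounded[OF Hm])
    have "(\<integral>\<^sup>+ p. ennreal (norm (case_prod H p)) \<partial>(lborel \<Otimes>\<^sub>M lborel)) =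
        (\<integral>\<^sup>+ x. \<integral>\<^sup>+ \<xi>. ennreal (norm (H \<xi> x)) \<partial>lborel \<partial>lborel)"
      using lborel_pair.nn_integral_snd[of "\<lambda>p. ennreal (norm (case_prod H p))"] Hm by simp
    also have "\<dots> \<le> (\<integral>\<^sup>+ x. ennreal C * indicator {0..1::real} x \<partial>lborel)"
    proof (rule nn_integral_mono)
      fix x :: real
      let ?w = "z + c x *s v"
      have w: "?w \<in> \<Omega>" using in\<Omega> c by simp
      show "(\<integral>\<^sup>+ \<xi>. ennreal (norm (H \<xi> x)) \<partial>lborel) \<le> ennreal C * indicator {0..1} x"
      proof (cases "x \<in> {0..1}")
        case True
        have "(\<integral>\<^sup>+ \<xi>. ennreal (norm (H \<xi> x)) \<partial>lborel) \<le> (\<integral>\<^sup>+ \<xi>. ennreal (k ?w \<xi>) \<partial>lborel)"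
          by (intro nn_integral_mono ennreal_leI) (use Hk[of _ x] True in auto)
        also have "\<dots> = ennreal (LINT \<xi>|lborel. k ?w \<xi>)"
          by (rule nn_integral_eq_integral[OF k(1)[OF w]]) (use knn in auto)
        also have "\<dots> \<le> ennreal C"
          unfolding k(2)[OF w] C_def using r r0(4)[OF in_cb[of "c x"]] c(1)[of x]
          by (intro ennreal_leI divide_right_mono) auto
        finally show ?thesis using True by simp
      next
        case False
        then have "H \<xi> x = 0" for \<xi> by (simp add: H_def)
        then show ?thesis by simp
      qed
    qed
    also have "\<dots> = ennreal C * emeasure lborel {0..1::real}" by (rule nn_integral_cmult_indicator) simp
    also have "\<dots> < \<infinity>" by (simp add: ennreal_mult_less_top)
    finally show "(\<integral>\<^sup>+ p. ennreal (norm (case_prod H p)) \<partial>(lborel \<Otimes>\<^sub>M lborel)) < \<infinity>" .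
  qed
  define h where "h \<xi> = (LINT x|lborel. H \<xi> x)" for \<xi>
  have set01: "(LINT x|lborel. indicator {0..1} x *\<^sub>R g x) = y"
    if "(g has_integral y) {0..1}" "continuous_on {0..1} g" for g :: "real \<Rightarrow> complex" and y
  proof -
    have "set_integrable lborel {0..1} g"
      unfolding set_integrable_def using that(2) by (intro borel_integrable_compact) auto
    from set_borel_integral_eq_integral(2)[OF this] integral_unique[OF that(1)]
    show ?thesis by (simp add: set_lebesgue_integral_def)
  qed
  have cc: "continuous_on {0..1} (\<lambda>x. g (z + c x *s v) / c x)" if "continuous_on \<Omega> g" for g
    unfolding c_def
    by (intro continuous_on_divide continuous_on_compose2[OF that] continuous_intros)
      (use in\<Omega> c r in \<open>auto simp: c_def norm_mult\<close>)
  have hval: "h \<xi> = indicator \<Omega> \<xi> *\<^sub>R (f \<xi> * rpart (vjoin v 0) G (vjoin z (vcnj \<xi>)))" for \<xi>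
  proof (cases "\<xi> \<in> \<Omega>")
    case True
    note hol = kernel_holomorphic[OF True]
    have "((\<lambda>x. B (z + c x *s v) \<xi> / c x) has_integral rpart v (\<lambda>z. B z \<xi>) z) {0..1}"
      unfolding c_def by (rule circle_mean(2)[OF hol r in\<Omega>])
    from set01[OF this cc[OF holomorphic_in_continuous_on[OF hol]]]
    have I: "(LINT x|lborel. indicator {0..1} x *\<^sub>R (B (z + c x *s v) \<xi> / c x)) = rpart v (\<lambda>z. B z \<xi>) z" .
    have "h \<xi> = (LINT x|lborel. f \<xi> * (indicator {0..1} x *\<^sub>R (B (z + c x *s v) \<xi> / c x)))"
      unfolding h_def using True by (intro Bochner_Integration.integral_cong) (auto simp: H_def b_def indicator_def)
    also have "\<dots> = f \<xi> * rpart v (\<lambda>z. B z \<xi>) z" unfolding I[symmetric] by (rule integral_mult_right_zero)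
    finally show ?thesis using True rpart_G_left[OF z True] by simp
  qed (simp add: h_def H_def)
  have hint: "integrable lborel h"
    unfolding h_def using lborel_pair.integrable_fst'[OF int] by simp
  then have hm: "h \<in> borel_measurable lborel" by auto
  then have hint': "integrable lebesgue h" using hint by (simp add: integrable_completion)
  then show "set_integrable lebesgue \<Omega> (\<lambda>\<xi>. f \<xi> * rpart (vjoin v 0) G (vjoin z (vcnj \<xi>)))"
    by (simp add: set_integrable_def hval[symmetric])
  have "(LINT \<xi>:\<Omega>|lebesgue. f \<xi> * rpart (vjoin v 0) G (vjoin z (vcnj \<xi>))) = (LINT \<xi>|lborel. h \<xi>)"
    using hm by (simp add: set_lebesgue_integral_def hval[symmetric] integral_completion)
  also have "\<dots> = (LINT x|lborel. LINT \<xi>|lborel. H \<xi> x)"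
    unfolding h_def by (rule lborel_pair.Fubini_integral[OF int, symmetric])
  also have "\<dots> = (LINT x|lborel. indicator {0..1} x *\<^sub>R (f (z + c x *s v) / c x))"
  proof (rule Bochner_Integration.integral_cong[OF refl])
    fix x :: real
    let ?w = "z + c x *s v"
    have w: "?w \<in> \<Omega>" using in\<Omega> c by simp
    have m: "(\<lambda>\<xi>. indicator \<Omega> \<xi> *\<^sub>R (f \<xi> * cnj (B \<xi> ?w))) \<in> borel_measurable borel"
      by (intro borel_measurable_continuous_on_indicator continuous_intros
          holomorphic_in_continuous_on[OF fh] holomorphic_in_continuous_on[OF kernel_holomorphic[OF w]]) auto
    have eq: "H \<xi> x = (indicator {0..1} x / c x) * (indicator \<Omega> \<xi> *\<^sub>R (f \<xi> * cnj (B \<xi> ?w)))" for \<xi>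
      using kernel_hermitian[OF w, of \<xi>] by (auto simp: H_def b_def indicator_def)
    have "(LINT \<xi>|lborel. H \<xi> x) = (indicator {0..1} x / c x) * (LINT \<xi>|lborel. indicator \<Omega> \<xi> *\<^sub>R (f \<xi> * cnj (B \<xi> ?w)))"
      unfolding eq by (rule integral_mult_right_zero)
    also have "(LINT \<xi>|lborel. indicator \<Omega> \<xi> *\<^sub>R (f \<xi> * cnj (B \<xi> ?w))) = f ?w"
      using reproducing[OF w f] m by (simp add: set_lebesgue_integral_def integral_completion)
    finally show "(LINT \<xi>|lborel. H \<xi> x) = indicator {0..1} x *\<^sub>R (f ?w / c x)"
      by (cases "x \<in> {0..1}") simp_all
  qed
  also have "\<dots> = rpart v f z"
  proof (rule set01[OF _ cc[OF holomorphic_in_continuous_on[OF fh]]])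
    show "((\<lambda>x. f (z + c x *s v) / c x) has_integral rpart v f z) {0..1}"
      unfolding c_def by (rule circle_mean(2)[OF fh r in\<Omega>])
  qed
  finally show "(LINT \<xi>:\<Omega>|lebesgue. f \<xi> * rpart (vjoin v 0) G (vjoin z (vcnj \<xi>))) = rpart v f z" .
qed

end

section \<open>Moments of the score\<close>

context bergman
begin

lemma kernel_zeros_negligible:
  assumes "z \<in> \<Omega>"
  shows "negligible {\<xi> \<in> \<Omega>. B \<xi> z = 0}"
proof (rule holomorphic_in_negligible_zeros[OF open_\<Omega> connected_\<Omega> kernel_holomorphic[OF assms] assms])
  show "B z z \<noteq> 0" using K_pos[OF assms] by (auto simp: K_def)
qed

lemma AE_kernel_nonzero:
  assumes "z \<in> \<Omega>"
  shows "AE \<xi> in lebesgue. \<xi> \<in> \<Omega> \<longrightarrow> B \<xi> z \<noteq> 0"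
proof -
  have "AE \<xi> in lebesgue. \<xi> \<notin> {\<xi> \<in> \<Omega>. B \<xi> z = 0}"
    using kernel_zeros_negligible[OF assms] by (intro AE_not_in) (simp add: negligible_iff_null_sets)
  then show ?thesis by eventually_elim auto
qed

lemma sets_model: "sets (bergman_model \<Omega> B z) = sets (lebesgue_on \<Omega>)"
  by (simp add: bergman_model_def)

lemma continuous_measurable:
  fixes f :: "complex ^ 'n \<Rightarrow> complex"
  assumes "continuous_on \<Omega> f"
  shows "f \<in> borel_measurable (lebesgue_on \<Omega>)"
  using assms by (rule continuous_imp_measurable_on_sets_lebesgue) auto

text \<open>The functions of interest are determined only off the zeros of B(.,z). These form a null
  set and Lebesgue measure is complete, so measurability of \<open>f'\<close> is a consequence,
  whatever its values there.\<close>

lemma model_cong: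
  fixes f f' :: "complex ^ 'n \<Rightarrow> 'b::{banach, second_countable_topology}"
  assumes z: "z \<in> \<Omega>" and eq: "\<And>\<xi>. \<xi> \<in> \<Omega> \<Longrightarrow> B \<xi> z \<noteq> 0 \<Longrightarrow> f \<xi> = f' \<xi>"
    and f: "integrable (bergman_model \<Omega> B z) f"
  shows "integrable (bergman_model \<Omega> B z) f'"
    and "integral\<^sup>L (bergman_model \<Omega> B z) f' = integral\<^sup>L (bergman_model \<Omega> B z) f"
proof -
  let ?N = "{\<xi> \<in> \<Omega>. B \<xi> z = 0}" and ?M = "bergman_model \<Omega> B z"
  have fm: "f \<in> borel_measurable (lebesgue_on \<Omega>)"
    using borel_measurable_integrable[OF f] by (simp add: measurable_cong_sets[OF sets_model refl])
  have N: "T \<in> sets lebesgue" if "T \<subseteq> ?N" for T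
    using negligible_subset[OF kernel_zeros_negligible[OF z] that] by (rule negligible_imp_sets)
  have f'm: "f' \<in> borel_measurable (lebesgue_on \<Omega>)"
  proof (rule measurableI)
    fix A :: "'b set" assume A: "A \<in> sets borel"
    have "f -` A \<inter> space (lebesgue_on \<Omega>) \<in> sets (lebesgue_on \<Omega>)"
      by (rule measurable_sets[OF fm A])
    then have s: "f -` A \<inter> \<Omega> \<in> sets lebesgue"
      by (simp add: sets_restrict_space_iff)
    have "f' -` A \<inter> \<Omega> = (f -` A \<inter> \<Omega> - ?N) \<union> (f' -` A \<inter> ?N)"
      using eq by auto
    also have "\<dots> \<in> sets lebesgue" using s N[of ?N] N[of "f' -` A \<inter> ?N"] by auto
    finally show "f' -` A \<inter> space (lebesgue_on \<Omega>) \<in> sets (lebesgue_on \<Omega>)"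
      by (simp add: sets_restrict_space_iff)
  qed simp
  then have f'M: "f' \<in> borel_measurable ?M" by (simp add: measurable_cong_sets[OF sets_model refl])
  have ae: "AE \<xi> in ?M. f \<xi> = f' \<xi>"
    unfolding bergman_model_def using bergman_P_measurable[OF z]
  proof (subst AE_density, simp, intro AE_I2 impI)
    fix \<xi> assume "\<xi> \<in> space (lebesgue_on \<Omega>)" and p: "0 < ennreal (bergman_P B z \<xi>)"
    then have \<xi>: "\<xi> \<in> \<Omega>" by simp
    have "B \<xi> z \<noteq> 0" using p bergman_P_eq[OF z \<xi>] by auto
    then show "f \<xi> = f' \<xi>" by (rule eq[OF \<xi>])
  qed
  show "integrable ?M f'"
    using f by (rule integrable_cong_AE[THEN iffD1, rotated -1]) (use ae f'M borel_measurable_integrable[OF f] in auto)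
  show "integral\<^sup>L ?M f' = integral\<^sup>L ?M f"
    by (rule integral_cong_AE) (use ae f'M borel_measurable_integrable[OF f] in auto)
qed

text \<open>The passage from complex moments to real expectations, with agreement required only off
  the zeros.\<close>

lemma expect_Re:
  assumes z: "z \<in> \<Omega>" and \<phi>: "integrable (bergman_model \<Omega> B z) \<phi>"
    and eq: "\<And>\<xi>. \<xi> \<in> \<Omega> \<Longrightarrow> B \<xi> z \<noteq> 0 \<Longrightarrow> f \<xi> = Re (\<phi> \<xi>)"
  shows "integrable (bergman_model \<Omega> B z) f"
    and "expect \<Omega> B z f = Re (integral\<^sup>L (bergman_model \<Omega> B z) \<phi>)"
proof -
  let ?M = "bergman_model \<Omega> B z"
  note c = model_cong[OF z _ integrable_Re[OF \<phi>], of f]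
  show i: "integrable ?M f" using c(1) eq by simp
  have "f \<in> borel_measurable (lebesgue_on \<Omega>)"
    using borel_measurable_integrable[OF i] by (simp add: measurable_cong_sets[OF sets_model refl])
  from model_integral(1)[OF z this] have "expect \<Omega> B z f = integral\<^sup>L ?M f"
    by (simp add: expect_def mult.commute)
  also have "\<dots> = Re (integral\<^sup>L ?M \<phi>)" using c(2) eq \<phi> by simp
  finally show "expect \<Omega> B z f = Re (integral\<^sup>L ?M \<phi>)" .
qed

text \<open>Meromorphic functions with poles on the zero set of B(.,z). Values on that set are left
  free and the pole order is unbounded; a single power of the kernel as denominator is stable under
  products and differences.\<close>

definition mero where
  "mero z m \<longleftrightarrow> (\<exists>p N. holomorphic_in p \<Omega> \<and> (\<forall>\<xi>\<in>\<Omega>. B \<xi> z \<noteq> 0 \<longrightarrow> m \<xi> = p \<xi> / B \<xi> z ^ N))"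

lemma mero_const: "mero z (\<lambda>_. c)"
  unfolding mero_def by (rule exI[of _ "\<lambda>_. c"], rule exI[of _ 0]) (simp add: holomorphic_in_const)

lemma mero_mult:
  assumes "mero z m" "mero z m'"
  shows "mero z (\<lambda>\<xi>. m \<xi> * m' \<xi>)"
proof -
  obtain p N p' N' where 1: "holomorphic_in p \<Omega>" "\<forall>\<xi>\<in>\<Omega>. B \<xi> z \<noteq> 0 \<longrightarrow> m \<xi> = p \<xi> / B \<xi> z ^ N"
    and 2: "holomorphic_in p' \<Omega>" "\<forall>\<xi>\<in>\<Omega>. B \<xi> z \<noteq> 0 \<longrightarrow> m' \<xi> = p' \<xi> / B \<xi> z ^ N'"
    using assms unfolding mero_def by blast
  show ?thesis unfolding mero_def
    by (rule exI[of _ "\<lambda>\<xi>. p \<xi> * p' \<xi>"], rule exI[of _ "N + N'"])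
      (use 1 2 in \<open>simp add: holomorphic_in_mult power_add\<close>)
qed

lemma mero_diff:
  assumes z: "z \<in> \<Omega>" and "mero z m" "mero z m'"
  shows "mero z (\<lambda>\<xi>. m \<xi> - m' \<xi>)"
proof -
  obtain p N p' N' where 1: "holomorphic_in p \<Omega>" "\<forall>\<xi>\<in>\<Omega>. B \<xi> z \<noteq> 0 \<longrightarrow> m \<xi> = p \<xi> / B \<xi> z ^ N"
    and 2: "holomorphic_in p' \<Omega>" "\<forall>\<xi>\<in>\<Omega>. B \<xi> z \<noteq> 0 \<longrightarrow> m' \<xi> = p' \<xi> / B \<xi> z ^ N'"
    using assms unfolding mero_def by blast
  show ?thesis unfolding mero_def
  proof (rule exI[of _ "\<lambda>\<xi>. p \<xi> * B \<xi> z ^ N' - p' \<xi> * B \<xi> z ^ N"], rule exI[of _ "N + N'"], intro conjI)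
    show "holomorphic_in (\<lambda>\<xi>. p \<xi> * B \<xi> z ^ N' - p' \<xi> * B \<xi> z ^ N) \<Omega>"
      using 1 2 kernel_holomorphic[OF z]
      by (intro holomorphic_in_diff holomorphic_in_mult holomorphic_in_power) auto
    show "\<forall>\<xi>\<in>\<Omega>. B \<xi> z \<noteq> 0 \<longrightarrow> m \<xi> - m' \<xi> = (p \<xi> * B \<xi> z ^ N' - p' \<xi> * B \<xi> z ^ N) / B \<xi> z ^ (N + N')"
      using 1 2 by (simp add: power_add diff_divide_distrib)
  qed
qed

text \<open>\<open>cnj (score z v \<xi>)\<close> is the holomorphic derivative of \<open>log P(z,\<xi>)\<close> in the direction \<open>v\<close>; the
  function \<open>score z v\<close> itself is meromorphic in \<open>\<xi>\<close>.\<close>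

definition score where
  "score z v \<xi> = F (vjoin 0 (vcnj v)) (vjoin \<xi> (vcnj z)) - F (vjoin 0 (vcnj v)) (vjoin z (vcnj z))"

text \<open>The second antiholomorphic parameter derivative of log B alone. The contribution of log
  B(z,z) is left out, being constant in \<open>\<xi>\<close>; it returns below as the constants
  \<open>\<kappa>\<close> and \<open>c\<close>.\<close>

definition dscore where
  "dscore z v w \<xi> = rpart (vjoin 0 (vcnj v)) (F (vjoin 0 (vcnj w))) (vjoin \<xi> (vcnj z))"

lemma mero_score:
  assumes z: "z \<in> \<Omega>"
  shows "mero z (score z v)"
proof -
  let ?v = "vjoin 0 (vcnj v) :: complex ^ ('n + 'n)"
  have "mero z (\<lambda>\<xi>. F ?v (vjoin \<xi> (vcnj z)))"
    unfolding mero_def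
  proof (rule exI[of _ "\<lambda>\<xi>. rpart ?v G (vjoin \<xi> (vcnj z))"], rule exI[of _ 1], intro conjI)
    show "holomorphic_in (\<lambda>\<xi>. rpart ?v G (vjoin \<xi> (vcnj z))) \<Omega>"
      by (rule holomorphic_in_left[OF holomorphic_in_rpart[OF G_holomorphic open_\<Omega>2] vjoin_\<Omega>2[OF _ z]])
  qed (simp add: F_def)
  then show ?thesis unfolding score_def[abs_def] by (intro mero_diff[OF z] mero_const)
qed

lemma mero_dscore:
  assumes z: "z \<in> \<Omega>"
  shows "mero z (dscore z v w)"
proof -
  let ?v = "vjoin 0 (vcnj v) :: complex ^ ('n + 'n)" and ?w = "vjoin 0 (vcnj w) :: complex ^ ('n + 'n)"
  note H = holomorphic_in_left[OF _ vjoin_\<Omega>2[OF _ z], of _ \<Omega>]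
  note R = holomorphic_in_rpart[OF _ open_\<Omega>2]
  show ?thesis unfolding mero_def
  proof (rule exI[of _ "\<lambda>\<xi>. rpart ?v (rpart ?w G) (vjoin \<xi> (vcnj z)) * G (vjoin \<xi> (vcnj z))
      - rpart ?w G (vjoin \<xi> (vcnj z)) * rpart ?v G (vjoin \<xi> (vcnj z))"], rule exI[of _ 2], intro conjI)
    show "holomorphic_in (\<lambda>\<xi>. rpart ?v (rpart ?w G) (vjoin \<xi> (vcnj z)) * G (vjoin \<xi> (vcnj z))
      - rpart ?w G (vjoin \<xi> (vcnj z)) * rpart ?v G (vjoin \<xi> (vcnj z))) \<Omega>"
      by (intro holomorphic_in_diff holomorphic_in_mult H R G_holomorphic)
  qed (simp add: dscore_def rpart_F vjoin_\<Omega>2' z power2_eq_square)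
qed

lemma score_base: "score z v z = 0"
  by (simp add: score_def)

lemma score_has_derivative:
  assumes "z \<in> \<Omega>"
  shows "(score z v has_derivative (\<lambda>k. rpart (vjoin k 0) (F (vjoin 0 (vcnj v))) (vjoin z (vcnj z)))) (at z)"
  unfolding score_def[abs_def]
  using has_derivative_diff[OF left_has_derivative[OF F_holomorphic(1) diag_\<Omega>2'[OF assms]] has_derivative_const]
  by simp

lemmas rpart_score = rpart_eqI[OF score_has_derivative]

lemma rpart_dscore:
  assumes "z \<in> \<Omega>"
  shows "rpart k (dscore z v w) z =
    rpart (vjoin k 0) (rpart (vjoin 0 (vcnj v)) (F (vjoin 0 (vcnj w)))) (vjoin z (vcnj z))"
  unfolding dscore_def[abs_def]
  by (rule rpart_eqI[OF left_has_derivative[OF F_holomorphic(2) diag_\<Omega>2'[OF assms]]])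

text \<open>Conjugation exchanges the slots, so a derivative in the conjugated second slot becomes a
  holomorphic derivative in the first.\<close>

lemma cnj_score:
  assumes "z \<in> \<Omega>" "\<xi> \<in> \<Omega>" "B \<xi> z \<noteq> 0"
  shows "cnj (score z v \<xi>) = F (vjoin v 0) (vjoin z (vcnj \<xi>)) - F (vjoin v 0) (vjoin z (vcnj z))"
  using F_vswap[of "vjoin \<xi> (vcnj z)" "vjoin 0 (vcnj v)"] F_vswap[of "vjoin z (vcnj z)" "vjoin 0 (vcnj v)"]
    assms vjoin_\<Omega>2'[OF assms(2,1)] diag_\<Omega>2'[OF assms(1)] by (simp add: score_def vcnj_arith)

lemma cnj_dscore:
  assumes "z \<in> \<Omega>" "\<xi> \<in> \<Omega>" "B \<xi> z \<noteq> 0"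
  shows "cnj (dscore z v w \<xi>) = rpart (vjoin v 0) (F (vjoin w 0)) (vjoin z (vcnj \<xi>))"
  using rpart_F_vswap[of "vjoin \<xi> (vcnj z)" "vjoin 0 (vcnj v)" "vjoin 0 (vcnj w)"]
    assms vjoin_\<Omega>2'[OF assms(2,1)] by (simp add: dscore_def vcnj_arith)

text \<open>A meromorphic \<open>m\<close> that is square integrable against the model is the quotient of an element
  of the Bergman space by the kernel, since \<open>L\<^sup>2\<close> singularities along the zeros of \<open>B(\<cdot>,z)\<close> are removable.\<close>

lemma mero_extension:
  assumes z: "z \<in> \<Omega>" and m: "mero z m"
    and int: "integrable (bergman_model \<Omega> B z) (\<lambda>\<xi>. m \<xi> * cnj (m \<xi>))"
  obtains H where "H \<in> bergman_space \<Omega>" "\<And>\<xi>. \<xi> \<in> \<Omega> \<Longrightarrow> B \<xi> z \<noteq> 0 \<Longrightarrow> m \<xi> = H \<xi> / B \<xi> z"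
proof -
  obtain p N where p: "holomorphic_in p \<Omega>" "\<And>\<xi>. \<xi> \<in> \<Omega> \<Longrightarrow> B \<xi> z \<noteq> 0 \<Longrightarrow> m \<xi> = p \<xi> / B \<xi> z ^ N"
    using m unfolding mero_def by blast
  \<comment> \<open>The candidate for \<open>m\<close> times the kernel. The factor
    \<open>B \<xi> z\<close> kept in the numerator makes \<open>h\<close> vanish where the kernel
    does, also for \<open>N = 0\<close>, so its square matches the density-weighted square of
    \<open>m\<close> at every point.\<close>
  define h where "h \<xi> = p \<xi> * B \<xi> z / B \<xi> z ^ N" for \<xi>
  note gh = kernel_holomorphic[OF z]
  have Kz: "K z > 0" "B z z = of_real (K z)" using K_pos[OF z] kernel_norm_sq(2)[OF z] by auto
  have "(\<lambda>\<xi>. m \<xi> * cnj (m \<xi>)) \<in> borel_measurable (lebesgue_on \<Omega>)"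
    using borel_measurable_integrable[OF int] by (simp add: measurable_cong_sets[OF sets_model refl])
  from model_integral(2)[OF z this] int
  have "set_integrable lebesgue \<Omega> (\<lambda>\<xi>. bergman_P B z \<xi> *\<^sub>R (m \<xi> * cnj (m \<xi>)))" by simp
  then have "set_integrable lebesgue \<Omega> (\<lambda>\<xi>. complex_of_real ((cmod (h \<xi>))\<^sup>2 / K z))"
  proof (rule set_integrable_cong[THEN iffD1, rotated -1, OF _ refl refl])
    fix \<xi> assume \<xi>: "\<xi> \<in> \<Omega>"
    show "bergman_P B z \<xi> *\<^sub>R (m \<xi> * cnj (m \<xi>)) = complex_of_real ((cmod (h \<xi>))\<^sup>2 / K z)"
    proof (cases "B \<xi> z = 0")
      case True
      then show ?thesis by (simp add: bergman_P_eq[OF z \<xi>] h_def)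
    next
      case False
      have "m \<xi> * cnj (m \<xi>) = of_real ((cmod (m \<xi>))\<^sup>2)" by (simp only: complex_norm_square)
      moreover have "cmod (h \<xi>) = cmod (m \<xi>) * cmod (B \<xi> z)"
        using p(2)[OF \<xi> False] by (simp add: h_def norm_mult norm_divide)
      ultimately show ?thesis
        by (simp add: bergman_P_eq[OF z \<xi>] scaleR_conv_of_real power_mult_distrib mult_ac)
    qed
  qed
  then have "integrable lebesgue (\<lambda>\<xi>. Re (indicator \<Omega> \<xi> *\<^sub>R complex_of_real ((cmod (h \<xi>))\<^sup>2 / K z)))"
    unfolding set_integrable_def by (rule integrable_Re)
  from integrable_mult_right[OF this, of "K z"]
  have hint: "integrable lebesgue (\<lambda>\<xi>. indicator \<Omega> \<xi> * (cmod (h \<xi>))\<^sup>2)"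
    by (rule Bochner_Integration.integrable_cong[THEN iffD1, rotated -1]) (use Kz in auto)
  have "(\<integral>\<^sup>+\<xi>. indicator \<Omega> \<xi> * ennreal ((cmod (p \<xi> * B \<xi> z / B \<xi> z ^ N))\<^sup>2) \<partial>lborel)
    = (\<integral>\<^sup>+\<xi>. ennreal (norm (indicator \<Omega> \<xi> * (cmod (h \<xi>))\<^sup>2)) \<partial>lebesgue)"
    unfolding nn_integral_completion by (intro nn_integral_cong) (auto simp: h_def indicator_def)
  also have "\<dots> < \<infinity>" using hint by (simp add: integrable_iff_bounded)
  finally obtain H where H: "holomorphic_in H \<Omega>"
    "\<And>\<xi>. \<xi> \<in> \<Omega> \<Longrightarrow> B \<xi> z ^ N \<noteq> 0 \<Longrightarrow> H \<xi> = p \<xi> * B \<xi> z / B \<xi> z ^ N"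
    using L2_quotient_extends[OF open_\<Omega> connected_\<Omega> holomorphic_in_power[OF gh] z _ holomorphic_in_mult[OF p(1) gh]]
      Kz by auto
  have Hh: "H \<xi> = h \<xi>" if "\<xi> \<in> \<Omega>" "B \<xi> z \<noteq> 0" for \<xi>
    using H(2)[OF that(1)] that(2) by (simp add: h_def)
  have "(\<lambda>\<xi>. indicator \<Omega> \<xi> *\<^sub>R (cmod (H \<xi>))\<^sup>2) \<in> borel_measurable borel"
    by (intro borel_measurable_continuous_on_indicator continuous_intros holomorphic_in_continuous_on[OF H(1)]) auto
  then have Hm: "(\<lambda>\<xi>. indicator \<Omega> \<xi> *\<^sub>R (cmod (H \<xi>))\<^sup>2) \<in> borel_measurable lebesgue"
    by (simp add: measurable_completion)
  have ae: "AE \<xi> in lebesgue. indicator \<Omega> \<xi> * (cmod (h \<xi>))\<^sup>2 = indicator \<Omega> \<xi> *\<^sub>R (cmod (H \<xi>))\<^sup>2"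
    using AE_kernel_nonzero[OF z] by eventually_elim (auto simp: indicator_def Hh)
  have "integrable lebesgue (\<lambda>\<xi>. indicator \<Omega> \<xi> *\<^sub>R (cmod (H \<xi>))\<^sup>2)"
    using hint by (rule integrable_cong_AE[THEN iffD1, rotated -1])
      (use ae Hm borel_measurable_integrable[OF hint] in auto)
  then have "H \<in> bergman_space \<Omega>" using H(1) by (simp add: bergman_space_def set_integrable_def)
  moreover have "m \<xi> = H \<xi> / B \<xi> z" if "\<xi> \<in> \<Omega>" "B \<xi> z \<noteq> 0" for \<xi>
    using p(2)[OF that] Hh[OF that] that by (simp add: h_def)
  ultimately show ?thesis using that by blast
qed

text \<open>Multiplying \<open>H \<xi> / B \<xi> z\<close> by the density leaves
  \<open>H \<xi> * cnj (B \<xi> z) / K z\<close>, to which the reproducing property applies. The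
  logarithmic derivative in the conjugate score trades \<open>cnj (B \<xi> z)\<close> for a
  derivative of the kernel, and the differentiated property applies.\<close>

lemma quotient_mean:
  assumes z: "z \<in> \<Omega>" and H: "H \<in> bergman_space \<Omega>"
  shows "integrable (bergman_model \<Omega> B z) (\<lambda>\<xi>. H \<xi> / B \<xi> z)"
    and "(LINT \<xi>|bergman_model \<Omega> B z. H \<xi> / B \<xi> z) = H z / B z z"
    and "integrable (bergman_model \<Omega> B z) (\<lambda>\<xi>. H \<xi> / B \<xi> z * cnj (score z v \<xi>))"
    and "(LINT \<xi>|bergman_model \<Omega> B z. H \<xi> / B \<xi> z * cnj (score z v \<xi>)) = rpart v (\<lambda>\<xi>. H \<xi> / B \<xi> z) z"
proof -
  let ?M = "bergman_model \<Omega> B z"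
  have Hh: "holomorphic_in H \<Omega>" using H by (simp add: bergman_space_def)
  note gh = kernel_holomorphic[OF z]
  have Kz: "K z > 0" "B z z = of_real (K z)" using K_pos[OF z] kernel_norm_sq(2)[OF z] by auto
  have Hm: "H \<in> borel_measurable (lebesgue_on \<Omega>)"
    by (rule continuous_measurable[OF holomorphic_in_continuous_on[OF Hh]])
  have gm: "(\<lambda>\<xi>. B \<xi> z) \<in> borel_measurable (lebesgue_on \<Omega>)"
    by (rule continuous_measurable[OF holomorphic_in_continuous_on[OF gh]])
  have cgm: "(\<lambda>\<xi>. cnj (B \<xi> z)) \<in> borel_measurable (lebesgue_on \<Omega>)"
    by (intro continuous_measurable continuous_on_cnj holomorphic_in_continuous_on[OF gh])
  note [measurable] = Hm gm
  have m: "(\<lambda>\<xi>. H \<xi> / B \<xi> z) \<in> borel_measurable (lebesgue_on \<Omega>)" by measurable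
  have P: "bergman_P B z \<xi> *\<^sub>R (H \<xi> / B \<xi> z) = H \<xi> * cnj (B \<xi> z) / of_real (K z)" if "\<xi> \<in> \<Omega>" for \<xi>
  proof -
    have "of_real ((cmod (B \<xi> z))\<^sup>2) = B \<xi> z * cnj (B \<xi> z)" by (simp only: complex_norm_square)
    then show ?thesis by (simp add: bergman_P_eq[OF z that] scaleR_conv_of_real)
  qed
  note i = bergman_space_mult_cnj_integrable[OF open_\<Omega> H kernel_in_space[OF z]]
  then have "set_integrable lebesgue \<Omega> (\<lambda>\<xi>. H \<xi> * cnj (B \<xi> z) / of_real (K z))" by simp
  then have "set_integrable lebesgue \<Omega> (\<lambda>\<xi>. bergman_P B z \<xi> *\<^sub>R (H \<xi> / B \<xi> z))"
    by (rule set_integrable_cong[THEN iffD2, rotated -1]) (auto simp: P)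
  then show "integrable ?M (\<lambda>\<xi>. H \<xi> / B \<xi> z)" using model_integral(2)[OF z m] by simp
  have "(LINT \<xi>|?M. H \<xi> / B \<xi> z) = (LINT \<xi>:\<Omega>|lebesgue. H \<xi> * cnj (B \<xi> z) / of_real (K z))"
    unfolding model_integral(1)[OF z m] by (rule set_lebesgue_integral_cong) (auto simp: P)
  also have "\<dots> = H z / B z z" using reproducing[OF z H] Kz by simp
  finally show "(LINT \<xi>|?M. H \<xi> / B \<xi> z) = H z / B z z" .
  define R where "R \<xi> = rpart (vjoin v 0) G (vjoin z (vcnj \<xi>))" for \<xi>
  \<comment> \<open>The normalising part of the score. It equals the logarithmic derivative of
    B(.,z) at \<open>z\<close>, so the two terms combine into the quotient rule.\<close>
  define c where "c = F (vjoin v 0) (vjoin z (vcnj z))"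
  have c: "c = rpart v (\<lambda>\<xi>. B \<xi> z) z / of_real (K z)"
    using Kz by (simp add: c_def F_def rpart_G_left z)
  have "continuous_on \<Omega> R"
  proof (rule continuous_on_eq)
    show "continuous_on \<Omega> (\<lambda>\<xi>. rpart v (\<lambda>w. B w (snd (z, \<xi>))) (fst (z, \<xi>)))"
      by (rule continuous_on_compose2[OF kernel_rpart_continuous[of v], of \<Omega> "\<lambda>\<xi>. (z, \<xi>)"])
        (use z in \<open>auto intro!: continuous_on_Pair continuous_on_const continuous_on_id\<close>)
  qed (use z in \<open>simp add: R_def rpart_G_left\<close>)
  then have Rm: "R \<in> borel_measurable (lebesgue_on \<Omega>)" by (rule continuous_measurable)
  define \<phi> where "\<phi> \<xi> = H \<xi> / B \<xi> z * (R \<xi> / cnj (B \<xi> z) - c)" for \<xi>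
  have \<phi>m: "\<phi> \<in> borel_measurable (lebesgue_on \<Omega>)" unfolding \<phi>_def[abs_def]
    by (intro borel_measurable_times borel_measurable_divide borel_measurable_diff borel_measurable_const Hm gm cgm Rm)
  have \<phi>_eq: "H \<xi> / B \<xi> z * cnj (score z v \<xi>) = \<phi> \<xi>" if "\<xi> \<in> \<Omega>" "B \<xi> z \<noteq> 0" for \<xi>
    using cnj_score[OF z that] kernel_hermitian[OF z that(1)] by (simp add: \<phi>_def F_def R_def c_def)
  define \<psi> where "\<psi> \<xi> = (H \<xi> * R \<xi> - c * (H \<xi> * cnj (B \<xi> z))) / of_real (K z)" for \<xi>
  have P2: "bergman_P B z \<xi> *\<^sub>R \<phi> \<xi> = \<psi> \<xi>" if "\<xi> \<in> \<Omega>" "B \<xi> z \<noteq> 0" for \<xi>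
  proof -
    have "of_real ((cmod (B \<xi> z))\<^sup>2) = B \<xi> z * cnj (B \<xi> z)" by (simp only: complex_norm_square)
    then have "bergman_P B z \<xi> *\<^sub>R \<phi> \<xi> = (B \<xi> z * cnj (B \<xi> z) / of_real (K z)) * \<phi> \<xi>"
      by (simp add: bergman_P_eq[OF z that(1)] scaleR_conv_of_real)
    also have "\<dots> = \<psi> \<xi>"
    proof -
      have *: "(b * b' / k) * (h / b * (r / b' - c)) = (h * r - c * (h * b')) / k"
        if "b \<noteq> 0" "b' \<noteq> 0" for b b' k h r :: complex
        using that by (cases "k = 0") (simp_all add: field_simps)
      show ?thesis unfolding \<phi>_def \<psi>_def by (rule *) (use that(2) in auto)
    qed
    finally show ?thesis .
  qed
  note rd = reproducing_derivative[OF z H, of v, folded R_def]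
  have ci: "set_integrable lebesgue \<Omega> (\<lambda>\<xi>. c * (H \<xi> * cnj (B \<xi> z)))" using i by simp
  have \<psi>i: "set_integrable lebesgue \<Omega> \<psi>"
    unfolding \<psi>_def[abs_def] using set_integral_diff(1)[OF rd(1) ci] by simp
  have \<psi>v: "(LINT \<xi>:\<Omega>|lebesgue. \<psi> \<xi>) = (rpart v H z - c * H z) / of_real (K z)"
    unfolding \<psi>_def using set_integral_diff(2)[OF rd(1) ci] rd(2) reproducing[OF z H] by simp
  have ae: "AE \<xi> in lebesgue. indicator \<Omega> \<xi> *\<^sub>R (bergman_P B z \<xi> *\<^sub>R \<phi> \<xi>) = indicator \<Omega> \<xi> *\<^sub>R \<psi> \<xi>"
    using AE_kernel_nonzero[OF z] by eventually_elim (auto simp: indicator_def P2)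
  have mm: "(\<lambda>\<xi>. indicator \<Omega> \<xi> *\<^sub>R (bergman_P B z \<xi> *\<^sub>R \<phi> \<xi>)) \<in> borel_measurable lebesgue"
  proof -
    have "(\<lambda>\<xi>. bergman_P B z \<xi> *\<^sub>R \<phi> \<xi>) \<in> borel_measurable (lebesgue_on \<Omega>)"
      using bergman_P_measurable[OF z] \<phi>m by measurable
    then show ?thesis by (simp add: borel_measurable_restrict_space_iff)
  qed
  have "set_integrable lebesgue \<Omega> (\<lambda>\<xi>. bergman_P B z \<xi> *\<^sub>R \<phi> \<xi>)"
    unfolding set_integrable_def
    using \<psi>i[unfolded set_integrable_def] by (rule integrable_cong_AE[THEN iffD2, rotated -1])
      (use ae mm borel_measurable_integrable[OF \<psi>i[unfolded set_integrable_def]] in auto)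
  then have \<phi>i: "integrable ?M \<phi>" using model_integral(2)[OF z \<phi>m] by simp
  have "integral\<^sup>L ?M \<phi> = (LINT \<xi>:\<Omega>|lebesgue. \<psi> \<xi>)"
    unfolding model_integral(1)[OF z \<phi>m] set_lebesgue_integral_def
    by (rule integral_cong_AE) (use ae mm borel_measurable_integrable[OF \<psi>i[unfolded set_integrable_def]] in auto)
  also have "\<dots> = rpart v (\<lambda>\<xi>. H \<xi> / B \<xi> z) z"
    using \<psi>v Kz by (simp add: rpart_divide[OF Hh gh z] c field_simps)
  finally have \<phi>v: "integral\<^sup>L ?M \<phi> = rpart v (\<lambda>\<xi>. H \<xi> / B \<xi> z) z" .
  note mc = model_cong[OF z _ \<phi>i, of "\<lambda>\<xi>. H \<xi> / B \<xi> z * cnj (score z v \<xi>)"]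
  show "integrable ?M (\<lambda>\<xi>. H \<xi> / B \<xi> z * cnj (score z v \<xi>))" using mc(1) \<phi>_eq by simp
  show "(LINT \<xi>|?M. H \<xi> / B \<xi> z * cnj (score z v \<xi>)) = rpart v (\<lambda>\<xi>. H \<xi> / B \<xi> z) z"
    using mc(2) \<phi>_eq \<phi>v by simp
qed

text \<open>The moments of \<open>m\<close> are those of its regular representative. Value and
  derivative at \<open>z\<close> itself also agree, since the kernel is nonzero in a neighbourhood
  of \<open>z\<close>.\<close>

lemma mero_mean:
  assumes z: "z \<in> \<Omega>" and m: "mero z m"
    and int: "integrable (bergman_model \<Omega> B z) (\<lambda>\<xi>. m \<xi> * cnj (m \<xi>))"
  shows "integrable (bergman_model \<Omega> B z) m"
    and "integral\<^sup>L (bergman_model \<Omega> B z) m = m z"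
    and "integrable (bergman_model \<Omega> B z) (\<lambda>\<xi>. m \<xi> * cnj (score z v \<xi>))"
    and "(LINT \<xi>|bergman_model \<Omega> B z. m \<xi> * cnj (score z v \<xi>)) = rpart v m z"
proof -
  let ?M = "bergman_model \<Omega> B z"
  obtain H where H: "H \<in> bergman_space \<Omega>" and mH: "\<And>\<xi>. \<xi> \<in> \<Omega> \<Longrightarrow> B \<xi> z \<noteq> 0 \<Longrightarrow> m \<xi> = H \<xi> / B \<xi> z"
    using mero_extension[OF assms] by blast
  have zz: "B z z \<noteq> 0" using K_pos[OF z] by (auto simp: K_def)
  note q = quotient_mean(1,2)[OF z H] quotient_mean(3,4)[OF z H, of v]
  have c1: "integrable ?M m" "integral\<^sup>L ?M m = (LINT \<xi>|?M. H \<xi> / B \<xi> z)"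
    by (rule model_cong[OF z _ q(1)], simp add: mH)+
  then show "integrable ?M m" "integral\<^sup>L ?M m = m z" using q(2) mH[OF z zz] by simp_all
  have c2: "integrable ?M (\<lambda>\<xi>. m \<xi> * cnj (score z v \<xi>))"
    "(LINT \<xi>|?M. m \<xi> * cnj (score z v \<xi>)) = (LINT \<xi>|?M. H \<xi> / B \<xi> z * cnj (score z v \<xi>))"
    by (rule model_cong[OF z _ q(3)], simp add: mH)+
  then show "integrable ?M (\<lambda>\<xi>. m \<xi> * cnj (score z v \<xi>))" by simp
  let ?S = "\<Omega> \<inter> (\<lambda>\<xi>. B \<xi> z) -` (- {0})"
  have "open ?S"
    by (rule continuous_open_preimage[OF holomorphic_in_continuous_on[OF kernel_holomorphic[OF z]] open_\<Omega>
          open_Compl[OF closed_singleton]])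
  then have "rpart v m z = rpart v (\<lambda>\<xi>. H \<xi> / B \<xi> z) z"
    by (rule rpart_cong) (use z zz mH in auto)
  then show "(LINT \<xi>|?M. m \<xi> * cnj (score z v \<xi>)) = rpart v m z" using c2(2) q(4) by simp
qed

end

section \<open>Derivatives of the log-likelihood\<close>

lemma ln_norm_sq_has_derivative:
  fixes f :: "'a::real_normed_vector \<Rightarrow> complex"
  assumes "(f has_derivative D) (at z)" "f z \<noteq> 0"
  shows "((\<lambda>z. ln ((cmod (f z))\<^sup>2)) has_derivative (\<lambda>v. 2 * Re (D v / f z))) (at z)"
proof -
  have eq: "(cmod w)\<^sup>2 = Re (w * cnj w)" for w
    unfolding complex_norm_square[symmetric] by simp
  have "((\<lambda>z. Re (f z * cnj (f z))) has_derivative (\<lambda>v. Re (f z * cnj (D v) + D v * cnj (f z)))) (at z)"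
    by (intro bounded_linear.has_derivative[OF bounded_linear_Re] has_derivative_mult
        bounded_linear.has_derivative[OF bounded_linear_cnj] assms(1))
  then have "((\<lambda>z. (cmod (f z))\<^sup>2) has_derivative (\<lambda>v. Re (f z * cnj (D v) + D v * cnj (f z)))) (at z)"
    by (simp only: eq)
  from has_derivative_ln[OF _ this]
  have "((\<lambda>z. ln ((cmod (f z))\<^sup>2)) has_derivative
      (\<lambda>v. Re (f z * cnj (D v) + D v * cnj (f z)) * inverse ((cmod (f z))\<^sup>2))) (at z)"
    using assms(2) by simp
  moreover have "Re (f z * cnj d + d * cnj (f z)) * inverse ((cmod (f z))\<^sup>2) = 2 * Re (d / f z)" for d
  proof -
    have "d / f z = (d * cnj (f z)) / of_real ((cmod (f z))\<^sup>2)"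
      using assms(2) by (simp only: complex_norm_square) simp
    then have "Re (d / f z) = Re (d * cnj (f z)) / (cmod (f z))\<^sup>2" by (simp only: Re_divide_of_real)
    moreover have "Re (f z * cnj d) = Re (d * cnj (f z))" by simp
    ultimately show ?thesis by (simp add: divide_inverse algebra_simps)
  qed
  ultimately show ?thesis by simp
qed

lemma of_real_has_derivative:
  assumes "(f has_derivative D) (at z)"
  shows "((\<lambda>z. complex_of_real (f z)) has_derivative (\<lambda>v. of_real (D v))) (at z)"
  by (rule bounded_linear.has_derivative[OF bounded_linear_of_real assms])

lemma wirt_eqI:
  assumes "(f has_derivative D) (at z)"
  shows "wirt k f z = (D (axis k 1) - \<i> * D (axis k \<i>)) / 2"
    and "wirt_bar k f z = (D (axis k 1) + \<i> * D (axis k \<i>)) / 2"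
  by (simp_all add: wirt_def wirt_bar_def rpart_eqI[OF assms])

lemma wirt_cong:
  assumes "open S" "z \<in> S" "\<And>x. x \<in> S \<Longrightarrow> f x = g x"
  shows "wirt k f z = wirt k g z" "wirt_bar k f z = wirt_bar k g z"
  by (simp_all add: wirt_def wirt_bar_def rpart_cong[OF assms])

lemma wirt_bar_cnj:
  assumes "(f has_derivative D) (at z)"
  shows "wirt_bar k (\<lambda>z. cnj (f z)) z = cnj (wirt k f z)"
  by (simp add: wirt_eqI[OF assms] wirt_eqI[OF bounded_linear.has_derivative[OF bounded_linear_cnj assms]])

lemma axis_\<i>: "axis k \<i> = \<i> *s axis k 1"
  by (auto simp: axis_def vec_eq_iff)

section \<open>Multi-indices of order one and two\<close>

definition unit_index :: "'n \<Rightarrow> 'n \<Rightarrow> nat" where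
  "unit_index a k = (if k = a then 1 else 0)"

lemma foldr_pow_zero: "\<forall>k\<in>set ks. \<Gamma> k = 0 \<Longrightarrow> foldr (\<lambda>k. d k ^^ \<Gamma> k) ks f = f"
  by (induction ks) auto

lemma foldr_pow_unit:
  assumes "distinct ks" "a \<in> set ks" "\<forall>k\<in>set ks. \<Gamma> k = unit_index a k"
  shows "foldr (\<lambda>k. d k ^^ \<Gamma> k) ks f = d a f"
  using assms
proof (induction ks)
  case (Cons x xs)
  show ?case
  proof (cases "x = a")
    case True
    then have "foldr (\<lambda>k. d k ^^ \<Gamma> k) xs f = f"
      using Cons.prems by (intro foldr_pow_zero) (auto simp: unit_index_def)
    then show ?thesis using True Cons.prems by (simp add: unit_index_def)
  next
    case False
    then show ?thesis using Cons by (simp add: unit_index_def)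
  qed
qed simp

text \<open>Which coordinate is processed first depends on the list, so only one of two orders can
  be asserted. It is chosen before \<open>d\<close> and \<open>f\<close>, hence is the same for
  holomorphic and antiholomorphic derivatives.\<close>

lemma foldr_pow_two:
  assumes "distinct ks" "a \<in> set ks" "b \<in> set ks"
  shows "\<exists>x y. (x, y) \<in> {(a, b), (b, a)} \<and>
    (\<forall>(d :: 'n \<Rightarrow> 'b \<Rightarrow> 'b) f. foldr (\<lambda>k. d k ^^ (unit_index a k + unit_index b k)) ks f = d x (d y f))"
  using assms
proof (induction ks)
  case (Cons u us)
  let ?\<Gamma> = "\<lambda>k. unit_index a k + unit_index b k"
  consider "u = a" "u = b" | "u = a" "u \<noteq> b" | "u \<noteq> a" "u = b" | "u \<noteq> a" "u \<noteq> b" by blast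
  then show ?case
  proof cases
    case 1
    then have eq: "foldr (\<lambda>k. d k ^^ ?\<Gamma> k) us f = f" for d :: "'n \<Rightarrow> 'b \<Rightarrow> 'b" and f
      using Cons.prems by (intro foldr_pow_zero) (auto simp: unit_index_def)
    have "?\<Gamma> u = Suc (Suc 0)" using 1 by (simp add: unit_index_def)
    then have "foldr (\<lambda>k. d k ^^ ?\<Gamma> k) (u # us) f = d a (d b f)" for d :: "'n \<Rightarrow> 'b \<Rightarrow> 'b" and f
      using 1 eq[of d f] by simp
    then show ?thesis by auto
  next
    case 2
    then have "foldr (\<lambda>k. d k ^^ ?\<Gamma> k) us f = d b f" for d :: "'n \<Rightarrow> 'b \<Rightarrow> 'b" and f
      using Cons.prems by (intro foldr_pow_unit) (auto simp: unit_index_def)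
    then show ?thesis using 2 by (intro exI[of _ a] exI[of _ b]) (simp add: unit_index_def)
  next
    case 3
    then have "foldr (\<lambda>k. d k ^^ ?\<Gamma> k) us f = d a f" for d :: "'n \<Rightarrow> 'b \<Rightarrow> 'b" and f
      using Cons.prems by (intro foldr_pow_unit) (auto simp: unit_index_def)
    then show ?thesis using 3 by (intro exI[of _ b] exI[of _ a]) (simp add: unit_index_def)
  next
    case 4
    then have "distinct us" "a \<in> set us" "b \<in> set us" using Cons.prems by auto
    from Cons.IH[OF this] obtain x y where xy: "(x, y) \<in> {(a, b), (b, a)}"
      "\<forall>(d :: 'n \<Rightarrow> 'b \<Rightarrow> 'b) f. foldr (\<lambda>k. d k ^^ ?\<Gamma> k) us f = d x (d y f)" by (elim exE conjE)
    have "?\<Gamma> u = 0" using 4 by (simp add: unit_index_def)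
    then have "foldr (\<lambda>k. d k ^^ ?\<Gamma> k) (u # us) f = d x (d y f)" for d :: "'n \<Rightarrow> 'b \<Rightarrow> 'b" and f
      using xy(2)[rule_format, of d f] by simp
    then show ?thesis using xy(1) by (intro exI[of _ x] exI[of _ y] conjI allI)
  qed
qed simp

lemma some_index_list:
  "distinct (SOME ks. distinct ks \<and> set ks = (UNIV :: 'n::finite set)) \<and>
   set (SOME ks. distinct ks \<and> set ks = (UNIV :: 'n set)) = UNIV"
proof (rule someI_ex)
  show "\<exists>ks. distinct ks \<and> set ks = (UNIV :: 'n set)"
    using finite_distinct_list[OF finite_class.finite_UNIV] by blast
qed

lemma multi_deriv_unit: "multi_deriv d (unit_index a) f = d a f"
  unfolding multi_deriv_def by (rule foldr_pow_unit) (simp_all add: some_index_list)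

lemma multi_deriv_two:
  obtains x y where "(x, y) \<in> {(a, b), (b, a)}"
    "\<And>d f. multi_deriv d (\<lambda>k. unit_index a k + unit_index b k) f = d x (d y f)"
proof -
  define ks where "ks = (SOME ks. distinct ks \<and> set ks = (UNIV :: 'a set))"
  have ks: "distinct ks" "set ks = UNIV" using some_index_list[where 'n='a] by (auto simp: ks_def)
  have "a \<in> set ks" "b \<in> set ks" by (simp_all add: ks)
  from foldr_pow_two[OF ks(1) this] obtain x y where xy: "(x, y) \<in> {(a, b), (b, a)}"
    "\<forall>(d :: 'a \<Rightarrow> (complex ^ 'a \<Rightarrow> complex) \<Rightarrow> complex ^ 'a \<Rightarrow> complex) f.
      foldr (\<lambda>k. d k ^^ (unit_index a k + unit_index b k)) ks f = d x (d y f)" by (elim exE conjE)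
  show ?thesis
    by (rule that[OF xy(1)]) (simp only: multi_deriv_def ks_def[symmetric] xy(2)[rule_format])
qed

lemma multi_order_unit: "multi_order (unit_index a) = 1"
    "multi_order (\<lambda>k. unit_index a k + unit_index b k) = 2"
  by (simp_all add: multi_order_def unit_index_def sum.distrib)

lemma unit_index_nonzero: "unit_index a \<noteq> (\<lambda>_. 0)" "(\<lambda>k. unit_index a k + unit_index b k) \<noteq> (\<lambda>_. 0)"
  by (auto simp: unit_index_def fun_eq_iff)

section \<open>First and second parameter derivatives in terms of the scores\<close>

context bergman
begin

lemma kernel_nonzero_sym: "z \<in> \<Omega> \<Longrightarrow> \<xi> \<in> \<Omega> \<Longrightarrow> B z \<xi> = 0 \<longleftrightarrow> B \<xi> z = 0"
  using kernel_hermitian[of z \<xi>] by auto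

text \<open>On the diagonal the two slots of \<open>G\<close> contribute conjugate derivatives,
  hence twice a real part.\<close>

lemma ln_K_has_derivative:
  assumes z: "z \<in> \<Omega>"
  shows "((\<lambda>z. ln (K z)) has_derivative (\<lambda>v. 2 * Re (F (vjoin v 0) (vjoin z (vcnj z))))) (at z)"
proof -
  let ?d = "vjoin z (vcnj z)"
  note D = holomorphic_in_has_derivative[OF G_holomorphic vjoin_\<Omega>2[OF z z]]
  have "((\<lambda>z. G (vjoin z (vcnj z))) has_derivative (\<lambda>v. rpart (vjoin v (vcnj v)) G ?d)) (at z)"
    by (rule has_derivative_compose[OF bounded_linear_imp_has_derivative[OF bounded_linear_vjoin_cnj] D])
  then have "((\<lambda>z. K z) has_derivative (\<lambda>v. Re (rpart (vjoin v (vcnj v)) G ?d))) (at z)"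
    unfolding K_def G_vjoin by (rule bounded_linear.has_derivative[OF bounded_linear_Re])
  from has_derivative_ln[OF _ this] have
    "((\<lambda>z. ln (K z)) has_derivative (\<lambda>v. Re (rpart (vjoin v (vcnj v)) G ?d) * inverse (K z))) (at z)"
    using K_pos[OF z] by simp
  moreover have "Re (rpart (vjoin v (vcnj v)) G ?d) * inverse (K z) = 2 * Re (F (vjoin v 0) ?d)" for v
  proof -
    have e1: "rpart (vjoin v (vcnj v)) G ?d = rpart (vjoin v 0) G ?d + rpart (vjoin 0 (vcnj v)) G ?d"
      using rpart_add_direction[OF D, of "vjoin v 0" "vjoin 0 (vcnj v)"] by (simp add: vjoin_arith)
    have e2: "rpart (vjoin 0 (vcnj v)) G ?d = cnj (rpart (vjoin v 0) G ?d)"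
      using rpart_G_vswap[OF vjoin_\<Omega>2[OF z z], of "vjoin v 0"] by (simp add: vcnj_arith)
    have e3: "F (vjoin v 0) ?d = rpart (vjoin v 0) G ?d / of_real (K z)"
      by (simp add: F_def kernel_norm_sq(2)[OF z])
    show ?thesis unfolding e1 e2 e3 Re_divide_of_real by (simp add: divide_inverse)
  qed
  ultimately show ?thesis by simp
qed

lemma open_kernel_nonzero:
  assumes "\<xi> \<in> \<Omega>"
  shows "open {z \<in> \<Omega>. B z \<xi> \<noteq> 0}"
proof -
  have "{z \<in> \<Omega>. B z \<xi> \<noteq> 0} = \<Omega> \<inter> (\<lambda>z. B z \<xi>) -` (- {0})" by auto
  then show ?thesis
    using continuous_open_preimage[OF holomorphic_in_continuous_on[OF kernel_holomorphic[OF assms]] open_\<Omega>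
          open_Compl[OF closed_singleton]] by (simp only:)
qed

lemma loglik_has_derivative:
  assumes z: "z \<in> \<Omega>" and \<xi>: "\<xi> \<in> \<Omega>" and nz: "B \<xi> z \<noteq> 0"
  shows "(loglik B \<xi> has_derivative (\<lambda>v. 2 * Re (score z v \<xi>))) (at z)"
proof (rule has_derivative_transform_within_open)
  let ?S = "{z \<in> \<Omega>. B z \<xi> \<noteq> 0}"
  show "open ?S" by (rule open_kernel_nonzero[OF \<xi>])
  show "z \<in> ?S" using z \<xi> nz kernel_nonzero_sym by auto
  have "((\<lambda>z. ln ((cmod (B z \<xi>))\<^sup>2)) has_derivative (\<lambda>v. 2 * Re (rpart v (\<lambda>z. B z \<xi>) z / B z \<xi>))) (at z)"
    using z \<xi> nz kernel_nonzero_sym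
    by (intro ln_norm_sq_has_derivative holomorphic_in_has_derivative[OF kernel_holomorphic[OF \<xi>]]) auto
  from has_derivative_diff[OF this ln_K_has_derivative[OF z]]
  have "((\<lambda>z. ln ((cmod (B z \<xi>))\<^sup>2) - ln (K z)) has_derivative (\<lambda>v. 2 * Re (cnj (score z v \<xi>)))) (at z)"
    unfolding cnj_score[OF z \<xi> nz] by (simp add: F_def rpart_G_left z \<xi> algebra_simps)
  then show "((\<lambda>z. ln ((cmod (B z \<xi>))\<^sup>2) - ln (K z)) has_derivative (\<lambda>v. 2 * Re (score z v \<xi>))) (at z)" by simp
  fix x assume x: "x \<in> ?S"
  then show "ln ((cmod (B x \<xi>))\<^sup>2) - ln (K x) = loglik B \<xi> x"
    using K_pos[of x] by (simp add: loglik_def bergman_P_def K_def ln_div)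
qed

lemma rpart_loglik:
  assumes "z \<in> \<Omega>" "\<xi> \<in> \<Omega>" "B \<xi> z \<noteq> 0"
  shows "rpart v (loglik B \<xi>) z = 2 * Re (score z v \<xi>)"
  by (rule rpart_eqI[OF loglik_has_derivative[OF assms]])

lemma vjoin_cnj_scalar: "vjoin 0 (vcnj (c *s v)) = cnj c *s vjoin 0 (vcnj v)"
  by (simp add: vjoin_arith vcnj_arith)

lemma score_scalar_mult:
  assumes "z \<in> \<Omega>" "\<xi> \<in> \<Omega>" "B \<xi> z \<noteq> 0"
  shows "score z (c *s v) \<xi> = cnj c * score z v \<xi>"
  unfolding score_def vjoin_cnj_scalar
  using assms vjoin_\<Omega>2'[OF assms(2,1)] diag_\<Omega>2'[OF assms(1)]
  by (simp add: F_scalar_mult algebra_simps)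

lemma dscore_scalar_mult:
  assumes "z \<in> \<Omega>" "\<xi> \<in> \<Omega>" "B \<xi> z \<noteq> 0"
  shows "dscore z (c *s v) (c' *s w) \<xi> = cnj c * cnj c' * dscore z v w \<xi>"
  unfolding dscore_def vjoin_cnj_scalar
  using assms vjoin_\<Omega>2'[OF assms(2,1)] by (simp add: rpart_F_scalar_mult)

lemma dscore_commute:
  assumes "z \<in> \<Omega>" "\<xi> \<in> \<Omega>" "B \<xi> z \<noteq> 0"
  shows "dscore z v w \<xi> = dscore z w v \<xi>"
  unfolding dscore_def using assms vjoin_\<Omega>2'[OF assms(2,1)] by (intro rpart_F_commute) simp

text \<open>The score is antilinear in its direction, so each Wirtinger combination of
  \<open>axis k 1\<close> and \<open>axis k \<i>\<close> cancels one of the two conjugate halves of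
  \<open>2 * Re (score z v \<xi>)\<close>.\<close>

lemma wirt_loglik:
  assumes "z \<in> \<Omega>" "\<xi> \<in> \<Omega>" "B \<xi> z \<noteq> 0"
  shows "wirt k (\<lambda>z. of_real (loglik B \<xi> z)) z = cnj (score z (axis k 1) \<xi>)"
    and "wirt_bar k (\<lambda>z. of_real (loglik B \<xi> z)) z = score z (axis k 1) \<xi>"
  unfolding wirt_eqI[OF of_real_has_derivative[OF loglik_has_derivative[OF assms]]]
    axis_\<i>[of k] score_scalar_mult[OF assms]
  by (simp_all add: complex_eq_iff)

text \<open>The correction \<open>\<delta>\<close> comes from \<open>B z z\<close> and therefore does not depend on \<open>\<xi>\<close>.\<close>

lemma cnj_score_has_derivative:
  assumes "z \<in> \<Omega>"
  obtains \<delta> where "\<And>\<xi>. \<xi> \<in> \<Omega> \<Longrightarrow> B \<xi> z \<noteq> 0 \<Longrightarrow>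
    ((\<lambda>z. cnj (score z w \<xi>)) has_derivative (\<lambda>v. cnj (dscore z v w \<xi>) - \<delta> v)) (at z)"
proof -
  let ?F = "F (vjoin w 0)"
  define \<delta> where "\<delta> v = rpart (vjoin v 0) ?F (vjoin z (vcnj z)) + rpart (vjoin 0 (vcnj v)) ?F (vjoin z (vcnj z))" for v
  have "((\<lambda>z. cnj (score z w \<xi>)) has_derivative (\<lambda>v. cnj (dscore z v w \<xi>) - \<delta> v)) (at z)"
    if \<xi>: "\<xi> \<in> \<Omega>" and nz: "B \<xi> z \<noteq> 0" for \<xi>
  proof (rule has_derivative_transform_within_open)
    let ?S = "{z \<in> \<Omega>. B z \<xi> \<noteq> 0}"
    show "open ?S" by (rule open_kernel_nonzero[OF \<xi>])
    show zS: "z \<in> ?S" using assms \<xi> nz kernel_nonzero_sym by auto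
    have in': "vjoin z (vcnj \<xi>) \<in> \<Omega>2'" using zS vjoin_\<Omega>2'[OF assms \<xi>] by simp
    show "((\<lambda>z. ?F (vjoin z (vcnj \<xi>)) - ?F (vjoin z (vcnj z))) has_derivative
        (\<lambda>v. cnj (dscore z v w \<xi>) - \<delta> v)) (at z)"
      unfolding cnj_dscore[OF assms \<xi> nz] \<delta>_def
      by (rule has_derivative_diff[OF left_has_derivative[OF F_holomorphic(1) in']
            diag_has_derivative[OF F_holomorphic(1) assms]])
    fix x assume "x \<in> ?S"
    then show "?F (vjoin x (vcnj \<xi>)) - ?F (vjoin x (vcnj x)) = cnj (score x w \<xi>)"
      using cnj_score[of x \<xi> w] kernel_nonzero_sym[of x \<xi>] \<xi> by auto
  qed
  then show ?thesis using that by blast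
qed

lemma rpart_rpart_loglik:
  assumes "z \<in> \<Omega>"
  obtains c where "\<And>\<xi>. \<xi> \<in> \<Omega> \<Longrightarrow> B \<xi> z \<noteq> 0 \<Longrightarrow>
    rpart i (rpart j (loglik B \<xi>)) z = 2 * Re (dscore z i j \<xi>) - c"
proof -
  obtain \<delta> where \<delta>: "\<And>\<xi>. \<xi> \<in> \<Omega> \<Longrightarrow> B \<xi> z \<noteq> 0 \<Longrightarrow>
    ((\<lambda>z. cnj (score z j \<xi>)) has_derivative (\<lambda>v. cnj (dscore z v j \<xi>) - \<delta> v)) (at z)"
    using cnj_score_has_derivative[OF assms] by blast
  have "rpart i (rpart j (loglik B \<xi>)) z = 2 * Re (dscore z i j \<xi>) - 2 * Re (\<delta> i)"
    if \<xi>: "\<xi> \<in> \<Omega>" and nz: "B \<xi> z \<noteq> 0" for \<xi>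
  proof -
    have "rpart i (rpart j (loglik B \<xi>)) z = rpart i (\<lambda>z. 2 * Re (cnj (score z j \<xi>))) z"
    proof (rule rpart_cong[OF open_kernel_nonzero[OF \<xi>]])
      show "z \<in> {z \<in> \<Omega>. B z \<xi> \<noteq> 0}" using assms \<xi> nz kernel_nonzero_sym by auto
      fix x assume "x \<in> {z \<in> \<Omega>. B z \<xi> \<noteq> 0}"
      then show "rpart j (loglik B \<xi>) x = 2 * Re (cnj (score x j \<xi>))"
        using rpart_loglik[of x \<xi> j] kernel_nonzero_sym[of x \<xi>] \<xi> by auto
    qed
    also have "\<dots> = 2 * Re (cnj (dscore z i j \<xi>) - \<delta> i)"
    proof (rule rpart_eqI)
      show "((\<lambda>z. 2 * Re (cnj (score z j \<xi>))) has_derivative (\<lambda>v. 2 * Re (cnj (dscore z v j \<xi>) - \<delta> v))) (at z)"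
        by (rule has_derivative_mult_right[OF bounded_linear.has_derivative[OF bounded_linear_Re \<delta>[OF \<xi> nz]]])
    qed
    finally show ?thesis by simp
  qed
  then show ?thesis using that by blast
qed

text \<open>Links the second derivatives in the condition to \<open>dscore\<close>. One constant
  serves both types up to conjugation, because the log-likelihood is real.\<close>

lemma wirt_wirt_loglik:
  assumes "z \<in> \<Omega>"
  obtains \<kappa> where "\<And>\<xi>. \<xi> \<in> \<Omega> \<Longrightarrow> B \<xi> z \<noteq> 0 \<Longrightarrow>
      wirt a (wirt b (\<lambda>z. of_real (loglik B \<xi> z))) z = cnj (dscore z (axis a 1) (axis b 1) \<xi> - \<kappa>) \<and>
      wirt_bar a (wirt_bar b (\<lambda>z. of_real (loglik B \<xi> z))) z = dscore z (axis a 1) (axis b 1) \<xi> - \<kappa>"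
proof -
  obtain \<delta> where \<delta>: "\<And>\<xi>. \<xi> \<in> \<Omega> \<Longrightarrow> B \<xi> z \<noteq> 0 \<Longrightarrow>
    ((\<lambda>z. cnj (score z (axis b 1) \<xi>)) has_derivative (\<lambda>v. cnj (dscore z v (axis b 1) \<xi>) - \<delta> v)) (at z)"
    using cnj_score_has_derivative[OF assms] by blast
  define \<kappa> where "\<kappa> = cnj ((\<delta> (axis a 1) - \<i> * \<delta> (axis a \<i>)) / 2)"
  have "wirt a (wirt b (\<lambda>z. of_real (loglik B \<xi> z))) z = cnj (dscore z (axis a 1) (axis b 1) \<xi> - \<kappa>) \<and>
      wirt_bar a (wirt_bar b (\<lambda>z. of_real (loglik B \<xi> z))) z = dscore z (axis a 1) (axis b 1) \<xi> - \<kappa>"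
    if \<xi>: "\<xi> \<in> \<Omega>" and nz: "B \<xi> z \<noteq> 0" for \<xi>
  proof -
    let ?S = "{z \<in> \<Omega>. B z \<xi> \<noteq> 0}" and ?s = "\<lambda>z. cnj (score z (axis b 1) \<xi>)"
    note S = open_kernel_nonzero[OF \<xi>]
    have zS: "z \<in> ?S" using assms \<xi> nz kernel_nonzero_sym by auto
    have ev: "wirt b (\<lambda>z. of_real (loglik B \<xi> z)) x = ?s x"
      "wirt_bar b (\<lambda>z. of_real (loglik B \<xi> z)) x = cnj (?s x)" if "x \<in> ?S" for x
      using wirt_loglik[of x \<xi> b] kernel_nonzero_sym[of x \<xi>] \<xi> that by auto
    have "dscore z (axis a \<i>) (axis b 1) \<xi> = cnj \<i> * dscore z (axis a 1) (axis b 1) \<xi>"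
      using dscore_scalar_mult[OF assms \<xi> nz, of \<i> "axis a 1" 1 "axis b 1"] by (simp add: axis_\<i>[of a])
    then have w: "wirt a ?s z = cnj (dscore z (axis a 1) (axis b 1) \<xi> - \<kappa>)"
      unfolding wirt_eqI(1)[OF \<delta>[OF \<xi> nz]] \<kappa>_def by (simp add: field_simps)
    have "wirt a (wirt b (\<lambda>z. of_real (loglik B \<xi> z))) z = wirt a ?s z"
      by (rule wirt_cong(1)[OF S zS ev(1)])
    moreover have "wirt_bar a (wirt_bar b (\<lambda>z. of_real (loglik B \<xi> z))) z = wirt_bar a (\<lambda>z. cnj (?s z)) z"
      by (rule wirt_cong(2)[OF S zS ev(2)])
    moreover have "wirt_bar a (\<lambda>z. cnj (?s z)) z = cnj (wirt a ?s z)"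
      by (rule wirt_bar_cnj[OF \<delta>[OF \<xi> nz]])
    ultimately show ?thesis using w by simp
  qed
  then show ?thesis using that by blast
qed

end

text \<open>What the condition says about Wirtinger derivatives transfers to real coordinate
  directions by scaling with \<open>c\<close>.\<close>

lemma Basis_vec_complexE:
  assumes "i \<in> (Basis :: (complex ^ 'n) set)"
  obtains a c where "i = c *s axis a 1" "cmod c = 1"
proof -
  obtain a c where "i = axis a c" "c \<in> (Basis :: complex set)"
    using assms by (auto simp: Basis_vec_def)
  moreover have "axis a c = c *s axis a 1" by (auto simp: axis_def vec_eq_iff)
  ultimately show ?thesis using that[of c a] by (auto simp: Basis_complex_def)
qed

section \<open>Moments under Condition C6\<close>

context bergman
begin

abbreviation M where "M z \<equiv> bergman_model \<Omega> B z"

text \<open>Taking one list of multi-indices for both the holomorphic and the antiholomorphic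
  factors turns the integrand into a squared modulus; order 6 is twice the order 3 of
  \<open>m\<close>.\<close>

lemma condition_C_integrable:
  assumes C: "condition_C 6 \<Omega> B" and z: "z \<in> \<Omega>"
    and \<Gamma>s: "\<forall>\<Gamma>\<in>set \<Gamma>s. \<Gamma> \<noteq> (\<lambda>_. 0)" "(\<Sum>\<Gamma>\<leftarrow>\<Gamma>s. multi_order \<Gamma>) \<le> 3"
    and m: "\<And>\<xi>. \<xi> \<in> \<Omega> \<Longrightarrow> B \<xi> z \<noteq> 0 \<Longrightarrow>
      (\<Prod>\<Gamma>\<leftarrow>\<Gamma>s. multi_deriv wirt \<Gamma> (\<lambda>z. of_real (loglik B \<xi> z)) z) = cnj (m \<xi>) \<and>
      (\<Prod>\<Gamma>\<leftarrow>\<Gamma>s. multi_deriv wirt_bar \<Gamma> (\<lambda>z. of_real (loglik B \<xi> z)) z) = m \<xi>"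
  shows "integrable (M z) (\<lambda>\<xi>. m \<xi> * cnj (m \<xi>))"
proof (rule model_cong(1)[OF z])
  show "integrable (M z) (condition_C_integrand B \<Gamma>s \<Gamma>s z)"
    using C \<Gamma>s z unfolding condition_C_def by (auto dest!: spec[of _ \<Gamma>s])
  fix \<xi> assume "\<xi> \<in> \<Omega>" "B \<xi> z \<noteq> 0"
  from m[OF this] show "condition_C_integrand B \<Gamma>s \<Gamma>s z \<xi> = m \<xi> * cnj (m \<xi>)"
    by (simp add: condition_C_integrand_def)
qed

lemma integrable_square_scale:
  fixes m m' :: "complex ^ 'n \<Rightarrow> complex"
  assumes z: "z \<in> \<Omega>" and i: "integrable (M z) (\<lambda>\<xi>. m \<xi> * cnj (m \<xi>))"
    and eq: "\<And>\<xi>. \<xi> \<in> \<Omega> \<Longrightarrow> B \<xi> z \<noteq> 0 \<Longrightarrow> m' \<xi> = c * m \<xi>"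
  shows "integrable (M z) (\<lambda>\<xi>. m' \<xi> * cnj (m' \<xi>))"
proof (rule model_cong(1)[OF z])
  show "integrable (M z) (\<lambda>\<xi>. (c * cnj c) * (m \<xi> * cnj (m \<xi>)))"
    by (rule integrable_mult_right[OF i])
qed (use eq in \<open>simp add: mult_ac\<close>)

context
  fixes z assumes C: "condition_C 6 \<Omega> B" and z: "z \<in> \<Omega>"
begin

abbreviation "e k \<equiv> (axis k 1 :: complex ^ 'n)"

lemma int_unit_scores:
  "integrable (M z) (\<lambda>\<xi>. score z (e a) \<xi> * cnj (score z (e a) \<xi>))"
  "integrable (M z) (\<lambda>\<xi>. (score z (e a) \<xi> * score z (e b) \<xi>) * cnj (score z (e a) \<xi> * score z (e b) \<xi>))"
  "integrable (M z) (\<lambda>\<xi>. (score z (e a) \<xi> * score z (e b) \<xi> * score z (e c) \<xi>) *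
     cnj (score z (e a) \<xi> * score z (e b) \<xi> * score z (e c) \<xi>))"
proof -
  note s = unit_index_nonzero multi_order_unit multi_deriv_unit wirt_loglik[OF z]
  show "integrable (M z) (\<lambda>\<xi>. score z (e a) \<xi> * cnj (score z (e a) \<xi>))"
    by (rule condition_C_integrable[OF C z, of "[unit_index a]"]) (simp_all add: s)
  show "integrable (M z) (\<lambda>\<xi>. (score z (e a) \<xi> * score z (e b) \<xi>) * cnj (score z (e a) \<xi> * score z (e b) \<xi>))"
    by (rule condition_C_integrable[OF C z, of "[unit_index a, unit_index b]"]) (simp_all add: s)
  show "integrable (M z) (\<lambda>\<xi>. (score z (e a) \<xi> * score z (e b) \<xi> * score z (e c) \<xi>) *
     cnj (score z (e a) \<xi> * score z (e b) \<xi> * score z (e c) \<xi>))"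
    by (rule condition_C_integrable[OF C z, of "[unit_index a, unit_index b, unit_index c]"]) (simp_all add: s)
qed

text \<open>The condition controls only full second derivatives, so integrability is available for
  the shifted \<open>dscore\<close>. The shift is fixed before \<open>c\<close> because both
  statements are later used for one and the same function.\<close>

lemma int_unit_dscores:
  obtains \<kappa> where
    "integrable (M z) (\<lambda>\<xi>. (dscore z (e a) (e b) \<xi> - \<kappa>) * cnj (dscore z (e a) (e b) \<xi> - \<kappa>))"
    "\<And>c. integrable (M z) (\<lambda>\<xi>. ((dscore z (e a) (e b) \<xi> - \<kappa>) * score z (e c) \<xi>) *
      cnj ((dscore z (e a) (e b) \<xi> - \<kappa>) * score z (e c) \<xi>))"
proof -
  let ?\<Gamma> = "\<lambda>k. unit_index a k + unit_index b k"
  obtain x y where xy: "(x, y) \<in> {(a, b), (b, a)}" and D: "\<And>d f. multi_deriv d ?\<Gamma> f = d x (d y f)"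
    using multi_deriv_two[of a b] by blast
  obtain \<kappa> where \<kappa>: "\<And>\<xi>. \<xi> \<in> \<Omega> \<Longrightarrow> B \<xi> z \<noteq> 0 \<Longrightarrow>
      wirt x (wirt y (\<lambda>z. of_real (loglik B \<xi> z))) z = cnj (dscore z (e x) (e y) \<xi> - \<kappa>) \<and>
      wirt_bar x (wirt_bar y (\<lambda>z. of_real (loglik B \<xi> z))) z = dscore z (e x) (e y) \<xi> - \<kappa>"
    using wirt_wirt_loglik[OF z, of x y] by blast
  have xy': "dscore z (e x) (e y) \<xi> = dscore z (e a) (e b) \<xi>" if "\<xi> \<in> \<Omega>" "B \<xi> z \<noteq> 0" for \<xi>
    using xy dscore_commute[OF z that] by auto
  note s = unit_index_nonzero multi_order_unit multi_deriv_unit wirt_loglik[OF z] D \<kappa> xy'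
  have "integrable (M z) (\<lambda>\<xi>. (dscore z (e a) (e b) \<xi> - \<kappa>) * cnj (dscore z (e a) (e b) \<xi> - \<kappa>))"
    by (rule condition_C_integrable[OF C z, of "[?\<Gamma>]"]) (simp_all add: s)
  moreover have "integrable (M z) (\<lambda>\<xi>. ((dscore z (e a) (e b) \<xi> - \<kappa>) * score z (e c) \<xi>) *
      cnj ((dscore z (e a) (e b) \<xi> - \<kappa>) * score z (e c) \<xi>))" for c
    by (rule condition_C_integrable[OF C z, of "[?\<Gamma>, unit_index c]"]) (simp_all add: s)
  ultimately show ?thesis using that by blast
qed

lemma int_scores:
  assumes "i \<in> Basis" "j \<in> Basis" "k \<in> Basis"
  shows "integrable (M z) (\<lambda>\<xi>. score z i \<xi> * cnj (score z i \<xi>))"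
    "integrable (M z) (\<lambda>\<xi>. (score z i \<xi> * score z j \<xi>) * cnj (score z i \<xi> * score z j \<xi>))"
    "integrable (M z) (\<lambda>\<xi>. (score z i \<xi> * score z j \<xi> * score z k \<xi>) *
     cnj (score z i \<xi> * score z j \<xi> * score z k \<xi>))"
proof -
  obtain a s where i: "i = s *s e a" using Basis_vec_complexE[OF assms(1)] by metis
  obtain b t where j: "j = t *s e b" using Basis_vec_complexE[OF assms(2)] by metis
  obtain c u where k: "k = u *s e c" using Basis_vec_complexE[OF assms(3)] by metis
  note eqs = i j k score_scalar_mult[OF z]
  show "integrable (M z) (\<lambda>\<xi>. score z i \<xi> * cnj (score z i \<xi>))"
    by (rule integrable_square_scale[OF z int_unit_scores(1)[of a], where c="cnj s"]) (simp add: eqs)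
  show "integrable (M z) (\<lambda>\<xi>. (score z i \<xi> * score z j \<xi>) * cnj (score z i \<xi> * score z j \<xi>))"
    by (rule integrable_square_scale[OF z int_unit_scores(2)[of a b], where c="cnj s * cnj t"]) (simp add: eqs)
  show "integrable (M z) (\<lambda>\<xi>. (score z i \<xi> * score z j \<xi> * score z k \<xi>) *
     cnj (score z i \<xi> * score z j \<xi> * score z k \<xi>))"
    by (rule integrable_square_scale[OF z int_unit_scores(3)[of a b c], where c="cnj s * cnj t * cnj u"])
      (simp add: eqs)
qed

lemma int_dscores:
  assumes "i \<in> Basis" "j \<in> Basis"
  obtains \<kappa> where
    "integrable (M z) (\<lambda>\<xi>. (dscore z i j \<xi> - \<kappa>) * cnj (dscore z i j \<xi> - \<kappa>))"
    "\<And>k. k \<in> Basis \<Longrightarrow> integrable (M z) (\<lambda>\<xi>. ((dscore z i j \<xi> - \<kappa>) * score z k \<xi>) *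
      cnj ((dscore z i j \<xi> - \<kappa>) * score z k \<xi>))"
proof -
  obtain a s where i: "i = s *s e a" using Basis_vec_complexE[OF assms(1)] by metis
  obtain b t where j: "j = t *s e b" using Basis_vec_complexE[OF assms(2)] by metis
  obtain \<kappa> where \<kappa>:
    "integrable (M z) (\<lambda>\<xi>. (dscore z (e a) (e b) \<xi> - \<kappa>) * cnj (dscore z (e a) (e b) \<xi> - \<kappa>))"
    "\<And>c. integrable (M z) (\<lambda>\<xi>. ((dscore z (e a) (e b) \<xi> - \<kappa>) * score z (e c) \<xi>) *
      cnj ((dscore z (e a) (e b) \<xi> - \<kappa>) * score z (e c) \<xi>))"
    using int_unit_dscores by blast
  let ?\<kappa> = "cnj s * cnj t * \<kappa>"
  have "integrable (M z) (\<lambda>\<xi>. (dscore z i j \<xi> - ?\<kappa>) * cnj (dscore z i j \<xi> - ?\<kappa>))"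
    by (rule integrable_square_scale[OF z \<kappa>(1), where c="cnj s * cnj t"])
      (simp add: i j dscore_scalar_mult[OF z] right_diff_distrib)
  moreover have "integrable (M z) (\<lambda>\<xi>. ((dscore z i j \<xi> - ?\<kappa>) * score z k \<xi>) *
      cnj ((dscore z i j \<xi> - ?\<kappa>) * score z k \<xi>))" if k: "k \<in> Basis" for k
  proof -
    obtain c u where k: "k = u *s e c" using Basis_vec_complexE[OF k] by metis
    show ?thesis
      by (rule integrable_square_scale[OF z \<kappa>(2)[of c], where c="cnj s * cnj t * cnj u"])
        (simp add: i j k dscore_scalar_mult[OF z] score_scalar_mult[OF z] algebra_simps)
  qed
  ultimately show ?thesis using that by blast
qed

text \<open>Means are values at \<open>\<xi> = z\<close>, where the score vanishes, so products
  without conjugates have mean zero. A product of two scores vanishes to second order, hence so does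
  its derivative there, which settles the mixed third moment.\<close>

lemma score_moments:
  assumes i: "i \<in> Basis" and j: "j \<in> Basis" and k: "k \<in> Basis"
  shows "integrable (M z) (score z i)" "integral\<^sup>L (M z) (score z i) = 0"
    and "integrable (M z) (\<lambda>\<xi>. score z i \<xi> * score z j \<xi>)" "(LINT \<xi>|M z. score z i \<xi> * score z j \<xi>) = 0"
    and "integrable (M z) (\<lambda>\<xi>. score z i \<xi> * cnj (score z j \<xi>))"
      "(LINT \<xi>|M z. score z i \<xi> * cnj (score z j \<xi>)) = rpart j (score z i) z"
    and "integrable (M z) (\<lambda>\<xi>. score z i \<xi> * score z j \<xi> * score z k \<xi>)"
      "(LINT \<xi>|M z. score z i \<xi> * score z j \<xi> * score z k \<xi>) = 0"
    and "integrable (M z) (\<lambda>\<xi>. score z i \<xi> * score z j \<xi> * cnj (score z k \<xi>))"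
      "(LINT \<xi>|M z. score z i \<xi> * score z j \<xi> * cnj (score z k \<xi>)) = 0"
proof -
  note I = int_scores[OF i j k]
  note m1 = mero_score[OF z, of i] and m2 = mero_mult[OF mero_score[OF z, of i] mero_score[OF z, of j]]
  note m3 = mero_mult[OF m2 mero_score[OF z, of k]]
  note A = mero_mean(1,2)[OF z m1 I(1)] mero_mean(3,4)[OF z m1 I(1), of j]
  show "integrable (M z) (score z i)" "integral\<^sup>L (M z) (score z i) = 0"
    "integrable (M z) (\<lambda>\<xi>. score z i \<xi> * cnj (score z j \<xi>))"
    "(LINT \<xi>|M z. score z i \<xi> * cnj (score z j \<xi>)) = rpart j (score z i) z"
    using A by (simp_all add: score_base)
  note A = mero_mean(1,2)[OF z m2 I(2)] mero_mean(3,4)[OF z m2 I(2), of k]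
  have "rpart k (\<lambda>\<xi>. score z i \<xi> * score z j \<xi>) z = 0"
    using rpart_eqI[OF has_derivative_mult[OF score_has_derivative[OF z] score_has_derivative[OF z]], of k i j]
    by (simp add: score_base)
  then show "integrable (M z) (\<lambda>\<xi>. score z i \<xi> * score z j \<xi>)" "(LINT \<xi>|M z. score z i \<xi> * score z j \<xi>) = 0"
    "integrable (M z) (\<lambda>\<xi>. score z i \<xi> * score z j \<xi> * cnj (score z k \<xi>))"
    "(LINT \<xi>|M z. score z i \<xi> * score z j \<xi> * cnj (score z k \<xi>)) = 0"
    using A by (simp_all add: score_base)
  show "integrable (M z) (\<lambda>\<xi>. score z i \<xi> * score z j \<xi> * score z k \<xi>)"
      "(LINT \<xi>|M z. score z i \<xi> * score z j \<xi> * score z k \<xi>) = 0"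
    using mero_mean(1,2)[OF z m3 I(3)] by (simp_all add: score_base)
qed

lemma third_moment_loglik:
  assumes i: "i \<in> Basis" and j: "j \<in> Basis" and k: "k \<in> Basis"
  shows "integrable (M z) (\<lambda>\<xi>. rpart i (loglik B \<xi>) z * rpart j (loglik B \<xi>) z * rpart k (loglik B \<xi>) z)"
    and "amari_chentsov \<Omega> B z i j k = 0"
proof -
  let ?f = "\<lambda>\<xi>. rpart i (loglik B \<xi>) z * rpart j (loglik B \<xi>) z * rpart k (loglik B \<xi>) z"
  let ?a = "score z i" and ?b = "score z j" and ?c = "score z k"
  \<comment> \<open>Expanding the product of three factors of the form \<open>2 * Re\<close> gives
    eight terms in four conjugate pairs; one term represents each pair.\<close>
  let ?\<phi> = "\<lambda>\<xi>. 2 * (?a \<xi> * ?b \<xi> * ?c \<xi> + ?a \<xi> * ?b \<xi> * cnj (?c \<xi>) + ?a \<xi> * ?c \<xi> * cnj (?b \<xi>)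
      + ?b \<xi> * ?c \<xi> * cnj (?a \<xi>))"
  note m1 = score_moments(7-10)[OF i j k] and m2 = score_moments(9,10)[OF i k j]
    and m3 = score_moments(9,10)[OF j k i]
  have \<phi>: "integrable (M z) ?\<phi>" "integral\<^sup>L (M z) ?\<phi> = 0"
    using m1 m2 m3 by simp_all
  have eq: "?f \<xi> = Re (?\<phi> \<xi>)" if "\<xi> \<in> \<Omega>" "B \<xi> z \<noteq> 0" for \<xi>
    unfolding rpart_loglik[OF z that] by (simp add: algebra_simps)
  show "integrable (M z) ?f" by (rule expect_Re(1)[OF z \<phi>(1) eq])
  show "amari_chentsov \<Omega> B z i j k = 0"
    unfolding amari_chentsov_def using expect_Re(2)[OF z \<phi>(1) eq] \<phi>(2) by simp
qed

lemma second_moment_loglik: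
  assumes i: "i \<in> Basis" and j: "j \<in> Basis"
  shows "expect \<Omega> B z (\<lambda>\<xi>. rpart i (loglik B \<xi>) z * rpart j (loglik B \<xi>) z) = 2 * Re (rpart j (score z i) z)"
proof -
  let ?f = "\<lambda>\<xi>. rpart i (loglik B \<xi>) z * rpart j (loglik B \<xi>) z"
  let ?a = "score z i" and ?b = "score z j"
  let ?\<phi> = "\<lambda>\<xi>. 2 * (?a \<xi> * ?b \<xi> + ?a \<xi> * cnj (?b \<xi>))"
  note m = score_moments(3-6)[OF i j j]
  have \<phi>: "integrable (M z) ?\<phi>" "integral\<^sup>L (M z) ?\<phi> = 2 * rpart j (score z i) z"
    using m by simp_all
  have eq: "?f \<xi> = Re (?\<phi> \<xi>)" if "\<xi> \<in> \<Omega>" "B \<xi> z \<noteq> 0" for \<xi>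
    unfolding rpart_loglik[OF z that] by (simp add: algebra_simps)
  show ?thesis using expect_Re(2)[OF z \<phi>(1) eq] \<phi>(2) by simp
qed

text \<open>The second derivative is \<open>2 * Re (m \<xi>) + r\<close> with \<open>m\<close>
  square integrable and \<open>r\<close> constant. Against the score, \<open>r\<close> and the
  unconjugated product have mean zero; only \<open>m\<close> against the conjugate score survives
  and gives the derivative of \<open>m\<close> at \<open>z\<close>, where the shift by
  \<open>\<kappa>\<close> is invisible.\<close>

lemma christoffel_loglik:
  assumes i: "i \<in> Basis" and j: "j \<in> Basis" and k: "k \<in> Basis"
  shows "expect \<Omega> B z (\<lambda>\<xi>. rpart i (rpart j (loglik B \<xi>)) z * rpart k (loglik B \<xi>) z) =
    2 * Re (rpart k (dscore z i j) z)"
proof -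
  let ?f = "\<lambda>\<xi>. rpart i (rpart j (loglik B \<xi>)) z * rpart k (loglik B \<xi>) z"
  obtain c where c: "\<And>\<xi>. \<xi> \<in> \<Omega> \<Longrightarrow> B \<xi> z \<noteq> 0 \<Longrightarrow>
    rpart i (rpart j (loglik B \<xi>)) z = 2 * Re (dscore z i j \<xi>) - c"
    using rpart_rpart_loglik[OF z] by blast
  obtain \<kappa> where \<kappa>:
    "integrable (M z) (\<lambda>\<xi>. (dscore z i j \<xi> - \<kappa>) * cnj (dscore z i j \<xi> - \<kappa>))"
    "\<And>k. k \<in> Basis \<Longrightarrow> integrable (M z) (\<lambda>\<xi>. ((dscore z i j \<xi> - \<kappa>) * score z k \<xi>) *
      cnj ((dscore z i j \<xi> - \<kappa>) * score z k \<xi>))"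
    using int_dscores[OF i j] by blast
  define m where "m \<xi> = dscore z i j \<xi> - \<kappa>" for \<xi>
  have mm: "mero z m" unfolding m_def[abs_def] by (intro mero_diff[OF z] mero_dscore[OF z] mero_const)
  have I: "integrable (M z) (\<lambda>\<xi>. m \<xi> * cnj (m \<xi>))" using \<kappa>(1) by (simp add: m_def)
  have I': "integrable (M z) (\<lambda>\<xi>. (m \<xi> * score z k \<xi>) * cnj (m \<xi> * score z k \<xi>))"
    using \<kappa>(2)[OF k] by (simp add: m_def)
  note A = mero_mean(3,4)[OF z mm I, of k] and A' = mero_mean(1,2)[OF z mero_mult[OF mm mero_score[OF z]] I']
  have dm: "rpart k m z = rpart k (dscore z i j) z"
  proof -
    have D: "(dscore z i j has_derivative (\<lambda>k. rpart (vjoin k 0) (rpart (vjoin 0 (vcnj i)) (F (vjoin 0 (vcnj j)))) (vjoin z (vcnj z)))) (at z)"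
      unfolding dscore_def[abs_def] by (rule left_has_derivative[OF F_holomorphic(2) diag_\<Omega>2'[OF z]])
    show ?thesis
      using rpart_eqI[OF has_derivative_diff[OF D has_derivative_const[of \<kappa>]], of k] rpart_dscore[OF z, of k i j]
      by (simp add: m_def[abs_def])
  qed
  \<comment> \<open>The total part independent of \<open>\<xi>\<close> once \<open>dscore\<close>
    has been shifted by \<open>\<kappa>\<close>.\<close>
  define r where "r = 2 * Re \<kappa> - c"
  let ?s = "score z k"
  let ?\<phi> = "\<lambda>\<xi>. 2 * (m \<xi> * ?s \<xi> + m \<xi> * cnj (?s \<xi>) + of_real r * ?s \<xi>)"
  note S = score_moments(1,2)[OF k k k]
  have \<phi>: "integrable (M z) ?\<phi>" "integral\<^sup>L (M z) ?\<phi> = 2 * rpart k (dscore z i j) z"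
    using A A' S dm by (simp_all add: score_base)
  have eq: "?f \<xi> = Re (?\<phi> \<xi>)" if "\<xi> \<in> \<Omega>" "B \<xi> z \<noteq> 0" for \<xi>
    unfolding rpart_loglik[OF z that] c[OF that] by (simp add: m_def r_def algebra_simps)
  show ?thesis using expect_Re(2)[OF z \<phi>(1) eq] \<phi>(2) by simp
qed

end

end

section \<open>The metric and the connections\<close>

text \<open>\<open>\<sigma>\<close> is the identity or \<open>cnj\<close>, so one expansion serves
  both slots of a sesquilinear form.\<close>

lemma semilinear_expansion:
  fixes f :: "complex ^ 'n \<Rightarrow> complex"
  assumes add: "\<And>u v. f (u + v) = f u + f v" and scale: "\<And>c v. f (c *s v) = \<sigma> c * f v"
  shows "f u = (\<Sum>a\<in>UNIV. \<sigma> (u $ a) * f (axis a 1))"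
proof -
  have 0: "f 0 = 0" using add[of 0 0] by simp
  have "f (\<Sum>a\<in>A. g a) = (\<Sum>a\<in>A. f (g a))" if "finite A" for A :: "'n set" and g
    using that by induction (simp_all add: 0 add)
  then have "f (\<Sum>a\<in>UNIV. u $ a *s axis a 1) = (\<Sum>a\<in>UNIV. \<sigma> (u $ a) * f (axis a 1))"
    by (simp add: scale)
  then show ?thesis by (simp add: basis_expansion)
qed

text \<open>The coefficient map \<open>T\<close> is injective by definiteness, hence surjective by
  dimension. This gives existence and uniqueness of Christoffel vectors from their pairings with
  coordinate vectors.\<close>

lemma definite_form_represents:
  fixes \<beta> :: "'a::euclidean_space \<Rightarrow> 'a \<Rightarrow> real"
  assumes lin: "\<And>v. linear (\<lambda>u. \<beta> u v)" "\<And>u. linear (\<beta> u)" and def: "\<And>u. \<beta> u u = 0 \<Longrightarrow> u = 0"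
  shows "\<exists>c. \<forall>k\<in>Basis. \<beta> c k = \<phi> k"
    and "(\<And>k. k \<in> Basis \<Longrightarrow> \<beta> c k = \<beta> c' k) \<Longrightarrow> c = c'"
proof -
  have eq: "c = c'" if "\<And>k. k \<in> Basis \<Longrightarrow> \<beta> c k = \<beta> c' k" for c c'
  proof -
    have "\<beta> (c - c') k = 0" if "k \<in> Basis" for k
      using linear_diff[OF lin(1)] \<open>\<And>k. k \<in> Basis \<Longrightarrow> \<beta> c k = \<beta> c' k\<close>[OF that] by simp
    moreover have "\<beta> (c - c') (c - c') = (\<Sum>k\<in>Basis. ((c - c') \<bullet> k) * \<beta> (c - c') k)"
      using linear_sum[OF lin(2), of "c - c'" "\<lambda>k. ((c - c') \<bullet> k) *\<^sub>R k" Basis] linear_scale[OF lin(2)]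
      by (simp add: euclidean_representation)
    ultimately have "\<beta> (c - c') (c - c') = 0" by simp
    then show ?thesis using def by force
  qed
  then show "(\<And>k. k \<in> Basis \<Longrightarrow> \<beta> c k = \<beta> c' k) \<Longrightarrow> c = c'" by blast
  define T where "T c = (\<Sum>k\<in>Basis. \<beta> c k *\<^sub>R k)" for c
  have Tk: "T c \<bullet> k = \<beta> c k" if "k \<in> Basis" for c k
    using that by (simp add: T_def)
  have "linear T"
    unfolding T_def
    by (rule linearI) (simp_all add: linear_add[OF lin(1)] linear_scale[OF lin(1)] scaleR_left_distrib
        sum.distrib scaleR_sum_right)
  moreover have "inj T"
    by (rule injI, rule eq) (metis Tk)
  ultimately have "surj T" using linear_injective_imp_surjective by blast
  then obtain c where "T c = (\<Sum>k\<in>Basis. \<phi> k *\<^sub>R k)" by (metis surjD)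
  then have "\<forall>k\<in>Basis. \<beta> c k = \<phi> k" using Tk by (metis inner_sum_left_Basis)
  then show "\<exists>c. \<forall>k\<in>Basis. \<beta> c k = \<phi> k" by blast
qed

section \<open>Metric coefficients, their derivatives, and the connections\<close>

context bergman
begin

text \<open>The sesquilinear form whose matrix is the mixed complex Hessian of log B(z,z), linear in
  \<open>u\<close> and antilinear in \<open>v\<close>; the real metric is twice its real
  part.\<close>

definition herm where
  "herm z u v = rpart (vjoin u 0) (F (vjoin 0 (vcnj v))) (vjoin z (vcnj z))"

text \<open>The holomorphic derivative in direction \<open>k\<close> of the metric coefficient
  belonging to \<open>i\<close> and \<open>j\<close>, a third derivative of the potential log
  B(z,z).\<close>

definition tau where
  "tau z k i j = rpart (vjoin k 0) (rpart (vjoin i 0) (F (vjoin 0 (vcnj j)))) (vjoin z (vcnj z))"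

lemma herm_left: assumes "z \<in> \<Omega>"
  shows "herm z (u + u') v = herm z u v + herm z u' v" "herm z (c *s u) v = c * herm z u v"
proof -
  have "vjoin (u + u') 0 = vjoin u 0 + vjoin u' 0" "vjoin (c *s u) 0 = c *s vjoin u 0"
    by (simp_all add: vjoin_arith)
  then show "herm z (u + u') v = herm z u v + herm z u' v" "herm z (c *s u) v = c * herm z u v"
    by (simp_all add: herm_def rpart_F_add rpart_F_scalar_mult diag_\<Omega>2'[OF assms])
qed

lemma herm_right: assumes "z \<in> \<Omega>"
  shows "herm z u (v + v') = herm z u v + herm z u v'" "herm z u (c *s v) = cnj c * herm z u v"
proof -
  have "vjoin 0 (vcnj (v + v')) = vjoin 0 (vcnj v) + vjoin 0 (vcnj v')"
    by (simp add: vjoin_arith vcnj_arith)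
  then show "herm z u (v + v') = herm z u v + herm z u v'" "herm z u (c *s v) = cnj c * herm z u v"
    by (simp_all add: herm_def rpart_F_add rpart_F_scalar_mult vjoin_cnj_scalar diag_\<Omega>2'[OF assms])
qed

text \<open>Diagonal points are fixed by \<open>vswap\<close>, so conjugation merely exchanges the
  two directions of a mixed derivative.\<close>

lemma cnj_herm: assumes "z \<in> \<Omega>" shows "cnj (herm z u v) = herm z v u"
  using rpart_F_vswap[OF diag_\<Omega>2'[OF assms], of "vjoin u 0" "vjoin 0 (vcnj v)"]
    rpart_F_commute[OF diag_\<Omega>2'[OF assms], of "vjoin 0 (vcnj u)" "vjoin v 0"]
  by (simp add: herm_def vcnj_arith)

lemma Re_herm_commute: "z \<in> \<Omega> \<Longrightarrow> Re (herm z u v) = Re (herm z v u)"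
  using arg_cong[OF cnj_herm[of z u v], of Re] by simp

lemma linear_herm:
  assumes "z \<in> \<Omega>"
  shows "linear (\<lambda>u. 2 * Re (herm z u v))" "linear (\<lambda>v. 2 * Re (herm z u v))"
  by (auto intro!: linearI simp: herm_left[OF assms] herm_right[OF assms] scaleR_eq_scalar_mult algebra_simps)

text \<open>The Wirtinger derivative keeps the complex linear part of the diagonal derivative and
  cancels the antilinear one.\<close>

lemma wirt_diag:
  assumes \<Phi>: "holomorphic_in \<Phi> \<Omega>2'" and z: "z \<in> \<Omega>"
  shows "wirt k (\<lambda>z. \<Phi> (vjoin z (vcnj z))) z = rpart (vjoin (axis k 1) 0) \<Phi> (vjoin z (vcnj z))"
proof -
  note s = rpart_scalar_mult[OF \<Phi> diag_\<Omega>2'[OF z]]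
  have 1: "rpart (vjoin (axis k \<i>) 0) \<Phi> (vjoin z (vcnj z)) = \<i> * rpart (vjoin (axis k 1) 0) \<Phi> (vjoin z (vcnj z))"
    using s[of \<i> "vjoin (axis k 1) 0"] by (simp add: vjoin_arith axis_\<i>[of k])
  have 2: "rpart (vjoin 0 (vcnj (axis k \<i>))) \<Phi> (vjoin z (vcnj z)) = cnj \<i> * rpart (vjoin 0 (vcnj (axis k 1))) \<Phi> (vjoin z (vcnj z))"
    unfolding axis_\<i>[of k] vjoin_cnj_scalar by (rule s)
  show ?thesis
    unfolding wirt_eqI(1)[OF diag_has_derivative[OF assms]] 1 2 by (simp add: algebra_simps)
qed

lemma wirt_bar_ln_K:
  assumes z: "z \<in> \<Omega>"
  shows "wirt_bar k (\<lambda>z. of_real (ln (Re (B z z)))) z = F (vjoin 0 (vcnj (axis k 1))) (vjoin z (vcnj z))"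
proof -
  let ?d = "vjoin z (vcnj z)"
  have 1: "F (vjoin (axis k \<i>) 0) ?d = \<i> * F (vjoin (axis k 1) 0) ?d"
    using F_scalar_mult[OF diag_\<Omega>2'[OF z], of \<i> "vjoin (axis k 1) 0"] by (simp add: vjoin_arith axis_\<i>[of k])
  have 2: "F (vjoin 0 (vcnj (axis k 1))) ?d = cnj (F (vjoin (axis k 1) 0) ?d)"
    using F_vswap[OF diag_\<Omega>2'[OF z], of "vjoin (axis k 1) 0"] by (simp add: vcnj_arith)
  show ?thesis
    unfolding wirt_eqI(2)[OF of_real_has_derivative[OF ln_K_has_derivative[OF z, unfolded K_def]]] 1 2
    by (simp add: complex_eq_iff)
qed

lemma bergman_metric_eq:
  assumes z: "z \<in> \<Omega>"
  shows "bergman_metric B z u v = 2 * Re (herm z u v)"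
proof -
  have c: "bergman_coeff B z a b = herm z (axis a 1) (axis b 1)" for a b
  proof -
    have "bergman_coeff B z a b = wirt a (\<lambda>z. F (vjoin 0 (vcnj (axis b 1))) (vjoin z (vcnj z))) z"
      unfolding bergman_coeff_def by (rule wirt_cong(1)[OF open_\<Omega> z wirt_bar_ln_K])
    also have "\<dots> = herm z (axis a 1) (axis b 1)"
      unfolding herm_def by (rule wirt_diag[OF F_holomorphic(1) z])
    finally show ?thesis .
  qed
  have "herm z u v = (\<Sum>a\<in>UNIV. u $ a * herm z (axis a 1) v)"
    by (rule semilinear_expansion[of "\<lambda>u. herm z u v" "\<lambda>c. c"]) (simp_all add: herm_left[OF z])
  also have "\<dots> = (\<Sum>a\<in>UNIV. u $ a * (\<Sum>b\<in>UNIV. cnj (v $ b) * herm z (axis a 1) (axis b 1)))"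
    by (subst semilinear_expansion[of "\<lambda>v. herm z _ v" cnj v]) (simp_all add: herm_right[OF z])
  also have "\<dots> = (\<Sum>a\<in>UNIV. \<Sum>b\<in>UNIV. bergman_coeff B z a b * u $ a * cnj (v $ b))"
    by (simp add: c sum_distrib_left mult_ac)
  finally show ?thesis by (simp add: bergman_metric_def)
qed

text \<open>On coordinate vectors this is the second moment of the score; real bilinearity extends
  it to all vectors.\<close>

lemma fisher_metric_eq:
  assumes C: "condition_C 6 \<Omega> B" and z: "z \<in> \<Omega>"
  shows "fisher_metric \<Omega> B z u v = 2 * Re (herm z u v)"
proof -
  let ?\<beta> = "\<lambda>u v. 2 * Re (herm z u v)"
  have e: "expect \<Omega> B z (\<lambda>\<xi>. rpart i (loglik B \<xi>) z * rpart j (loglik B \<xi>) z) = ?\<beta> i j"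
    if "i \<in> Basis" "j \<in> Basis" for i j
    using second_moment_loglik[OF C z that] arg_cong[OF cnj_herm[OF z, of i j], of Re]
    by (simp add: rpart_score[OF z] herm_def)
  have "?\<beta> u v = ?\<beta> (\<Sum>i\<in>Basis. (u \<bullet> i) *\<^sub>R i) v" by (simp add: euclidean_representation)
  also have "\<dots> = (\<Sum>i\<in>Basis. (u \<bullet> i) *\<^sub>R ?\<beta> i v)"
    using linear_sum[OF linear_herm(1)[OF z, of v], of "\<lambda>i. (u \<bullet> i) *\<^sub>R i" Basis]
      linear_scale[OF linear_herm(1)[OF z, of v]] by simp
  also have "\<dots> = (\<Sum>i\<in>Basis. (u \<bullet> i) *\<^sub>R (\<Sum>j\<in>Basis. (v \<bullet> j) *\<^sub>R ?\<beta> i j))"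
  proof (rule sum.cong[OF refl])
    fix i :: "complex ^ 'n"
    have "?\<beta> i v = ?\<beta> i (\<Sum>j\<in>Basis. (v \<bullet> j) *\<^sub>R j)" by (simp add: euclidean_representation)
    also have "\<dots> = (\<Sum>j\<in>Basis. (v \<bullet> j) *\<^sub>R ?\<beta> i j)"
      using linear_sum[OF linear_herm(2)[OF z, of i], of "\<lambda>j. (v \<bullet> j) *\<^sub>R j" Basis]
        linear_scale[OF linear_herm(2)[OF z, of i]] by simp
    finally show "(u \<bullet> i) *\<^sub>R ?\<beta> i v = (u \<bullet> i) *\<^sub>R (\<Sum>j\<in>Basis. (v \<bullet> j) *\<^sub>R ?\<beta> i j)" by simp
  qed
  also have "\<dots> = fisher_metric \<Omega> B z u v"
    unfolding fisher_metric_def by (simp add: e sum_distrib_left mult.assoc)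
  finally show ?thesis by simp
qed

lemma score_expansion:
  assumes "z \<in> \<Omega>" "\<xi> \<in> \<Omega>" "B \<xi> z \<noteq> 0"
  shows "score z u \<xi> = (\<Sum>a\<in>UNIV. cnj (u $ a) * score z (axis a 1) \<xi>)"
proof (rule semilinear_expansion[of "\<lambda>u. score z u \<xi>" cnj])
  have F_add: "F (v + w) x = F v x + F w x" if "x \<in> \<Omega>2'" for v w x
    using rpart_add_direction[OF holomorphic_in_has_derivative[OF G_holomorphic'(1) that]]
    by (simp add: F_def add_divide_distrib)
  fix u v :: "complex ^ 'n"
  have "vjoin 0 (vcnj (u + v)) = vjoin 0 (vcnj u) + vjoin 0 (vcnj v)"
    by (simp add: vjoin_arith vcnj_arith)
  then show "score z (u + v) \<xi> = score z u \<xi> + score z v \<xi>"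
    using assms vjoin_\<Omega>2'[OF assms(2,1)] diag_\<Omega>2'[OF assms(1)] by (simp add: score_def F_add)
qed (rule score_scalar_mult[OF assms])

text \<open>If \<open>u\<close> is null for the metric then the score in direction \<open>u\<close> vanishes almost everywhere, and the
  reproducing property gives \<open>\<partial>\<^sub>u (f / B(\<cdot>,z)) = 0\<close> at \<open>z\<close> for every \<open>f\<close> in the Bergman space. Taking
  \<open>f\<close> to be \<open>1\<close> and the coordinates yields \<open>u = 0\<close>.\<close>

lemma herm_definite:
  assumes C: "condition_C 6 \<Omega> B" and z: "z \<in> \<Omega>" and 0: "2 * Re (herm z u u) = 0"
  shows "u = 0"
proof -
  let ?s = "\<lambda>a. score z (axis a 1)"
  have I1: "integrable (M z) (\<lambda>\<xi>. ?s a \<xi> * cnj (?s b \<xi>))" for a b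
    by (rule mero_mean(3)[OF z mero_score[OF z] int_unit_scores(1)[OF C z]])
  have I: "integrable (M z) (\<lambda>\<xi>. score z u \<xi> * cnj (score z u \<xi>))"
  proof (rule model_cong(1)[OF z])
    \<comment> \<open>The condition concerns coordinate directions only. A general \<open>u\<close>
      is expanded, and the mixed terms are integrable because \<open>mero_mean\<close> pairs a
      square integrable score with any conjugate score.\<close>
    show "integrable (M z) (\<lambda>\<xi>. \<Sum>a\<in>UNIV. \<Sum>b\<in>UNIV. (cnj (u $ a) * u $ b) * (?s a \<xi> * cnj (?s b \<xi>)))"
      by (intro Bochner_Integration.integrable_sum integrable_mult_right I1)
    fix \<xi> assume "\<xi> \<in> \<Omega>" "B \<xi> z \<noteq> 0"
    then have "score z u \<xi> * cnj (score z u \<xi>) =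
        (\<Sum>a\<in>UNIV. cnj (u $ a) * ?s a \<xi>) * (\<Sum>b\<in>UNIV. u $ b * cnj (?s b \<xi>))"
      using score_expansion[OF z, of \<xi> u] by simp
    also have "\<dots> = (\<Sum>a\<in>UNIV. \<Sum>b\<in>UNIV. (cnj (u $ a) * u $ b) * (?s a \<xi> * cnj (?s b \<xi>)))"
      unfolding sum_product by (intro sum.cong refl) (simp add: mult_ac)
    finally show "(\<Sum>a\<in>UNIV. \<Sum>b\<in>UNIV. (cnj (u $ a) * u $ b) * (?s a \<xi> * cnj (?s b \<xi>))) = score z u \<xi> * cnj (score z u \<xi>)" ..
  qed
  have sq: "score z u \<xi> * cnj (score z u \<xi>) = of_real ((cmod (score z u \<xi>))\<^sup>2)" for \<xi>
    by (simp only: complex_norm_square)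
  have Ir: "integrable (M z) (\<lambda>\<xi>. (cmod (score z u \<xi>))\<^sup>2)"
    using integrable_Re[OF I] unfolding sq by simp
  have "(LINT \<xi>|M z. score z u \<xi> * cnj (score z u \<xi>)) = herm z u u"
    using mero_mean(4)[OF z mero_score[OF z] I, of u] by (simp add: rpart_score[OF z] herm_def)
  then have "(LINT \<xi>|M z. (cmod (score z u \<xi>))\<^sup>2) = Re (herm z u u)"
    unfolding sq by (metis Re_complex_of_real integral_complex_of_real)
  then have "(LINT \<xi>|M z. (cmod (score z u \<xi>))\<^sup>2) = 0" using 0 by simp
  then have ae: "AE \<xi> in M z. score z u \<xi> = 0"
    using integral_nonneg_eq_0_iff_AE[OF Ir] by simp
  have Bz: "B z z \<noteq> 0" using K_pos[OF z] by (auto simp: K_def)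
  have zero: "rpart u f z * B z z - f z * rpart u (\<lambda>\<xi>. B \<xi> z) z = 0" if f: "f \<in> bergman_space \<Omega>" for f
  proof -
    have fh: "holomorphic_in f \<Omega>" using f by (simp add: bergman_space_def)
    have "(LINT \<xi>|M z. f \<xi> / B \<xi> z * cnj (score z u \<xi>)) = 0"
      by (rule integral_eq_zero_AE) (use ae in eventually_elim, simp)
    then have "rpart u (\<lambda>\<xi>. f \<xi> / B \<xi> z) z = 0" using quotient_mean(4)[OF z f, of u] by simp
    then show ?thesis using Bz by (simp add: rpart_divide[OF fh kernel_holomorphic[OF z] z Bz])
  qed
  have "rpart u (\<lambda>\<xi>. B \<xi> z) z = 0" using zero[OF one_in_space] Bz by (simp add: rpart_const)
  moreover have "rpart u (\<lambda>\<xi>. \<xi> $ k) z = u $ k" for k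
    by (rule rpart_eqI[OF bounded_linear_imp_has_derivative[OF bounded_linear_vec_nth]])
  ultimately have "u $ k = 0" for k using zero[OF component_in_space[of k]] Bz by simp
  then show ?thesis by (simp add: vec_eq_iff)
qed

lemma herm_eqI:
  assumes "condition_C 6 \<Omega> B" "z \<in> \<Omega>" "\<And>k. k \<in> Basis \<Longrightarrow> 2 * Re (herm z c k) = 2 * Re (herm z c' k)"
  shows "c = c'"
  by (rule definite_form_represents(2)[OF linear_herm[OF assms(2)]])
    (rule herm_definite[OF assms(1,2)] assms(3); assumption)+

text \<open>The Kaehler identity, here as symmetry of the third derivatives of a potential.\<close>

lemma tau_commute: "z \<in> \<Omega> \<Longrightarrow> tau z k i j = tau z i k j"
  unfolding tau_def by (rule rpart_rpart_F_commute(1)[OF diag_\<Omega>2'])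

text \<open>Along the diagonal the derivative has the holomorphic part \<open>tau z k i j\<close>
  and an antiholomorphic part, which \<open>vswap\<close> symmetry identifies as the conjugate of
  \<open>tau z k j i\<close>.\<close>

lemma rpart_bergman_metric:
  assumes z: "z \<in> \<Omega>"
  shows "rpart k (\<lambda>z. bergman_metric B z i j) z = 2 * Re (tau z k i j) + 2 * Re (tau z k j i)"
proof -
  let ?\<Phi> = "rpart (vjoin i 0) (F (vjoin 0 (vcnj j)))" and ?d = "vjoin z (vcnj z)"
  note d = diag_\<Omega>2'[OF z]
  have "rpart k (\<lambda>z. bergman_metric B z i j) z = rpart k (\<lambda>z. 2 * Re (?\<Phi> (vjoin z (vcnj z)))) z"
    by (rule rpart_cong[OF open_\<Omega> z]) (simp add: bergman_metric_eq herm_def)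
  also have "\<dots> = 2 * Re (rpart (vjoin k 0) ?\<Phi> ?d + rpart (vjoin 0 (vcnj k)) ?\<Phi> ?d)"
    by (rule rpart_eqI[OF has_derivative_mult_right[OF bounded_linear.has_derivative[OF bounded_linear_Re
          diag_has_derivative[OF F_holomorphic(2) z]]]])
  also have "rpart (vjoin 0 (vcnj k)) ?\<Phi> ?d = cnj (tau z k j i)"
  proof -
    have "cnj (rpart (vjoin 0 (vcnj k)) ?\<Phi> ?d) = rpart (vjoin k 0) (rpart (vjoin 0 (vcnj i)) (F (vjoin j 0))) ?d"
      using rpart_rpart_F_vswap[OF d, of "vjoin 0 (vcnj k)" "vjoin i 0" "vjoin 0 (vcnj j)"] by (simp add: vcnj_arith)
    also have "\<dots> = tau z k j i"
      unfolding tau_def by (rule rpart_rpart_F_commute(2)[OF d])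
    finally show ?thesis by (metis complex_cnj_cnj)
  qed
  finally show ?thesis by (simp add: tau_def)
qed

text \<open>The Christoffel integral produces a derivative with two antiholomorphic directions and
  one holomorphic; conjugating and reordering gives the metric derivative.\<close>

lemma Re_rpart_dscore:
  assumes z: "z \<in> \<Omega>"
  shows "Re (rpart k (dscore z i j) z) = Re (tau z i j k)"
proof -
  note d = diag_\<Omega>2'[OF z]
  have "cnj (rpart k (dscore z i j) z) = rpart (vjoin 0 (vcnj k)) (rpart (vjoin i 0) (F (vjoin j 0))) (vjoin z (vcnj z))"
    unfolding rpart_dscore[OF z]
    using rpart_rpart_F_vswap[OF d, of "vjoin k 0" "vjoin 0 (vcnj i)" "vjoin 0 (vcnj j)"] by (simp add: vcnj_arith)
  also have "\<dots> = rpart (vjoin i 0) (rpart (vjoin 0 (vcnj k)) (F (vjoin j 0))) (vjoin z (vcnj z))"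
    by (rule rpart_rpart_F_commute(1)[OF d])
  also have "\<dots> = tau z i j k"
    unfolding tau_def by (rule rpart_rpart_F_commute(2)[OF d])
  finally have "Re (cnj (rpart k (dscore z i j) z)) = Re (tau z i j k)" by (rule arg_cong)
  then show ?thesis by simp
qed

text \<open>The Bergman metric is a Kaehler metric, so its Levi-Civita connection is the Chern connection.\<close>

definition chern where
  "chern C \<longleftrightarrow> (\<forall>z\<in>\<Omega>. \<forall>i\<in>Basis. \<forall>j\<in>Basis. \<forall>k\<in>Basis. 2 * Re (herm z (C z i j) k) = 2 * Re (tau z i j k))"

text \<open>The term with \<open>\<alpha>\<close> multiplies a third moment and vanishes, so the
  same equations remain for every \<open>\<alpha>\<close>.\<close>

lemma is_alpha_connection_iff:
  assumes C: "condition_C 6 \<Omega> B"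
  shows "is_alpha_connection \<alpha> \<Omega> B \<Gamma> \<longleftrightarrow> chern \<Gamma>"
proof -
  have "expect \<Omega> B z (\<lambda>\<xi>. rpart i (loglik B \<xi>) z * rpart j (loglik B \<xi>) z * rpart k (loglik B \<xi>) z) = 0"
    if "z \<in> \<Omega>" "i \<in> Basis" "j \<in> Basis" "k \<in> Basis" for z i j k
    using third_moment_loglik(2)[OF C that] by (simp add: amari_chentsov_def)
  then show ?thesis
    unfolding is_alpha_connection_def chern_def
    by (simp add: fisher_metric_eq[OF C] christoffel_loglik[OF C] Re_rpart_dscore)
qed

lemma chern_exists:
  assumes C: "condition_C 6 \<Omega> B"
  shows "\<exists>\<Gamma>. chern \<Gamma>"
proof -
  have "\<forall>z i j. \<exists>c. z \<in> \<Omega> \<longrightarrow> (\<forall>k\<in>Basis. 2 * Re (herm z c k) = 2 * Re (tau z i j k))"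
  proof (intro allI)
    fix z i j :: "complex ^ 'n"
    show "\<exists>c. z \<in> \<Omega> \<longrightarrow> (\<forall>k\<in>Basis. 2 * Re (herm z c k) = 2 * Re (tau z i j k))"
    proof (cases "z \<in> \<Omega>")
      case True
      have "\<exists>c. \<forall>k\<in>Basis. 2 * Re (herm z c k) = 2 * Re (tau z i j k)"
        by (rule definite_form_represents(1)[OF linear_herm[OF True]]) (rule herm_definite[OF C True])
      then show ?thesis by blast
    qed simp
  qed
  then obtain \<Gamma> where "\<forall>z i j. z \<in> \<Omega> \<longrightarrow> (\<forall>k\<in>Basis. 2 * Re (herm z (\<Gamma> z i j) k) = 2 * Re (tau z i j k))"
    by metis
  then show ?thesis unfolding chern_def by blast
qed

lemma chern_unique:
  assumes C: "condition_C 6 \<Omega> B" and "chern \<Gamma>" "chern \<Gamma>'" and z: "z \<in> \<Omega>" and ij: "i \<in> Basis" "j \<in> Basis"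
  shows "\<Gamma> z i j = \<Gamma>' z i j"
proof (rule herm_eqI[OF C z])
  fix k :: "complex ^ 'n" assume "k \<in> Basis"
  then show "2 * Re (herm z (\<Gamma> z i j) k) = 2 * Re (herm z (\<Gamma>' z i j) k)"
    using assms unfolding chern_def by simp
qed

text \<open>From right to left, the Kaehler identity gives vanishing torsion and the formula for the
  metric derivative gives compatibility. The converse is the uniqueness argument for Levi-Civita
  connections, applied to the difference from the Chern coefficients.\<close>

lemma is_levi_civita_iff:
  assumes C: "condition_C 6 \<Omega> B"
  shows "is_levi_civita \<Omega> (bergman_metric B) \<Gamma> \<longleftrightarrow> chern \<Gamma>"
proof
  assume ch: "chern \<Gamma>"
  show "is_levi_civita \<Omega> (bergman_metric B) \<Gamma>"
    unfolding is_levi_civita_def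
  proof (intro conjI ballI)
    fix z i j :: "complex ^ 'n" assume z: "z \<in> \<Omega>" and ij: "i \<in> Basis" "j \<in> Basis"
    show "\<Gamma> z i j = \<Gamma> z j i"
    proof (rule herm_eqI[OF C z])
      fix k :: "complex ^ 'n" assume "k \<in> Basis"
      then show "2 * Re (herm z (\<Gamma> z i j) k) = 2 * Re (herm z (\<Gamma> z j i) k)"
        using ch z ij tau_commute[OF z, of i j k] unfolding chern_def by simp
    qed
  next
    fix z i j k :: "complex ^ 'n" assume z: "z \<in> \<Omega>" and ijk: "i \<in> Basis" "j \<in> Basis" "k \<in> Basis"
    have "2 * Re (herm z (\<Gamma> z k i) j) = 2 * Re (tau z k i j)" "2 * Re (herm z (\<Gamma> z k j) i) = 2 * Re (tau z k j i)"
      using ch z ijk unfolding chern_def by blast+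
    then show "rpart k (\<lambda>z. bergman_metric B z i j) z = bergman_metric B z (\<Gamma> z k i) j + bergman_metric B z i (\<Gamma> z k j)"
      unfolding rpart_bergman_metric[OF z] bergman_metric_eq[OF z] using Re_herm_commute[OF z, of i] by simp
  qed
next
  assume lc: "is_levi_civita \<Omega> (bergman_metric B) \<Gamma>"
  show "chern \<Gamma>"
    unfolding chern_def
  proof (intro ballI)
    fix z i j k :: "complex ^ 'n" assume z: "z \<in> \<Omega>" and ijk: "i \<in> Basis" "j \<in> Basis" "k \<in> Basis"
    \<comment> \<open>Symmetric in the first two arguments by torsion freeness and the Kaehler
      identity, skew in the last two by compatibility with the metric; both properties together
      force it to vanish.\<close>
    define \<Delta> where "\<Delta> i j k = Re (herm z (\<Gamma> z i j) k) - Re (tau z i j k)" for i j k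
    have sym\<Delta>: "\<Delta> i j k = \<Delta> j i k" if "i \<in> Basis" "j \<in> Basis" for i j k :: "complex ^ 'n"
      using lc z that tau_commute[OF z, of i j k] unfolding is_levi_civita_def \<Delta>_def by simp
    have skew: "\<Delta> k i j + \<Delta> k j i = 0" if "i \<in> Basis" "j \<in> Basis" "k \<in> Basis" for i j k
    proof -
      have "rpart k (\<lambda>z. bergman_metric B z i j) z = bergman_metric B z (\<Gamma> z k i) j + bergman_metric B z i (\<Gamma> z k j)"
        using lc z that unfolding is_levi_civita_def by blast
      then show ?thesis
        unfolding rpart_bergman_metric[OF z] bergman_metric_eq[OF z] using Re_herm_commute[OF z, of i "\<Gamma> z k j"]
        by (simp add: \<Delta>_def)
    qed
    have "\<Delta> i j k = 0"
      using skew[of j k i] skew[of i k j] skew[of i j k] sym\<Delta>[of i j k] sym\<Delta>[of i k j] sym\<Delta>[of j k i] ijk by simp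
    then show "2 * Re (herm z (\<Gamma> z i j) k) = 2 * Re (tau z i j k)" by (simp add: \<Delta>_def)
  qed
qed

end

theorem theorem3p22:
  fixes \<Omega> :: "(complex ^ 'n) set"
    and B :: "complex ^ 'n \<Rightarrow> complex ^ 'n \<Rightarrow> complex"
  assumes "domain \<Omega>" and "bounded \<Omega>" and "bergman_kernel \<Omega> B"
  shows
    "(condition_C 6 \<Omega> B \<longrightarrow>
        (\<forall>z\<in>\<Omega>. \<forall>i\<in>Basis. \<forall>j\<in>Basis. \<forall>k\<in>Basis.
           integrable (bergman_model \<Omega> B z)
             (\<lambda>\<xi>. rpart i (loglik B \<xi>) z * rpart j (loglik B \<xi>) z * rpart k (loglik B \<xi>) z) \<and>
           amari_chentsov \<Omega> B z i j k = 0)) \<and>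
     (condition_C 6 \<Omega> B \<longrightarrow>
        (\<forall>\<alpha>::real.
           (\<exists>C. is_alpha_connection \<alpha> \<Omega> B C) \<and>
           (\<exists>C. is_levi_civita \<Omega> (bergman_metric B) C) \<and>
           (\<forall>C C'. is_alpha_connection \<alpha> \<Omega> B C \<longrightarrow> is_levi_civita \<Omega> (bergman_metric B) C' \<longrightarrow>
              (\<forall>z\<in>\<Omega>. \<forall>i\<in>Basis. \<forall>j\<in>Basis. C z i j = C' z i j)))) \<and>
     ((\<forall>z\<in>\<Omega>. \<forall>w\<in>\<Omega>. \<exists>L. log_branch \<Omega> (\<lambda>\<xi>. B \<xi> z / B \<xi> w) L \<and>
          (\<lambda>\<xi>. B \<xi> z * L \<xi>) \<in> bergman_space \<Omega>) \<longrightarrow>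
        (\<forall>z\<in>\<Omega>. \<forall>w\<in>\<Omega>.
           chi_divergence_finite chi_plus (bergman_model \<Omega> B z) (bergman_model \<Omega> B w) \<and>
           chi_divergence_finite chi_minus (bergman_model \<Omega> B z) (bergman_model \<Omega> B w) \<and>
           chi_divergence chi_plus (bergman_model \<Omega> B z) (bergman_model \<Omega> B w) = diastasis B z w \<and>
           diastasis B z w = chi_divergence chi_minus (bergman_model \<Omega> B z) (bergman_model \<Omega> B w))) \<and>
     ((\<forall>z\<in>\<Omega>. \<exists>L. log_branch \<Omega> (\<lambda>\<xi>. B \<xi> z) L \<and>
          (\<lambda>\<xi>. B \<xi> z * L \<xi>) \<in> bergman_space \<Omega>) \<longrightarrow>
        (\<forall>z\<in>\<Omega>.
           set_integrable lebesgue \<Omega> (\<lambda>\<xi>. bergman_P B z \<xi> * ln (bergman_P B z \<xi>)) \<and>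
           bergman_entropy \<Omega> B z = - ln (Re (B z z))))"
proof -
  interpret bergman \<Omega> B by (rule bergman.intro[OF assms])
  show ?thesis
  proof (intro conjI impI, goal_cases)
    case 1
    then show ?case using third_moment_loglik by blast
  next
    case 2
    then show ?case
      unfolding is_alpha_connection_iff[OF 2] is_levi_civita_iff[OF 2]
      using chern_exists chern_unique by blast
  next
    case 3
    show ?case
      by (intro ballI conjI divergences divergences(4)[symmetric]) (use 3 in blast)+
  next
    case 4
    then show ?case using entropy by blast
  qed
qed

end
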